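(* There is a randomized LOCAL algorithm that computes a proper vertex coloring with colors from $\{1,\ldots,\Delta+1\}$ of any $n$-vertex graph with maximum degree $\Delta$ in $O(\log\Delta + \exp(O(\sqrt{\log\log n})))$ rounds with high probability.
   Context: LOCAL model: each vertex hosts a processor with a distinct ID, knows its neighbors and an upper bound on $n$ (and $\Delta$); synchronous rounds, unbounded messages per edge per round, free local computation; time = number of rounds. A proper coloring assigns colors so no edge is monochromatic. "With high probability" means with probability at least $1-1/n^c$ for an arbitrarily large fixed constant $c$. *)

theory Defs
  imports "HOL-Probability.Probability"
begin

text \<open>Graphs: vertices are natural numbers, which double as the distinct IDs.
  Edges are a symmetric irreflexive relation on the finite vertex set.\<close>

definition simple_graph :: "nat set \<Rightarrow> (nat \<times> nat) set \<Rightarrow> bool" where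
  "simple_graph V E \<longleftrightarrow> finite V \<and> E \<subseteq> V \<times> V \<and> sym E \<and> (\<forall>v. (v, v) \<notin> E)"

definition degree :: "(nat \<times> nat) set \<Rightarrow> nat \<Rightarrow> nat" where
  "degree E v = card {u. (v, u) \<in> E}"

definition max_degree :: "nat set \<Rightarrow> (nat \<times> nat) set \<Rightarrow> nat" where
  "max_degree V E = Max (insert 0 (degree E ` V))"

definition ball :: "(nat \<times> nat) set \<Rightarrow> nat \<Rightarrow> nat \<Rightarrow> nat set" where
  "ball E v T = {u. \<exists>k\<le>T. (v, u) \<in> E ^^ k}"

text \<open>Everything vertex v can know after T synchronous LOCAL rounds:
  its own ID, the IDs of all vertices within distance T, their private random
  inputs, and all edges incident to those vertices (each vertex initially knows
  the IDs of its neighbours).\<close>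
type_synonym view = "nat \<times> nat set \<times> (nat \<Rightarrow> nat) \<times> (nat \<times> nat) set"

definition local_view :: "(nat \<times> nat) set \<Rightarrow> (nat \<Rightarrow> nat) \<Rightarrow> nat \<Rightarrow> nat \<Rightarrow> view" where
  "local_view E r T v =
     (let B = ball E v T in (v, B, restrict r B, {(x, y). (x, y) \<in> E \<and> (x \<in> B \<or> y \<in> B)}))"

definition proper_coloring ::
  "nat set \<Rightarrow> (nat \<times> nat) set \<Rightarrow> nat \<Rightarrow> (nat \<Rightarrow> nat) \<Rightarrow> bool" where
  "proper_coloring V E k col \<longleftrightarrow>
     (\<forall>v\<in>V. col v \<in> {1..k}) \<and> (\<forall>(u, w)\<in>E. col u \<noteq> col w)"

text \<open>A randomized LOCAL algorithm is given by a round count T, a range R of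
  private random inputs (each vertex draws independently and uniformly from
  {0..<R}) and an output function f, all depending on the known upper bound N
  on n and on the maximum degree D. The output of v is f N D applied to its
  T-round view. Probability that the output is a proper (D+1)-coloring:\<close>
definition success_prob ::
  "(nat \<Rightarrow> nat \<Rightarrow> nat) \<Rightarrow> (nat \<Rightarrow> nat \<Rightarrow> nat) \<Rightarrow> (nat \<Rightarrow> nat \<Rightarrow> view \<Rightarrow> nat)
   \<Rightarrow> nat set \<Rightarrow> (nat \<times> nat) set \<Rightarrow> nat \<Rightarrow> real" where
  "success_prob T R f V E N =
     (let D = max_degree V E in
      measure_pmf.prob (pmf_of_set (PiE V (\<lambda>_. {..<R N D})))
        {r. proper_coloring V E (D + 1) (\<lambda>v. f N D (local_view E r (T N D) v))})"

end

theory Submission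
  imports Defs
begin

text \<open>Every round, each uncoloured vertex becomes active with probability 1/2 and tries a uniformly random
  colour of its palette; it fails only if an active lower neighbour tries the same one. Exposing the
  tried colours in the order of the vertex names shows that, given the activities, a set of vertices
  fails with probability at most the product of the ratios (active neighbours) / (uncoloured
  neighbours + 1). With \<open>m\<close> of order \<open>log n\<close>, Chernoff makes this exponentially small in \<open>m\<close> for any \<open>m\<close>
  vertices of uncoloured degree at least \<open>16 m\<close>, so after \<open>O(log \<Delta>)\<close> rounds no vertex has \<open>m\<close>
  uncoloured neighbours of high degree. Hence the high vertices induce a graph of degree
  \<open>O(log n)\<close>, and so do the low ones. On each of these two graphs another \<open>O(log log n)\<close> rounds shatter
  the uncoloured vertices into components of polylogarithmic size. There the random IDs are
  compressed to \<open>O(log log n)\<close> bits by reducing them modulo a small number, the deterministic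
  clustering of Rozhon and Ghaffari puts at least half of every component into non-adjacent
  clusters of radius \<open>poly(log log n)\<close>, these are coloured by brute force, and \<open>O(log log n)\<close>
  repetitions finish. The total \<open>O(log \<Delta>) + poly(log log n)\<close> is within the claimed bound.

  A vertex colour 0 means uncoloured throughout.\<close>

section \<open>Locality\<close>

text \<open>A palette may exceed the uncoloured neighbours by only one colour, so if all vertices
  tried at once the blocking ratio could come arbitrarily close to 1; the activity coin keeps its
  mean at most 3/4. Given the activities the failures multiply, so only the activities remain
  correlated. Vertices with many uncoloured neighbours are handled by concentration, which tolerates
  shared neighbours; vertices of bounded degree by selecting some with disjoint neighbourhoods. The
  price of disjointness is polynomial in the degree, so degrees must be reduced before shattering.

  Vertex names are unbounded and cannot serve as labels, hence the random IDs. Clustering needs one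
  phase per label bit, and labels of order \<open>log n\<close> bits would cost poly(log n) rounds;
  this obstacle is what the reduction modulo a small number removes.

  Probabilities are ratios of cardinalities of sets of lists of assignments. The range of the random
  words is a common multiple of all numbers by which words are reduced, so residues are exactly
  uniform.\<close>

definition agree :: "nat \<Rightarrow> (nat \<times> nat) set \<Rightarrow> (nat \<Rightarrow> 'a) \<Rightarrow> (nat \<times> nat) set \<Rightarrow> (nat \<Rightarrow> 'a) \<Rightarrow> nat \<Rightarrow> bool" where
  "agree T E X E' X' v \<longleftrightarrow>
     ball E v T = ball E' v T \<and> (\<forall>u\<in>ball E v T. X u = X' u) \<and>
     (\<forall>x y. x \<in> ball E v T \<or> y \<in> ball E v T \<longrightarrow> (x, y) \<in> E \<longleftrightarrow> (x, y) \<in> E')"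

text \<open>The input type is arbitrary, so the output of one stage can be the input of the next.
  All pairs of instances are compared, not only valid graphs, because a truncated view is used as an
  instance too.\<close>

definition loc :: "nat \<Rightarrow> ((nat \<times> nat) set \<Rightarrow> (nat \<Rightarrow> 'a) \<Rightarrow> nat \<Rightarrow> 'b) \<Rightarrow> bool" where
  "loc T F \<longleftrightarrow> (\<forall>E X E' X' v. agree T E X E' X' v \<longrightarrow> F E X v = F E' X' v)"

lemma ball_refl [simp]: "v \<in> ball E v T"
  by (auto simp: ball_def intro!: exI[of _ 0])

lemma ball_mono: "T \<le> T' \<Longrightarrow> ball E v T \<subseteq> ball E v T'"
  unfolding ball_def by (auto intro: order_trans)

lemma ball_zero [simp]: "ball E v 0 = {v}"
  by (auto simp: ball_def)

lemma ball_trans: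
  assumes "u \<in> ball E v d" "w \<in> ball E u T"
  shows "w \<in> ball E v (T + d)"
proof -
  from assms obtain i j where "i \<le> d" "(v, u) \<in> E ^^ i" "j \<le> T" "(u, w) \<in> E ^^ j"
    by (auto simp: ball_def)
  then have "(v, w) \<in> E ^^ (i + j)" "i + j \<le> T + d"
    by (auto simp: relpow_add)
  then show ?thesis by (auto simp: ball_def)
qed

lemma ball_step:
  assumes "u \<in> ball E v d" "(u, w) \<in> E"
  shows "w \<in> ball E v (Suc d)"
proof -
  have "w \<in> ball E u 1" using assms(2) by (auto simp: ball_def intro!: exI[of _ "1::nat"])
  with assms(1) show ?thesis using ball_trans by fastforce
qed

lemma ball_edge: "(v, w) \<in> E \<Longrightarrow> 0 < d \<Longrightarrow> w \<in> ball E v d"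
  using ball_step[of v E v 0 w] ball_mono[of "Suc 0" d E v] by auto

lemma ball_Suc: "ball E v (Suc k) = ball E v k \<union> E `` ball E v k"
proof (intro set_eqI iffI)
  fix w assume "w \<in> ball E v (Suc k)"
  then obtain i where i: "i \<le> Suc k" "(v, w) \<in> E ^^ i" by (auto simp: ball_def)
  show "w \<in> ball E v k \<union> E `` ball E v k"
  proof (cases i)
    case 0
    then show ?thesis using i by auto
  next
    case (Suc j)
    then obtain x where "(v, x) \<in> E ^^ j" "(x, w) \<in> E" using i by auto
    then show ?thesis using i Suc by (auto simp: ball_def)
  qed
qed (use ball_mono[of k "Suc k" E v] ball_step in auto)

lemma ball_sym:
  assumes "sym E" "u \<in> ball E v d" shows "v \<in> ball E u d"
proof -
  have "sym (E ^^ i)" for i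
    by (induction i) (use \<open>sym E\<close> in \<open>auto simp: sym_conv_converse_eq converse_relcomp relpow_commute\<close>)
  then show ?thesis using assms(2) by (auto simp: ball_def dest: symD)
qed

lemma ball_mono_rel: "E \<subseteq> E' \<Longrightarrow> ball E v d \<subseteq> ball E' v d"
proof (induction d)
  case (Suc d)
  then show ?case unfolding ball_Suc by blast
qed simp

text \<open>The \<open>T\<close>-ball of \<open>u\<close> lies inside the
  \<open>(T + d)\<close>-ball of \<open>v\<close>, where both graphs have the same edges; so the
  balls of \<open>u\<close> in the two graphs grow identically, layer by layer.\<close>

lemma agree_at:
  assumes a: "agree (T + d) E X E' X' v" and u: "u \<in> ball E v d"
  shows "agree T E X E' X' u"
proof -
  let ?B = "ball E v (T + d)"
  have edge: "(x, y) \<in> E \<longleftrightarrow> (x, y) \<in> E'" if "x \<in> ?B \<or> y \<in> ?B" for x y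
    using a that by (auto simp: agree_def)
  have eq: "ball E u k = ball E' u k" if "k \<le> T" for k
    using that
  proof (induction k)
    case (Suc k)
    have "ball E u k \<subseteq> ?B"
      using ball_trans[OF u] Suc.prems ball_mono[of "k + d" "T + d" E v] by fastforce
    then have "E `` ball E u k = E' `` ball E u k"
      using edge by blast
    then show ?case using Suc by (simp add: ball_Suc)
  qed simp
  have sub: "ball E u T \<subseteq> ?B" using ball_trans[OF u] by blast
  show ?thesis unfolding agree_def
    using eq[of T] sub edge a by (auto simp: agree_def)
qed

lemma agree_mono: "agree T E X E' X' v \<Longrightarrow> T' \<le> T \<Longrightarrow> agree T' E X E' X' v"
  using agree_at[of T' "T - T'" E X E' X' v v] by simp

lemma loc_mono:
  fixes F :: "(nat \<times> nat) set \<Rightarrow> (nat \<Rightarrow> 'a) \<Rightarrow> nat \<Rightarrow> 'b"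
  assumes "loc T F" "T \<le> T'" shows "loc T' F"
  unfolding loc_def
proof (intro allI impI)
  fix E E' :: "(nat \<times> nat) set" and X X' :: "nat \<Rightarrow> 'a" and v
  assume "agree T' E X E' X' v"
  then have "agree T E X E' X' v" using agree_mono assms(2) by blast
  then show "F E X v = F E' X' v" using assms(1) unfolding loc_def by blast
qed

text \<open>Radii add: whatever the second stage reads within distance \<open>d\<close> was computed
  by the first stage from balls of radius \<open>T\<close> that the \<open>(T + d)\<close>-ball of
  \<open>v\<close> contains.\<close>

lemma loc_comp:
  fixes F :: "(nat \<times> nat) set \<Rightarrow> (nat \<Rightarrow> 'a) \<Rightarrow> nat \<Rightarrow> 'b"
  assumes F: "loc T F" and G: "loc d G"
  shows "loc (T + d) (\<lambda>E X. G E (F E X))"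
  unfolding loc_def
proof (intro allI impI)
  fix E E' :: "(nat \<times> nat) set" and X X' :: "nat \<Rightarrow> 'a" and v
  assume a: "agree (T + d) E X E' X' v"
  have "F E X u = F E' X' u" if "u \<in> ball E v d" for u
    using agree_at[OF a that] F by (auto simp: loc_def)
  moreover have "agree d E X E' X' v" using agree_mono[OF a] by simp
  ultimately have "agree d E (F E X) E' (F E' X') v" by (auto simp: agree_def)
  then show "G E (F E X) v = G E' (F E' X') v" using G by (auto simp: loc_def)
qed

lemma loc_map: "loc T F \<Longrightarrow> loc T (\<lambda>E X v. f (F E X v))"
  unfolding loc_def by metis

lemma loc_Pair: "loc T F \<Longrightarrow> loc T G \<Longrightarrow> loc T (\<lambda>E X v. (F E X v, G E X v))"
  unfolding loc_def by (metis (no_types, lifting))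

lemma loc_input: "loc T (\<lambda>E X v. f (X v))"
  by (auto simp: loc_def agree_def)

lemma loc_const: "loc T (\<lambda>E X v. c)"
  by (auto simp: loc_def)

lemma agree_Image: "agree T E X E' X' v \<Longrightarrow> x \<in> ball E v T \<Longrightarrow> E `` {x} = E' `` {x}"
  by (auto simp: agree_def)

text \<open>A view is itself an instance: its truncated edge set and restricted inputs agree with
  the real ones up to distance \<open>T\<close>. So the output function can run \<open>F\<close> on
  the view.\<close>

lemma ex_view_function:
  assumes "loc T F"
  shows "\<exists>f. \<forall>E r v. f (local_view E r T v) = F E r v"
proof (intro exI allI)
  fix E :: "(nat \<times> nat) set" and r :: "nat \<Rightarrow> nat" and v
  let ?f = "\<lambda>(v, B, r, E). F E r v"
  let ?B = "ball E v T"
  let ?E = "{(x, y). (x, y) \<in> E \<and> (x \<in> ?B \<or> y \<in> ?B)}"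
  have "ball ?E v k = ball E v k" if "k \<le> T" for k
    using that
  proof (induction k)
    case (Suc k)
    have "ball E v k \<subseteq> ?B" using Suc.prems ball_mono[of k T] by simp
    then have "?E `` ball E v k = E `` ball E v k" by blast
    then show ?case using Suc by (simp add: ball_Suc)
  qed simp
  then have "agree T E r ?E (restrict r ?B) v" by (auto simp: agree_def)
  then show "?f (local_view E r T v) = F E r v"
    using assms by (simp add: local_view_def Let_def loc_def)
qed

section \<open>Counting over product spaces\<close>

text \<open>Chain rule in counting form. Dropping the largest coordinate leaves the conditions at
  smaller ones intact and costs a factor \<open>p b\<close> whatever was exposed before, so the
  factors multiply without any independence.\<close>

lemma card_PiE_sequential_le:
  fixes V :: "nat set" and B :: "'b set" and p :: "nat \<Rightarrow> real"
  assumes "finite V" "finite B"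
    and "\<And>v X X'. v \<in> V \<Longrightarrow> (\<And>u. u \<le> v \<Longrightarrow> X u = X' u) \<Longrightarrow> bad v X = bad v X'"
    and "\<And>v X. v \<in> V \<Longrightarrow> card {x \<in> B. bad v (X(v := x))} \<le> p v * card B"
  shows "card {X \<in> V \<rightarrow>\<^sub>E B. \<forall>v\<in>V. bad v X} \<le> (\<Prod>v\<in>V. p v) * card B ^ card V"
  using assms(1,3,4)
proof (induction V rule: finite_linorder_max_induct)
  case empty
  then show ?case by simp
next
  case (insert b A)
  let ?G = "{X \<in> A \<rightarrow>\<^sub>E B. \<forall>v\<in>A. bad v X}"
  let ?H = "\<lambda>X. {x \<in> B. bad b (X(b := x))}"
  have bA: "b \<notin> A" using insert.hyps by blast
  have finG: "finite ?G"
    using insert.hyps(1) assms(2) by (intro finite_subset[of ?G "A \<rightarrow>\<^sub>E B"] finite_PiE) auto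
  have "{X \<in> insert b A \<rightarrow>\<^sub>E B. \<forall>v\<in>insert b A. bad v X} \<subseteq> (\<lambda>(X, x). X(b := x)) ` (SIGMA X:?G. ?H X)"
  proof
    fix Y assume "Y \<in> {X \<in> insert b A \<rightarrow>\<^sub>E B. \<forall>v\<in>insert b A. bad v X}"
    then have Y: "Y \<in> insert b A \<rightarrow>\<^sub>E B" and bad: "\<forall>v\<in>insert b A. bad v Y" by auto
    from Y obtain x X where x: "x \<in> B" and X: "X \<in> A \<rightarrow>\<^sub>E B" and eq: "Y = X(b := x)"
      by (auto simp: PiE_insert_eq)
    have "bad v X" if "v \<in> A" for v
    proof -
      have "bad v Y = bad v X"
        using insert.prems(1)[of v Y X] insert.hyps(2) that unfolding eq by fastforce
      then show ?thesis using bad that by simp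
    qed
    then show "Y \<in> (\<lambda>(X, x). X(b := x)) ` (SIGMA X:?G. ?H X)"
      using bad eq x X by (intro image_eqI[of _ _ "(X, x)"]) auto
  qed
  then have "card {X \<in> insert b A \<rightarrow>\<^sub>E B. \<forall>v\<in>insert b A. bad v X} \<le> card (SIGMA X:?G. ?H X)"
    using finG assms(2) by (intro surj_card_le) auto
  also have "\<dots> = (\<Sum>X\<in>?G. card (?H X))"
    using finG assms(2) by (intro card_SigmaI) auto
  also have "real \<dots> \<le> (\<Sum>X\<in>?G. p b * card B)"
    unfolding of_nat_sum by (intro sum_mono insert.prems(2)) auto
  also have "\<dots> = card ?G * (p b * card B)" by simp
  also have "\<dots> \<le> ((\<Prod>v\<in>A. p v) * card B ^ card A) * (p b * card B)"
  proof (rule mult_right_mono)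
    show "card ?G \<le> (\<Prod>v\<in>A. p v) * card B ^ card A"
    proof (rule insert.IH)
      show "bad v X = bad v X'" if "v \<in> A" "\<And>u. u \<le> v \<Longrightarrow> X u = X' u" for v X X'
        by (rule insert.prems(1)) (use that in simp_all)
      show "card {x \<in> B. bad v (X(v := x))} \<le> p v * card B" if "v \<in> A" for v X
        by (rule insert.prems(2)) (use that in simp)
    qed
    show "0 \<le> p b * card B"
      by (rule order_trans[OF _ insert.prems(2)[of b undefined]]) simp_all
  qed
  finally show ?case
    using insert.hyps(1) bA by (simp add: mult_ac)
qed

text \<open>Exchanging the coordinates in \<open>J\<close> is an involution on pairs of assignments; it turns
  \<open>(a, a')\<close>-summands \<open>f a * h a'\<close> into \<open>f c * h c\<close>.\<close>
lemma sum_PiE_independent: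
  fixes f h :: "('a \<Rightarrow> 'b) \<Rightarrow> real"
  assumes f: "\<And>X X'. (\<And>v. v \<in> J \<Longrightarrow> X v = X' v) \<Longrightarrow> f X = f X'"
    and h: "\<And>X X'. (\<And>v. v \<notin> J \<Longrightarrow> X v = X' v) \<Longrightarrow> h X = h X'"
  shows "(\<Sum>X\<in>V \<rightarrow>\<^sub>E B. f X) * (\<Sum>X\<in>V \<rightarrow>\<^sub>E B. h X) = card (V \<rightarrow>\<^sub>E B) * (\<Sum>X\<in>V \<rightarrow>\<^sub>E B. f X * h X)"
proof -
  let ?Q = "V \<rightarrow>\<^sub>E B"
  let ?m = "\<lambda>a a' v. if v \<in> J then a v else a' v"
  let ?s = "\<lambda>(a, a'). (?m a a', ?m a' a)"
  have m: "?m a a' \<in> ?Q" if "a \<in> ?Q" "a' \<in> ?Q" for a a'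
    using that by (auto simp: PiE_def Pi_def extensional_def)
  have ss: "?s (?s p) = p" for p by (cases p) (auto simp: fun_eq_iff)
  have ssQ: "?s p \<in> ?Q \<times> ?Q" if "p \<in> ?Q \<times> ?Q" for p
    using that m[of "fst p" "snd p"] m[of "snd p" "fst p"] by (auto simp: case_prod_unfold)
  have "(\<Sum>X\<in>?Q. f X) * (\<Sum>X\<in>?Q. h X) = (\<Sum>(a, a')\<in>?Q \<times> ?Q. f a * h a')"
    by (simp add: sum_product sum.cartesian_product)
  also have "\<dots> = (\<Sum>(a, a')\<in>?Q \<times> ?Q. f a * h a)"
  proof (rule sum.reindex_bij_witness[where i = ?s and j = ?s])
    fix p assume "p \<in> ?Q \<times> ?Q"
    then show "(case ?s p of (a, a') \<Rightarrow> f a * h a) = (case p of (a, a') \<Rightarrow> f a * h a')"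
      using f[of "?m (fst p) (snd p)" "fst p"] h[of "?m (fst p) (snd p)" "snd p"]
      by (auto simp: case_prod_unfold)
  qed (use ss ssQ in blast)+
  also have "\<dots> = card ?Q * (\<Sum>X\<in>?Q. f X * h X)"
    by (simp add: sum.cartesian_product[symmetric] sum_distrib_left)
  finally show ?thesis .
qed

text \<open>Factors reading disjoint coordinate sets are independent, so means multiply. One factor
  is split off at a time; multiplying through by the number of assignments avoids division.\<close>

lemma sum_PiE_prod_independent_le:
  fixes g :: "'c \<Rightarrow> ('a \<Rightarrow> 'b) \<Rightarrow> real" and \<rho> :: real
  assumes "finite V" "finite B" "B \<noteq> {}" "finite S"
    and dep: "\<And>v X X'. v \<in> S \<Longrightarrow> (\<And>u. u \<in> J v \<Longrightarrow> X u = X' u) \<Longrightarrow> g v X = g v X'"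
    and disj: "\<And>u v. u \<in> S \<Longrightarrow> v \<in> S \<Longrightarrow> u \<noteq> v \<Longrightarrow> J u \<inter> J v = {}"
    and nonneg: "\<And>v X. v \<in> S \<Longrightarrow> g v X \<ge> 0"
    and avg: "\<And>v. v \<in> S \<Longrightarrow> (\<Sum>X\<in>V \<rightarrow>\<^sub>E B. g v X) \<le> \<rho> * card (V \<rightarrow>\<^sub>E B)"
  shows "(\<Sum>X\<in>V \<rightarrow>\<^sub>E B. \<Prod>v\<in>S. g v X) \<le> \<rho> ^ card S * card (V \<rightarrow>\<^sub>E B)"
proof -
  let ?Q = "V \<rightarrow>\<^sub>E B"
  have pos: "real (card ?Q) > 0"
    using assms(1-3) by (auto simp: card_gt_0_iff PiE_eq_empty_iff intro: finite_PiE)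
  show ?thesis
    using assms(4-)
  proof (induction S rule: finite_induct)
    case empty
    then show ?case by simp
  next
    case (insert x S)
    have "card ?Q * (\<Sum>X\<in>?Q. \<Prod>v\<in>insert x S. g v X) = card ?Q * (\<Sum>X\<in>?Q. g x X * (\<Prod>v\<in>S. g v X))"
      using insert.hyps by simp
    also have "\<dots> = (\<Sum>X\<in>?Q. g x X) * (\<Sum>X\<in>?Q. \<Prod>v\<in>S. g v X)"
    proof (rule sum_PiE_independent[of "J x", symmetric])
      fix X X' :: "'a \<Rightarrow> 'b"
      assume eq: "\<And>v. v \<notin> J x \<Longrightarrow> X v = X' v"
      show "(\<Prod>v\<in>S. g v X) = (\<Prod>v\<in>S. g v X')"
      proof (intro prod.cong refl insert.prems(1))
        fix v u assume "v \<in> S" "u \<in> J v"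
        then show "X u = X' u" using insert.prems(2)[of x v] insert.hyps eq by blast
      qed auto
    next
      fix X X' :: "'a \<Rightarrow> 'b"
      assume "\<And>v. v \<in> J x \<Longrightarrow> X v = X' v"
      then show "g x X = g x X'" by (intro insert.prems(1)) auto
    qed
    also have "\<dots> \<le> (\<rho> * card ?Q) * (\<rho> ^ card S * card ?Q)"
    proof (rule mult_mono)
      show "(\<Sum>X\<in>?Q. \<Prod>v\<in>S. g v X) \<le> \<rho> ^ card S * card ?Q"
      proof (rule insert.IH)
        show "g v X = g v X'" if "v \<in> S" "\<And>u. u \<in> J v \<Longrightarrow> X u = X' u" for v X X'
          by (rule insert.prems(1)) (use that in simp_all)
        show "J u \<inter> J v = {}" if "u \<in> S" "v \<in> S" "u \<noteq> v" for u v
          by (rule insert.prems(2)) (use that in simp_all)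
        show "g v X \<ge> 0" if "v \<in> S" for v X
          by (rule insert.prems(3)) (use that in simp_all)
        show "(\<Sum>X\<in>?Q. g v X) \<le> \<rho> * card ?Q" if "v \<in> S" for v
          by (rule insert.prems(4)) (use that in simp_all)
      qed
      show le: "(\<Sum>X\<in>?Q. g x X) \<le> \<rho> * card ?Q" by (rule insert.prems(4)) simp
      have "0 \<le> (\<Sum>X\<in>?Q. g x X)" by (intro sum_nonneg insert.prems(3)) auto
      with le show "0 \<le> \<rho> * card ?Q" by linarith
      show "0 \<le> (\<Sum>X\<in>?Q. \<Prod>v\<in>S. g v X)"
        by (intro sum_nonneg prod_nonneg insert.prems(3)) auto
    qed
    also have "\<dots> = card ?Q * (\<rho> ^ card (insert x S) * card ?Q)"
      using insert.hyps by simp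
    finally show ?case using pos by simp
  qed
qed

text \<open>Reduction modulo a divisor of \<open>q\<close> is uniform on \<open>{..<q}\<close>. This
  is why the range of the random words is made divisible by every possible palette size.\<close>

lemma card_mod_eq_le:
  assumes "k dvd q" "0 < k" shows "card {x \<in> {..<q}. x mod k = j} \<le> q div k"
proof -
  have "{x \<in> {..<q}. x mod k = j} \<subseteq> (\<lambda>i. i * k + j) ` {..<q div k}"
  proof
    fix x assume "x \<in> {x \<in> {..<q}. x mod k = j}"
    then have x: "x < q" "x mod k = j" by auto
    have "x div k < q div k" using x assms by (metis div_less_iff_less_mult dvd_div_mult_self)
    moreover have "x = x div k * k + j" using x by (metis div_mult_mod_eq)
    ultimately show "x \<in> (\<lambda>i. i * k + j) ` {..<q div k}" by blast
  qed
  then have "card {x \<in> {..<q}. x mod k = j} \<le> card {..<q div k}"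
    by (intro surj_card_le) auto
  then show ?thesis by simp
qed

lemma card_evens:
  assumes "even (q::nat)" shows "card {x \<in> {..<q}. even x} * 2 = q"
proof -
  have "{x \<in> {..<q}. even x} = (*) 2 ` {..<q div 2}"
    using assms by (auto elim!: evenE)
  then show ?thesis using assms by (simp add: card_image inj_on_def)
qed

lemma card_even_PiE:
  assumes "finite V" "J \<subseteq> V" "even (q::nat)"
  shows "card {a \<in> V \<rightarrow>\<^sub>E {..<q}. \<forall>v\<in>J. even (a v)} * 2 ^ card J = q ^ card V"
proof -
  let ?e = "card {x \<in> {..<q}. even x}"
  have "{a \<in> V \<rightarrow>\<^sub>E {..<q}. \<forall>v\<in>J. even (a v)} = (\<Pi>\<^sub>E v\<in>V. if v \<in> J then {x \<in> {..<q}. even x} else {..<q})"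
    (is "?L = ?R")
  proof (intro set_eqI iffI)
    fix a assume a: "a \<in> ?R"
    have "a v < q \<and> (v \<in> J \<longrightarrow> even (a v))" if "v \<in> V" for v
      using PiE_mem[OF a that] by (auto split: if_splits)
    then show "a \<in> ?L" using a assms(2) by (auto simp: PiE_iff)
  qed (auto simp: PiE_iff)
  then have "card {a \<in> V \<rightarrow>\<^sub>E {..<q}. \<forall>v\<in>J. even (a v)} = (\<Prod>v\<in>V. if v \<in> J then ?e else q)"
    using assms(1) by (simp add: card_PiE if_distrib[of card] cong: if_cong)
  also have "\<dots> = ?e ^ card J * q ^ card (V - J)"
    using assms(1,2) by (simp add: prod.If_cases Int_absorb1 Diff_eq Collect_neg_eq)
  finally have "card {a \<in> V \<rightarrow>\<^sub>E {..<q}. \<forall>v\<in>J. even (a v)} * 2 ^ card J = (?e * 2) ^ card J * q ^ card (V - J)"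
    by (simp add: power_mult_distrib)
  also have "\<dots> = q ^ card V"
    using assms card_evens[of q] card_mono[of V J] finite_subset[of J V]
    by (simp add: card_Diff_subset power_add[symmetric])
  finally show ?thesis .
qed

section \<open>One round of colour trials\<close>

definition palette :: "nat \<Rightarrow> (nat \<times> nat) set \<Rightarrow> (nat \<Rightarrow> nat) \<Rightarrow> nat \<Rightarrow> nat set" where
  "palette D E \<sigma> v = {1..D + 1} - \<sigma> ` (E `` {v})"

text \<open>The random word comes from one fixed range although palettes change between rounds; the
  residue turns it into a uniform choice when the palette size divides that range.\<close>

definition pick :: "nat \<Rightarrow> (nat \<times> nat) set \<Rightarrow> (nat \<Rightarrow> nat) \<Rightarrow> (nat \<Rightarrow> nat) \<Rightarrow> nat \<Rightarrow> nat" where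
  "pick D E \<sigma> y v = sorted_list_of_set (palette D E \<sigma> v) ! (y v mod card (palette D E \<sigma> v))"

definition rivals :: "(nat \<times> nat) set \<Rightarrow> nat set \<Rightarrow> (nat \<Rightarrow> nat) \<Rightarrow> nat \<Rightarrow> nat set" where
  "rivals E P \<sigma> v = {u \<in> E `` {v}. u \<in> P \<and> \<sigma> u = 0}"

text \<open>Even \<open>a v\<close> means active. Only lower names block, and they block even if
  they fail themselves; thus success is decided by the picks at \<open>v\<close> and at lower
  vertices, as sequential exposure requires.\<close>

definition trial :: "nat \<Rightarrow> (nat \<times> nat) set \<Rightarrow> nat set \<Rightarrow> (nat \<Rightarrow> nat) \<Rightarrow> (nat \<Rightarrow> nat) \<Rightarrow> (nat \<Rightarrow> nat) \<Rightarrow> nat \<Rightarrow> nat" where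
  "trial D E P \<sigma> a y v =
     (if v \<in> P \<and> \<sigma> v = 0 \<and> even (a v) \<and>
         (\<forall>u\<in>rivals E P \<sigma> v. even (a u) \<and> u < v \<longrightarrow> pick D E \<sigma> y u \<noteq> pick D E \<sigma> y v)
      then pick D E \<sigma> y v else \<sigma> v)"

fun trials :: "nat \<Rightarrow> (nat \<times> nat) set \<Rightarrow> nat set \<Rightarrow> (nat \<Rightarrow> nat) \<Rightarrow> (nat \<Rightarrow> nat) list \<Rightarrow> nat \<Rightarrow> nat" where
  "trials D E P \<sigma> (a # y # zs) = trials D E P (trial D E P \<sigma> a y) zs"
| "trials D E P \<sigma> zs = \<sigma>"

definition partial_coloring :: "nat \<Rightarrow> (nat \<times> nat) set \<Rightarrow> (nat \<Rightarrow> nat) \<Rightarrow> bool" where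
  "partial_coloring D E \<sigma> \<longleftrightarrow> (\<forall>v. \<sigma> v \<le> D + 1) \<and> (\<forall>(u, v)\<in>E. \<sigma> u \<noteq> 0 \<longrightarrow> \<sigma> u \<noteq> \<sigma> v)"

lemma finite_palette [simp]: "finite (palette D E \<sigma> v)"
  by (simp add: palette_def)

lemma pick_in_palette:
  assumes "palette D E \<sigma> v \<noteq> {}" shows "pick D E \<sigma> y v \<in> palette D E \<sigma> v"
proof -
  let ?A = "palette D E \<sigma> v"
  have "y v mod card ?A < length (sorted_list_of_set ?A)"
    using assms by (simp add: card_gt_0_iff)
  then have "pick D E \<sigma> y v \<in> set (sorted_list_of_set ?A)"
    unfolding pick_def by (rule nth_mem)
  then show ?thesis by simp
qed

lemma trial_colored: "\<sigma> v \<noteq> 0 \<Longrightarrow> trial D E P \<sigma> a y v = \<sigma> v"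
  by (simp add: trial_def)

lemma trial_outside: "v \<notin> P \<Longrightarrow> trial D E P \<sigma> a y v = \<sigma> v"
  by (simp add: trial_def)

lemma trials_colored: "\<sigma> v \<noteq> 0 \<Longrightarrow> trials D E P \<sigma> zs v = \<sigma> v"
  by (induction D E P \<sigma> zs rule: trials.induct) (simp_all add: trial_colored)

lemma trials_outside: "v \<notin> P \<Longrightarrow> trials D E P \<sigma> zs v = \<sigma> v"
  by (induction D E P \<sigma> zs rule: trials.induct) (simp_all add: trial_outside)

locale bounded_graph =
  fixes V :: "nat set" and E :: "(nat \<times> nat) set" and D :: nat
  assumes fin: "finite V" and edges: "E \<subseteq> V \<times> V" and sym_edges: "sym E"
    and irrefl: "(v, v) \<notin> E" and deg: "card (E `` {v}) \<le> D"
begin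

lemma finite_nbs [simp]: "finite (E `` {v})"
  using edges fin by (intro finite_subset[of "E `` {v}" V]) auto

lemma finite_rivals [simp]: "finite (rivals E P \<sigma> v)"
  by (rule finite_subset[OF _ finite_nbs[of v]]) (auto simp: rivals_def)

lemma finite_filter_nbs [simp]: "finite {u. (v, u) \<in> E \<and> Q u}"
  by (rule finite_subset[OF _ finite_nbs[of v]]) auto

lemma edge_sym: "(u, v) \<in> E \<Longrightarrow> (v, u) \<in> E"
  using sym_edges by (auto dest: symD)

text \<open>Each of the at most \<open>D\<close> neighbours either removes at most one of
  \<open>D + 1\<close> colours or is uncoloured. The surplus of one is the \<open>+ 1\<close> in the
  denominator of \<open>block_prob\<close>.\<close>

lemma rivals_less_palette: "card (rivals E P \<sigma> v) + 1 \<le> card (palette D E \<sigma> v)"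
proof -
  let ?U = "{u \<in> E `` {v}. \<sigma> u = 0}" and ?C = "{u \<in> E `` {v}. \<sigma> u \<noteq> 0}"
  have "card ?U + card ?C = card (E `` {v})"
    by (subst card_Un_disjoint[symmetric]) (auto intro!: arg_cong[of _ _ card])
  moreover have "card (rivals E P \<sigma> v) \<le> card ?U"
    by (intro card_mono) (auto simp: rivals_def)
  moreover have "palette D E \<sigma> v = {1..D + 1} - \<sigma> ` ?C"
    by (force simp: palette_def)
  moreover have "card {1..D + 1} - card (\<sigma> ` ?C) \<le> card ({1..D + 1} - \<sigma> ` ?C)"
    by (intro diff_card_le_card_Diff) auto
  moreover have "card (\<sigma> ` ?C) \<le> card ?C" by (intro card_image_le) auto
  ultimately show ?thesis using deg[of v] by simp
qed

lemma palette_nonempty: "palette D E \<sigma> v \<noteq> {}"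
  using rivals_less_palette[of UNIV \<sigma> v] by auto

lemma card_palette: "card (palette D E \<sigma> v) \<in> {1..D + 1}"
proof -
  have "card (palette D E \<sigma> v) \<le> card {1..D + 1}"
    by (intro card_mono) (auto simp: palette_def)
  then show ?thesis using rivals_less_palette[of UNIV \<sigma> v] by auto
qed

lemma pick_palette: "pick D E \<sigma> y v \<in> palette D E \<sigma> v"
  by (intro pick_in_palette palette_nonempty)

lemma partial_coloring_trial:
  assumes pc: "partial_coloring D E \<sigma>"
  shows "partial_coloring D E (trial D E P \<sigma> a y)"
proof -
  let ?t = "trial D E P \<sigma> a y" and ?p = "pick D E \<sigma> y"
  have new: "?t v = ?p v \<and> v \<in> P \<and> even (a v) \<and>
     (\<forall>u\<in>rivals E P \<sigma> v. even (a u) \<and> u < v \<longrightarrow> ?p u \<noteq> ?p v)" if "\<sigma> v = 0" "?t v \<noteq> 0" for v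
    using that by (auto simp: trial_def split: if_splits)
  have "?t v \<le> D + 1" for v
    using pc pick_palette[of \<sigma> y v] by (auto simp: trial_def partial_coloring_def palette_def)
  moreover have "?t u \<noteq> ?t v" if "(u, v) \<in> E" "?t u \<noteq> 0" for u v
  proof
    assume eq: "?t u = ?t v"
    have vu: "(v, u) \<in> E" using that(1) by (rule edge_sym)
    have uv: "u \<noteq> v" using that(1) irrefl by blast
    consider "\<sigma> u \<noteq> 0" "\<sigma> v \<noteq> 0" | "\<sigma> u \<noteq> 0" "\<sigma> v = 0" | "\<sigma> u = 0" "\<sigma> v \<noteq> 0" | "\<sigma> u = 0" "\<sigma> v = 0"
      by blast
    then show False
    proof cases
      case 1
      then show False using eq that(1) pc by (auto simp: trial_colored partial_coloring_def)
    next
      case 2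
      then have "?p v = \<sigma> u" using new[of v] eq that(2) by (simp add: trial_colored)
      then show False using pick_palette[of \<sigma> y v] vu by (auto simp: palette_def)
    next
      case 3
      then have "?p u = \<sigma> v" using new[of u] eq that(2) by (simp add: trial_colored)
      then show False using pick_palette[of \<sigma> y u] that(1) by (auto simp: palette_def)
    next
      case 4
      \<comment> \<open>Both colours are new, so each end was an active rival of the other and the
        smaller name would have blocked the larger.\<close>
      note n = new[OF 4(1) that(2)] new[OF 4(2)]
      have "v \<in> rivals E P \<sigma> u" "u \<in> rivals E P \<sigma> v"
        using n that eq vu 4 by (auto simp: rivals_def)
      then show False using n eq that(2) uv by (metis linorder_neqE_nat)
    qed
  qed
  ultimately show ?thesis by (auto simp: partial_coloring_def)
qed

lemma partial_coloring_trials: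
  "partial_coloring D E \<sigma> \<Longrightarrow> partial_coloring D E (trials D E P \<sigma> zs)"
  by (induction zs arbitrary: \<sigma> rule: induct_list012) (simp_all add: partial_coloring_trial)

text \<open>Bounds the failure probability of \<open>v\<close> once the activities are known: each
  active rival spoils at most one of at least \<open>card (rivals E P \<sigma> v) + 1\<close>
  colours, and an inactive vertex surely fails.\<close>

definition block_prob :: "nat set \<Rightarrow> (nat \<Rightarrow> nat) \<Rightarrow> (nat \<Rightarrow> nat) \<Rightarrow> nat \<Rightarrow> real" where
  "block_prob P \<sigma> a v =
     (if even (a v) then card {u \<in> rivals E P \<sigma> v. even (a u)} / (card (rivals E P \<sigma> v) + 1) else 1)"

lemma block_prob_nonneg: "block_prob P \<sigma> a v \<ge> 0"
  by (simp add: block_prob_def)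

lemma block_prob_le_1: "block_prob P \<sigma> a v \<le> 1"
proof -
  have "card {u \<in> rivals E P \<sigma> v. even (a u)} \<le> card (rivals E P \<sigma> v)"
    by (intro card_mono) auto
  then show ?thesis by (simp add: block_prob_def)
qed

lemma card_pick_le:
  assumes "finite C" "card (palette D E \<sigma> v) dvd q"
  shows "card {x \<in> {..<q}. pick D E \<sigma> (y(v := x)) v \<in> C} * card (palette D E \<sigma> v) \<le> card C * q"
proof -
  let ?A = "palette D E \<sigma> v" and ?k = "card (palette D E \<sigma> v)"
  let ?l = "sorted_list_of_set ?A"
  have k: "0 < ?k" using card_palette[of \<sigma> v] by auto
  have one: "card {x \<in> {..<q}. ?l ! (x mod ?k) = c} \<le> q div ?k" for c
  proof (cases "\<exists>j<?k. ?l ! j = c")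
    case True
    then obtain j where j: "j < ?k" "?l ! j = c" by blast
    have "x mod ?k = j" if "?l ! (x mod ?k) = c" for x
      using that j k nth_eq_iff_index_eq[of ?l "x mod ?k" j] by auto
    then have "{x \<in> {..<q}. ?l ! (x mod ?k) = c} \<subseteq> {x \<in> {..<q}. x mod ?k = j}" by blast
    then have "card {x \<in> {..<q}. ?l ! (x mod ?k) = c} \<le> card {x \<in> {..<q}. x mod ?k = j}"
      by (intro card_mono) auto
    then show ?thesis using card_mod_eq_le[OF assms(2) k] by (meson order_trans)
  next
    case False
    then have "{x \<in> {..<q}. ?l ! (x mod ?k) = c} = {}" using k by (auto simp: mod_less_divisor)
    then show ?thesis by (metis card.empty zero_le)
  qed
  have "{x \<in> {..<q}. pick D E \<sigma> (y(v := x)) v \<in> C} = (\<Union>c\<in>C. {x \<in> {..<q}. ?l ! (x mod ?k) = c})"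
    by (auto simp: pick_def)
  then have "card {x \<in> {..<q}. pick D E \<sigma> (y(v := x)) v \<in> C} \<le> (\<Sum>c\<in>C. card {x \<in> {..<q}. ?l ! (x mod ?k) = c})"
    by (simp only: card_UN_le[OF assms(1)])
  also have "\<dots> \<le> card C * (q div ?k)"
    using sum_mono[of C "\<lambda>c. card {x \<in> {..<q}. ?l ! (x mod ?k) = c}", OF one] by simp
  finally have "card {x \<in> {..<q}. pick D E \<sigma> (y(v := x)) v \<in> C} * ?k \<le> card C * (q div ?k) * ?k"
    by (rule mult_right_mono) simp
  then show ?thesis using assms(2) by (simp add: mult.assoc)
qed

text \<open>Exposing the colour choices in the order of the vertex names makes the failure
  probabilities of the vertices multiply, for any set \<open>S\<close>.\<close>
lemma card_trial_fails_le:
  assumes S: "S \<subseteq> V" "S \<subseteq> P" "\<And>v. v \<in> S \<Longrightarrow> \<sigma> v = 0" and q: "(fact (D + 1) :: nat) dvd q"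
  shows "card {y \<in> V \<rightarrow>\<^sub>E {..<q}. \<forall>v\<in>S. trial D E P \<sigma> a y v = 0} \<le> (\<Prod>v\<in>S. block_prob P \<sigma> a v) * q ^ card V"
proof -
  let ?R = "\<lambda>v. {u \<in> rivals E P \<sigma> v. even (a u)}"
  \<comment> \<open>Vertices outside \<open>S\<close> and inactive vertices count as bad with factor
    1, so that the sequential bound can run over all of \<open>V\<close>.\<close>
  let ?p = "\<lambda>v. if v \<in> S then block_prob P \<sigma> a v else 1"
  define bad where "bad v y \<longleftrightarrow> (v \<in> S \<and> even (a v) \<longrightarrow>
      pick D E \<sigma> y v \<in> pick D E \<sigma> y ` {u \<in> ?R v. u < v})" for v y
  have dvd: "card (palette D E \<sigma> v) dvd q" for v
    using card_palette[of \<sigma> v] q dvd_fact[of "card (palette D E \<sigma> v)" "D + 1"] by (auto intro: dvd_trans)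
  have pick_cong: "pick D E \<sigma> y v = pick D E \<sigma> y' v" if "y v = y' v" for y y' v
    using that by (simp add: pick_def)
  have "bad v y" if "v \<in> S" "trial D E P \<sigma> a y v = 0" for v y
  proof -
    have "pick D E \<sigma> y v \<noteq> 0" using pick_palette[of \<sigma> y v] by (auto simp: palette_def)
    moreover have "v \<in> P" "\<sigma> v = 0" using S that(1) by auto
    ultimately have "\<exists>u\<in>rivals E P \<sigma> v. even (a u) \<and> u < v \<and> pick D E \<sigma> y u = pick D E \<sigma> y v"
      if "even (a v)"
      using that \<open>trial D E P \<sigma> a y v = 0\<close> unfolding trial_def by meson
    then have "\<exists>u\<in>{u \<in> ?R v. u < v}. pick D E \<sigma> y v = pick D E \<sigma> y u" if "even (a v)"
      using that by fastforce
    then show ?thesis unfolding bad_def by blast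
  qed
  then have "{y \<in> V \<rightarrow>\<^sub>E {..<q}. \<forall>v\<in>S. trial D E P \<sigma> a y v = 0} \<subseteq> {y \<in> V \<rightarrow>\<^sub>E {..<q}. \<forall>v\<in>V. bad v y}"
    by (auto simp: bad_def)
  then have "card {y \<in> V \<rightarrow>\<^sub>E {..<q}. \<forall>v\<in>S. trial D E P \<sigma> a y v = 0} \<le> card {y \<in> V \<rightarrow>\<^sub>E {..<q}. \<forall>v\<in>V. bad v y}"
    using fin by (intro card_mono finite_subset[of "{y \<in> V \<rightarrow>\<^sub>E {..<q}. \<forall>v\<in>V. bad v y}" "V \<rightarrow>\<^sub>E {..<q}"] finite_PiE) auto
  also have "real \<dots> \<le> (\<Prod>v\<in>V. ?p v) * card {..<q} ^ card V"
  proof (rule card_PiE_sequential_le[OF fin])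
    fix v and y y' :: "nat \<Rightarrow> nat" assume eq: "\<And>u. u \<le> v \<Longrightarrow> y u = y' u"
    have "pick D E \<sigma> y v = pick D E \<sigma> y' v" using eq by (intro pick_cong) auto
    moreover have "pick D E \<sigma> y ` {u \<in> ?R v. u < v} = pick D E \<sigma> y' ` {u \<in> ?R v. u < v}"
      using eq by (intro image_cong pick_cong) auto
    ultimately show "bad v y = bad v y'" by (simp only: bad_def)
  next
    fix v and y :: "nat \<Rightarrow> nat"
    show "card {x \<in> {..<q}. bad v (y(v := x))} \<le> ?p v * card {..<q}"
    proof (cases "v \<in> S \<and> even (a v)")
      case False
      have "card {x \<in> {..<q}. bad v (y(v := x))} \<le> card {..<q}" by (intro card_mono) auto
      then show ?thesis using False by (auto simp: block_prob_def)
    next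
      case True
      let ?C = "pick D E \<sigma> y ` {u \<in> ?R v. u < v}" and ?k = "card (palette D E \<sigma> v)"
      let ?n = "card {x \<in> {..<q}. bad v (y(v := x))}"
      \<comment> \<open>The word of \<open>v\<close> does not affect the picks of lower vertices, so
        the set of forbidden colours is fixed before that word is exposed.\<close>
      have "pick D E \<sigma> (y(v := x)) ` {u \<in> ?R v. u < v} = ?C" for x
        by (intro image_cong pick_cong) auto
      then have eq: "{x \<in> {..<q}. bad v (y(v := x))} = {x \<in> {..<q}. pick D E \<sigma> (y(v := x)) v \<in> ?C}"
        using True by (auto simp only: bad_def)
      have "card ?C \<le> card {u \<in> ?R v. u < v}" by (intro card_image_le) auto
      also have "\<dots> \<le> card (?R v)" by (intro card_mono) auto
      finally have C: "card ?C \<le> card (?R v)" .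
      have "?n * (card (rivals E P \<sigma> v) + 1) \<le> ?n * ?k"
        using rivals_less_palette by (intro mult_left_mono) auto
      also have "\<dots> \<le> card ?C * q"
        unfolding eq by (intro card_pick_le dvd) auto
      also have "\<dots> \<le> card (?R v) * q" using C by simp
      finally have "real (?n * (card (rivals E P \<sigma> v) + 1)) \<le> real (card (?R v) * q)"
        by (rule of_nat_mono)
      then show ?thesis using True by (simp add: block_prob_def field_simps)
    qed
  qed auto
  also have "(\<Prod>v\<in>V. ?p v) = (\<Prod>v\<in>S. block_prob P \<sigma> a v)"
    using fin S(1) by (simp add: prod.If_cases Int_absorb1)
  finally show ?thesis by simp
qed

end

section \<open>Failure probabilities\<close>

text \<open>Conditioning on a prefix: a bound that holds for every fixed prefix survives averaging
  over prefixes.\<close>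

lemma card_lists_append_le:
  fixes \<epsilon> :: real
  assumes "finite Q"
    and "\<And>xs. set xs \<subseteq> Q \<Longrightarrow> length xs = i \<Longrightarrow>
      card {ys. set ys \<subseteq> Q \<and> length ys = j \<and> bad xs ys} \<le> \<epsilon> * card Q ^ j"
  shows "card {zs. set zs \<subseteq> Q \<and> length zs = i + j \<and> bad (take i zs) (drop i zs)} \<le> \<epsilon> * card Q ^ (i + j)"
proof -
  let ?A = "{xs. set xs \<subseteq> Q \<and> length xs = i}"
  let ?B = "\<lambda>xs. {ys. set ys \<subseteq> Q \<and> length ys = j \<and> bad xs ys}"
  have finA: "finite ?A" using assms(1) by (rule finite_lists_length_eq)
  have finB: "finite (?B xs)" for xs
    by (rule finite_subset[OF _ finite_lists_length_eq[OF assms(1), of j]]) auto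
  have "{zs. set zs \<subseteq> Q \<and> length zs = i + j \<and> bad (take i zs) (drop i zs)}
      \<subseteq> (\<lambda>(xs, ys). xs @ ys) ` (SIGMA xs:?A. ?B xs)"
  proof
    fix zs assume "zs \<in> {zs. set zs \<subseteq> Q \<and> length zs = i + j \<and> bad (take i zs) (drop i zs)}"
    then have "(take i zs, drop i zs) \<in> (SIGMA xs:?A. ?B xs)"
      by (auto dest: in_set_takeD in_set_dropD)
    then show "zs \<in> (\<lambda>(xs, ys). xs @ ys) ` (SIGMA xs:?A. ?B xs)"
      by (rule rev_image_eqI) simp
  qed
  then have "card {zs. set zs \<subseteq> Q \<and> length zs = i + j \<and> bad (take i zs) (drop i zs)}
      \<le> card (SIGMA xs:?A. ?B xs)"
    using finA finB by (intro surj_card_le) auto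
  also have "\<dots> = (\<Sum>xs\<in>?A. card (?B xs))"
    using finA finB by (intro card_SigmaI) auto
  also have "real \<dots> \<le> (\<Sum>xs\<in>?A. \<epsilon> * card Q ^ j)"
    unfolding of_nat_sum by (intro sum_mono assms(2)) auto
  also have "\<dots> = \<epsilon> * card Q ^ (i + j)"
    using card_lists_length_eq[OF assms(1), of i] by (simp add: power_add mult_ac)
  finally show ?thesis by simp
qed

lemma sum_of_bool_even: "even (q::nat) \<Longrightarrow> (\<Sum>x<q. of_bool (even x) :: real) = q / 2"
proof -
  assume "even q"
  have "(\<Sum>x<q. of_bool (even x) :: real) = card {x \<in> {..<q}. even x}"
    by (simp add: of_bool_def sum.If_cases Int_def)
  then show ?thesis using arg_cong[OF card_evens[OF \<open>even q\<close>], of real] by simp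
qed

text \<open>Chernoff bound by an exponential moment, for half the coordinates being even on average
  against a threshold of three quarters.\<close>

lemma card_mostly_even_le:
  fixes N :: "'a set"
  assumes "finite V" "N \<subseteq> V" "even (q::nat)" "16 * m \<le> card N"
  shows "card {a \<in> V \<rightarrow>\<^sub>E {..<q}. 3 * card N \<le> 4 * card {u \<in> N. even (a u)}} \<le> (1 / 8) ^ m * real q ^ card V"
proof -
  let ?Q = "V \<rightarrow>\<^sub>E {..<q}" and ?n = "card N"
  let ?A = "{a \<in> ?Q. 3 * card N \<le> 4 * card {u \<in> N. even (a u)}}"
  \<comment> \<open>The weight is (4/3)^4, near the optimal value 3 for this threshold and chosen so
    that all exponents stay integral. Its mean over one coordinate is 337/162, against the
    guaranteed 64/27 per coordinate.\<close>
  let ?w = "\<lambda>u x. if u \<in> N \<and> even x then 256 / 81 else (1::real)"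
  have finN: "finite N" using assms finite_subset by blast
  have finQ: "finite ?Q" using assms by (auto intro: finite_PiE)
  have w: "(64 / 27) ^ ?n \<le> (\<Prod>u\<in>V. ?w u (a u))" if "a \<in> ?A" for a
  proof -
    have "(\<Prod>u\<in>V. ?w u (a u)) = (256 / 81) ^ card {u \<in> N. even (a u)}"
    proof -
      have "V \<inter> {u. u \<in> N \<and> even (a u)} = {u \<in> N. even (a u)}" using assms(2) by auto
      then show ?thesis using assms(1) by (simp add: prod.If_cases)
    qed
    also have "\<dots> = (4 / 3) ^ (4 * card {u \<in> N. even (a u)})"
      by (simp add: power_mult power_divide)
    also have "\<dots> \<ge> (4 / 3) ^ (3 * ?n)"
      using that by (intro power_increasing) auto
    finally show ?thesis by (simp add: power_mult power_divide)
  qed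
  have inner: "(\<Sum>x<q. ?w u x) = (if u \<in> N then q * (337 / 162) else q)" for u
  proof (cases "u \<in> N")
    case True
    have "(\<Sum>x<q. ?w u x) = (\<Sum>x<q. 1 + (175 / 81) * of_bool (even x))"
      using True by (intro sum.cong) auto
    also have "\<dots> = q + (175 / 81) * (\<Sum>x<q. of_bool (even x) :: real)"
      by (simp only: sum.distrib sum_distrib_left) simp
    also have "(\<Sum>x<q. of_bool (even x) :: real) = q / 2"
      by (rule sum_of_bool_even) fact
    finally show ?thesis using True by simp
  qed simp
  have "(64 / 27) ^ ?n * card ?A = (\<Sum>a\<in>?A. (64 / 27 :: real) ^ ?n)" by simp
  also have "\<dots> \<le> (\<Sum>a\<in>?A. \<Prod>u\<in>V. ?w u (a u))"
    by (intro sum_mono w)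
  also have "\<dots> \<le> (\<Sum>a\<in>?Q. \<Prod>u\<in>V. ?w u (a u))"
    using finQ by (intro sum_mono2 prod_nonneg) auto
  also have "\<dots> = (\<Prod>u\<in>V. \<Sum>x<q. ?w u x)"
    using assms(1) by (subst prod_sum_PiE) auto
  also have "\<dots> = (\<Prod>u\<in>V. q * (if u \<in> N then 337 / 162 else 1))"
    unfolding inner by (intro prod.cong) auto
  also have "\<dots> = real q ^ card V * (337 / 162) ^ ?n"
    using assms(1,2) by (simp add: prod.distrib prod.If_cases Int_absorb1)
  finally have "card ?A \<le> real q ^ card V * ((337 / 162) ^ ?n / (64 / 27) ^ ?n)"
    by (simp add: field_simps)
  also have "(337 / 162) ^ ?n / (64 / 27) ^ ?n = (337 / 384 :: real) ^ ?n"
    by (simp add: power_divide[symmetric])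
  also have "\<dots> \<le> (337 / 384) ^ (16 * m)"
    using assms(4) by (intro power_decreasing) auto
  also have "\<dots> = ((337 / 384) ^ 16) ^ m" by (simp add: power_mult)
  \<comment> \<open>The gain per coordinate is 337/384, and 16 is the least exponent that brings it
    below 1/8. This is the origin of the threshold \<open>16 * m\<close>.\<close>
  also have "\<dots> \<le> (1 / 8) ^ m" by (intro power_mono) (simp_all add: power_divide)
  finally have "card ?A \<le> real q ^ card V * (1 / 8) ^ m" by (simp add: mult_left_mono)
  then show ?thesis by (simp add: mult.commute)
qed

text \<open>The second summand is at most the first, and the resulting factor 2 is absorbed by
  (15/14)^m, which exceeds 2 from \<open>m = 11\<close> on; then 15/14 * 7/8 = 15/16.\<close>

lemma high_failure_rate_le: "11 \<le> m \<Longrightarrow> (7 / 8) ^ m + real m * (1 / 8) ^ m \<le> (15 / 16) ^ m"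
proof -
  assume m: "11 \<le> m"
  have "real m * (1 / 8) ^ m \<le> 2 ^ m * (1 / 8) ^ m"
    using of_nat_less_two_power[of m, where 'a = real] by (intro mult_right_mono) auto
  also have "\<dots> = (1 / 4) ^ m" by (simp add: power_mult_distrib[symmetric])
  also have "\<dots> \<le> (7 / 8) ^ m" by (intro power_mono) auto
  finally have "(7 / 8) ^ m + real m * (1 / 8) ^ m \<le> 2 * (7 / 8) ^ m" by simp
  also have "\<dots> \<le> (15 / 14) ^ m * (7 / 8) ^ m"
  proof (rule mult_right_mono)
    have "(2::real) \<le> (15 / 14) ^ 11" by (simp add: power_divide)
    also have "\<dots> \<le> (15 / 14) ^ m" using m by (intro power_increasing) auto
    finally show "(2::real) \<le> (15 / 14) ^ m" .
  qed simp
  also have "\<dots> = (15 / 16) ^ m" by (simp add: power_mult_distrib[symmetric])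
  finally show ?thesis .
qed

section \<open>Average blocking ratios of sets of vertices\<close>

definition separated :: "('a \<times> 'a) set \<Rightarrow> 'a set \<Rightarrow> bool" where
  "separated F S \<longleftrightarrow> (\<forall>u\<in>S. \<forall>v\<in>S. u \<noteq> v \<longrightarrow> insert u (F `` {u}) \<inter> insert v (F `` {v}) = {})"

context bounded_graph
begin

lemma rivals_subset: "rivals E P \<sigma> v \<subseteq> V"
  using edges by (auto simp: rivals_def)

text \<open>With \<open>r\<close> rivals, inactivity contributes 1/2 and activity contributes
  \<open>r / (4 * (r + 1))\<close>, which is below 1/4.\<close>

lemma sum_block_prob_le:
  assumes "even (q::nat)" "v \<in> V"
  shows "(\<Sum>a\<in>V \<rightarrow>\<^sub>E {..<q}. block_prob P \<sigma> a v) \<le> 3 / 4 * real q ^ card V"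
proof -
  let ?Q = "V \<rightarrow>\<^sub>E {..<q}" and ?R = "rivals E P \<sigma> v"
  let ?r = "card ?R"
  have finQ: "finite ?Q" using fin by (auto intro: finite_PiE)
  have count: "(\<Sum>a\<in>?Q. of_bool (\<forall>u\<in>J. even (a u))) = real q ^ card V / 2 ^ card J" if "J \<subseteq> V" for J
  proof -
    have "(\<Sum>a\<in>?Q. of_bool (\<forall>u\<in>J. even (a u)) :: real) = card {a \<in> ?Q. \<forall>u\<in>J. even (a u)}"
      using finQ by (simp add: of_bool_def sum.If_cases Int_def)
    moreover have "real (card {a \<in> ?Q. \<forall>u\<in>J. even (a u)}) * 2 ^ card J = real q ^ card V"
      using arg_cong[OF card_even_PiE[OF fin that assms(1)], of real] by simp
    ultimately show ?thesis by (simp add: field_simps)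
  qed
  \<comment> \<open>The ratio is linear in indicators that one or two given vertices are active, so
    its mean only needs \<open>count\<close>.\<close>
  have eq: "block_prob P \<sigma> a v = 1 - of_bool (\<forall>u\<in>{v}. even (a u)) + (\<Sum>w\<in>?R. of_bool (\<forall>u\<in>{v, w}. even (a u))) / (?r + 1)" for a
    by (auto simp: block_prob_def of_bool_def sum.If_cases Int_def)
  have w: "(\<Sum>a\<in>?Q. of_bool (\<forall>u\<in>{v, w}. even (a u))) = real q ^ card V / 4" if "w \<in> ?R" for w
  proof -
    have "w \<noteq> v" "w \<in> V" using that irrefl edges by (auto simp: rivals_def)
    then show ?thesis using count[of "{v, w}"] assms(2) by simp
  qed
  have "(\<Sum>a\<in>?Q. block_prob P \<sigma> a v) = real (card ?Q) - (\<Sum>a\<in>?Q. of_bool (\<forall>u\<in>{v}. even (a u)))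
      + (\<Sum>w\<in>?R. \<Sum>a\<in>?Q. of_bool (\<forall>u\<in>{v, w}. even (a u))) / (?r + 1)"
    unfolding eq sum.distrib sum_subtractf sum_divide_distrib[symmetric] by (subst sum.swap) simp
  also have "(\<Sum>w\<in>?R. \<Sum>a\<in>?Q. of_bool (\<forall>u\<in>{v, w}. even (a u)) :: real) = ?r * (real q ^ card V / 4)"
    by (subst sum.cong[OF refl w]) simp_all
  also have "(\<Sum>a\<in>?Q. of_bool (\<forall>u\<in>{v}. even (a u)) :: real) = real q ^ card V / 2"
    using count[of "{v}"] assms(2) by simp
  also have "real (card ?Q) = real q ^ card V" using fin by (simp add: card_PiE)
  also have "?r * (real q ^ card V / 4) / (?r + 1) \<le> real q ^ card V / 4"
    by (simp add: field_simps)
  finally show ?thesis by simp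
qed

text \<open>Each factor reads only activities in the closed \<open>F\<close>-neighbourhood of its
  vertex; separation makes these disjoint and the factors independent.\<close>

lemma sum_prod_block_prob_separated_le:
  assumes "even (q::nat)" "0 < q" "S \<subseteq> V" "separated F S"
    and rivals: "\<And>v. v \<in> S \<Longrightarrow> rivals E P \<sigma> v \<subseteq> F `` {v}"
  shows "(\<Sum>a\<in>V \<rightarrow>\<^sub>E {..<q}. \<Prod>v\<in>S. block_prob P \<sigma> a v) \<le> (3 / 4) ^ card S * real q ^ card V"
proof -
  have card: "real (card (V \<rightarrow>\<^sub>E {..<q})) = real q ^ card V" using fin by (simp add: card_PiE)
  have "(\<Sum>a\<in>V \<rightarrow>\<^sub>E {..<q}. \<Prod>v\<in>S. block_prob P \<sigma> a v) \<le> (3 / 4) ^ card S * card (V \<rightarrow>\<^sub>E {..<q})"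
  proof (rule sum_PiE_prod_independent_le[where J = "\<lambda>v. insert v (F `` {v})"])
    fix v and X X' :: "nat \<Rightarrow> nat"
    assume v: "v \<in> S" and eq: "\<And>u. u \<in> insert v (F `` {v}) \<Longrightarrow> X u = X' u"
    have "X v = X' v" using eq by blast
    moreover have "X u = X' u" if "u \<in> rivals E P \<sigma> v" for u
      using that v rivals by (intro eq) auto
    then have "{u \<in> rivals E P \<sigma> v. even (X u)} = {u \<in> rivals E P \<sigma> v. even (X' u)}" by auto
    ultimately show "block_prob P \<sigma> X v = block_prob P \<sigma> X' v" by (simp add: block_prob_def)
  next
    fix v assume "v \<in> S"
    then show "(\<Sum>X\<in>V \<rightarrow>\<^sub>E {..<q}. block_prob P \<sigma> X v) \<le> 3 / 4 * card (V \<rightarrow>\<^sub>E {..<q})"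
      using sum_block_prob_le[OF assms(1)] assms(3) unfolding card by blast
  next
    fix u v assume "u \<in> S" "v \<in> S" "u \<noteq> v"
    then show "insert u (F `` {u}) \<inter> insert v (F `` {v}) = {}"
      using assms(4) unfolding separated_def by blast
  qed (use fin assms(2,3) in \<open>auto intro: block_prob_nonneg finite_subset\<close>)
  then show ?thesis by (simp only: card)
qed

lemma sum_prod_block_prob_high_le:
  assumes "even (q::nat)" "S \<subseteq> V" "card S = m" "11 \<le> m" "\<And>v. v \<in> S \<Longrightarrow> 16 * m \<le> card (rivals E P \<sigma> v)"
  shows "(\<Sum>a\<in>V \<rightarrow>\<^sub>E {..<q}. \<Prod>v\<in>S. block_prob P \<sigma> a v) \<le> (15 / 16) ^ m * real q ^ card V"
proof -
  let ?Q = "V \<rightarrow>\<^sub>E {..<q}" and ?R = "\<lambda>v. rivals E P \<sigma> v"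
  let ?A = "\<lambda>v. {a \<in> ?Q. 3 * card (?R v) \<le> 4 * card {u \<in> ?R v. even (a u)}}"
  let ?g = "\<lambda>x. if even x then 3 / 4 else (1::real)"
  let ?b = "\<lambda>a. \<Prod>v\<in>S. block_prob P \<sigma> a v"
  have finQ: "finite ?Q" using fin by (auto intro: finite_PiE)
  have finS: "finite S" using fin assms(2) finite_subset by blast
  have le: "?b a \<le> (\<Sum>v\<in>S. of_bool (a \<in> ?A v)) + (\<Prod>v\<in>S. ?g (a v))" if a: "a \<in> ?Q" for a
  proof (cases "\<exists>v\<in>S. a \<in> ?A v")
    case True
    then obtain v where "v \<in> S" "a \<in> ?A v" by blast
    then have "1 \<le> (\<Sum>v\<in>S. of_bool (a \<in> ?A v) :: real)"
      using member_le_sum[of v S "\<lambda>v. of_bool (a \<in> ?A v) :: real"] finS by simp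
    moreover have "?b a \<le> 1" by (intro prod_le_1) (auto simp: block_prob_nonneg block_prob_le_1)
    moreover have "0 \<le> (\<Prod>v\<in>S. ?g (a v))" by (intro prod_nonneg) auto
    ultimately show ?thesis by linarith
  next
    case False
    have "?b a \<le> (\<Prod>v\<in>S. ?g (a v))"
    proof (rule prod_mono)
      fix v assume "v \<in> S"
      then have "4 * card {u \<in> ?R v. even (a u)} < 3 * card (?R v)" using False a by auto
      then have "real (card {u \<in> ?R v. even (a u)}) \<le> 3 / 4 * (real (card (?R v)) + 1)" by simp
      then have "real (card {u \<in> ?R v. even (a u)}) / (real (card (?R v)) + 1) \<le> 3 / 4"
        by (subst divide_le_eq) auto
      then have "block_prob P \<sigma> a v \<le> ?g (a v)" by (auto simp: block_prob_def add_ac)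
      then show "0 \<le> block_prob P \<sigma> a v \<and> block_prob P \<sigma> a v \<le> ?g (a v)"
        using block_prob_nonneg by blast
    qed
    moreover have "0 \<le> (\<Sum>v\<in>S. of_bool (a \<in> ?A v) :: real)" by (intro sum_nonneg) auto
    ultimately show ?thesis by linarith
  qed
  have sumg: "(\<Sum>x<q. ?g x) = 7 / 8 * q"
  proof -
    have "(\<Sum>x<q. ?g x) = (\<Sum>x<q. 1 - (1 / 4) * of_bool (even x))"
      by (intro sum.cong) auto
    also have "\<dots> = q - (1 / 4) * (\<Sum>x<q. of_bool (even x) :: real)"
      by (simp only: sum_subtractf sum_distrib_left) simp
    also have "(\<Sum>x<q. of_bool (even x) :: real) = q / 2"
      by (rule sum_of_bool_even) fact
    finally show ?thesis by simp
  qed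
  have "(\<Sum>a\<in>?Q. \<Prod>v\<in>S. ?g (a v)) = (\<Sum>a\<in>?Q. \<Prod>v\<in>V. if v \<in> S then ?g (a v) else 1)"
    using fin assms(2) by (intro sum.cong refl) (simp add: prod.If_cases Int_absorb1)
  also have "\<dots> = (\<Prod>v\<in>V. \<Sum>x<q. if v \<in> S then ?g x else 1)"
    using fin by (subst prod_sum_PiE) auto
  also have "\<dots> = (\<Prod>v\<in>V. q * (if v \<in> S then 7 / 8 else 1))"
    using sumg by (intro prod.cong) auto
  also have "\<dots> = real q ^ card V * (7 / 8) ^ m"
    using fin assms(2,3) by (simp add: prod.distrib prod.If_cases Int_absorb1)
  finally have g: "(\<Sum>a\<in>?Q. \<Prod>v\<in>S. ?g (a v)) = real q ^ card V * (7 / 8) ^ m" .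
  have "(\<Sum>a\<in>?Q. ?b a) \<le> (\<Sum>a\<in>?Q. (\<Sum>v\<in>S. of_bool (a \<in> ?A v)) + (\<Prod>v\<in>S. ?g (a v)))"
    by (intro sum_mono le)
  also have "\<dots> = (\<Sum>v\<in>S. \<Sum>a\<in>?Q. of_bool (a \<in> ?A v)) + (\<Sum>a\<in>?Q. \<Prod>v\<in>S. ?g (a v))"
    by (subst sum.swap) (simp add: sum.distrib)
  also have "(\<Sum>v\<in>S. \<Sum>a\<in>?Q. of_bool (a \<in> ?A v) :: real) = (\<Sum>v\<in>S. real (card (?A v)))"
  proof (intro sum.cong refl)
    fix v
    have "(\<Sum>a\<in>?Q. of_bool (a \<in> ?A v) :: real) = card (?Q \<inter> ?A v)"
      using finQ by (simp add: of_bool_def sum.If_cases Int_def)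
    also have "?Q \<inter> ?A v = ?A v" by blast
    finally show "(\<Sum>a\<in>?Q. of_bool (a \<in> ?A v) :: real) = real (card (?A v))" .
  qed
  also have "\<dots> \<le> (\<Sum>v\<in>S. (1 / 8) ^ m * real q ^ card V)"
    using assms(1,5) by (intro sum_mono card_mostly_even_le fin rivals_subset) auto
  also have "\<dots> + (\<Sum>a\<in>?Q. \<Prod>v\<in>S. ?g (a v)) = ((7 / 8) ^ m + real m * (1 / 8) ^ m) * real q ^ card V"
    using assms(3) g by (simp add: algebra_simps)
  also have "\<dots> \<le> (15 / 16) ^ m * real q ^ card V"
    using high_failure_rate_le[OF assms(4)] by (intro mult_right_mono) auto
  finally show ?thesis by simp
qed

lemma card_trial_pairs_le:
  fixes \<rho> :: real
  assumes S: "S \<subseteq> V" "S \<subseteq> P" "\<And>v. v \<in> S \<Longrightarrow> \<sigma> v = 0" and q: "(fact (D + 1) :: nat) dvd q"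
    and "(\<Sum>a\<in>V \<rightarrow>\<^sub>E {..<q}. \<Prod>v\<in>S. block_prob P \<sigma> a v) \<le> \<rho> * real q ^ card V"
  shows "card {(a, y) \<in> (V \<rightarrow>\<^sub>E {..<q}) \<times> (V \<rightarrow>\<^sub>E {..<q}). \<forall>v\<in>S. trial D E P \<sigma> a y v = 0}
     \<le> \<rho> * card (V \<rightarrow>\<^sub>E {..<q}) ^ 2"
proof -
  let ?Q = "V \<rightarrow>\<^sub>E {..<q}"
  let ?Y = "\<lambda>a. {y \<in> ?Q. \<forall>v\<in>S. trial D E P \<sigma> a y v = 0}"
  have finQ: "finite ?Q" using fin by (auto intro: finite_PiE)
  have "{(a, y) \<in> ?Q \<times> ?Q. \<forall>v\<in>S. trial D E P \<sigma> a y v = 0} = (SIGMA a:?Q. ?Y a)" by auto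
  then have "card {(a, y) \<in> ?Q \<times> ?Q. \<forall>v\<in>S. trial D E P \<sigma> a y v = 0} = (\<Sum>a\<in>?Q. card (?Y a))"
    using finQ by (simp add: card_SigmaI)
  also have "real \<dots> \<le> (\<Sum>a\<in>?Q. (\<Prod>v\<in>S. block_prob P \<sigma> a v) * real q ^ card V)"
    unfolding of_nat_sum using card_trial_fails_le[OF S q] by (intro sum_mono) auto
  also have "\<dots> \<le> \<rho> * real q ^ card V * real q ^ card V"
    unfolding sum_distrib_right[symmetric] using assms(5) by (intro mult_right_mono) auto
  also have "\<dots> = \<rho> * card ?Q ^ 2" using fin by (simp add: card_PiE power2_eq_square)
  finally show ?thesis .
qed

text \<open>\<open>R\<close> is inherited backwards in time: if it holds at the end, it held before
  every round, so each round contributes its own factor. If it already fails at the start, the count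
  is zero. \<open>I\<close> carries whatever the one-round bound needs to know about the
  history.\<close>

lemma card_trials_le:
  fixes \<rho> :: real
  assumes finQ: "finite Q" and rho: "0 \<le> \<rho>"
    and inv: "\<And>\<sigma> a y. I \<sigma> \<Longrightarrow> I (trial D E P \<sigma> a y)"
    and mono: "\<And>\<sigma> a y. R (trial D E P \<sigma> a y) \<Longrightarrow> R \<sigma>"
    and one: "\<And>\<sigma>. I \<sigma> \<Longrightarrow> R \<sigma> \<Longrightarrow> card {(a, y) \<in> Q \<times> Q. R (trial D E P \<sigma> a y)} \<le> \<rho> * card Q ^ 2"
    and start: "I \<sigma>"
  shows "card {zs. set zs \<subseteq> Q \<and> length zs = 2 * \<tau> \<and> R (trials D E P \<sigma> zs)} \<le> \<rho> ^ \<tau> * card Q ^ (2 * \<tau>)"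
  using start
proof (induction \<tau> arbitrary: \<sigma>)
  case 0
  have "{zs. set zs \<subseteq> Q \<and> length zs = 2 * 0 \<and> R (trials D E P \<sigma> zs)} \<subseteq> {[]}" by auto
  then have "card {zs. set zs \<subseteq> Q \<and> length zs = 2 * 0 \<and> R (trials D E P \<sigma> zs)} \<le> card {[] :: (nat \<Rightarrow> nat) list}"
    by (intro card_mono) auto
  then show ?case by simp
next
  case (Suc \<tau>)
  have mono': "R (trials D E P \<sigma> zs) \<Longrightarrow> R \<sigma>" for \<sigma> and zs :: "(nat \<Rightarrow> nat) list"
  proof (induction zs arbitrary: \<sigma> rule: induct_list012)
    case (3 a y zs)
    from "3.prems" have "R (trials D E P (trial D E P \<sigma> a y) zs)" by (simp only: trials.simps)
    then have "R (trial D E P \<sigma> a y)" by (rule "3.IH"(1))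
    then show ?case by (rule mono)
  qed simp_all
  let ?A = "{(a, y) \<in> Q \<times> Q. R (trial D E P \<sigma> a y)}"
  let ?Z = "\<lambda>\<sigma> \<tau>. {zs. set zs \<subseteq> Q \<and> length zs = 2 * \<tau> \<and> R (trials D E P \<sigma> zs)}"
  have finZ: "finite (?Z \<sigma> \<tau>)" for \<sigma> \<tau>
    by (rule finite_subset[OF _ finite_lists_length_eq[OF finQ, of "2 * \<tau>"]]) auto
  have finA: "finite ?A"
    by (rule finite_subset[of _ "Q \<times> Q"]) (use finQ in auto)
  show ?case
  proof (cases "R \<sigma>")
    case False
    then have "?Z \<sigma> (Suc \<tau>) = {}" using mono' by blast
    then have "card (?Z \<sigma> (Suc \<tau>)) = 0" by (metis card.empty)
    then show ?thesis using rho by simp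
  next
    case True
    have "?Z \<sigma> (Suc \<tau>) \<subseteq> (\<lambda>(p, zs). fst p # snd p # zs) ` (SIGMA p:?A. ?Z (trial D E P \<sigma> (fst p) (snd p)) \<tau>)"
    proof
      fix xs assume xs: "xs \<in> ?Z \<sigma> (Suc \<tau>)"
      then obtain a y zs where eq: "xs = a # y # zs" "length zs = 2 * \<tau>"
        by (auto simp: length_Suc_conv)
      have "R (trials D E P (trial D E P \<sigma> a y) zs)" using xs eq by simp
      then have "R (trial D E P \<sigma> a y)" by (rule mono')
      then have "((a, y), zs) \<in> (SIGMA p:?A. ?Z (trial D E P \<sigma> (fst p) (snd p)) \<tau>)"
        using xs eq by auto
      then show "xs \<in> (\<lambda>(p, zs). fst p # snd p # zs) ` (SIGMA p:?A. ?Z (trial D E P \<sigma> (fst p) (snd p)) \<tau>)"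
        by (rule rev_image_eqI) (simp add: eq)
    qed
    then have "card (?Z \<sigma> (Suc \<tau>)) \<le> card (SIGMA p:?A. ?Z (trial D E P \<sigma> (fst p) (snd p)) \<tau>)"
      using finA finZ by (intro surj_card_le) auto
    also have "\<dots> = (\<Sum>p\<in>?A. card (?Z (trial D E P \<sigma> (fst p) (snd p)) \<tau>))"
      using finA finZ by (intro card_SigmaI) auto
    also have "real \<dots> \<le> (\<Sum>p\<in>?A. \<rho> ^ \<tau> * card Q ^ (2 * \<tau>))"
      unfolding of_nat_sum by (intro sum_mono Suc.IH inv Suc.prems)
    also have "\<dots> = card ?A * (\<rho> ^ \<tau> * card Q ^ (2 * \<tau>))" by simp
    also have "\<dots> \<le> (\<rho> * card Q ^ 2) * (\<rho> ^ \<tau> * card Q ^ (2 * \<tau>))"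
      using one[OF Suc.prems True] rho by (intro mult_right_mono) auto
    also have "\<dots> = \<rho> ^ Suc \<tau> * card Q ^ (2 * Suc \<tau>)"
      by (simp add: power_add power2_eq_square)
    finally show ?thesis by simp
  qed
qed

end

section \<open>Degree reduction and shattering\<close>

lemma card_exists_le:
  fixes \<epsilon> :: real
  assumes "finite I" "finite L" "\<And>i. i \<in> I \<Longrightarrow> card {z \<in> L. B i z} \<le> \<epsilon>" "card I \<le> k" "0 \<le> \<epsilon>"
  shows "card {z \<in> L. \<exists>i\<in>I. B i z} \<le> k * \<epsilon>"
proof -
  have "{z \<in> L. \<exists>i\<in>I. B i z} = (\<Union>i\<in>I. {z \<in> L. B i z})" by auto
  then have "card {z \<in> L. \<exists>i\<in>I. B i z} \<le> (\<Sum>i\<in>I. card {z \<in> L. B i z})"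
    by (simp only: card_UN_le[OF assms(1)])
  also have "real \<dots> \<le> (\<Sum>i\<in>I. \<epsilon>)" unfolding of_nat_sum by (intro sum_mono assms(3))
  also have "\<dots> = card I * \<epsilon>" by simp
  also have "\<dots> \<le> k * \<epsilon>" using assms(4,5) by (intro mult_right_mono) auto
  finally show ?thesis by simp
qed

lemma card_ball_le:
  assumes "\<And>v. finite (F `` {v})" "\<And>v. card (F `` {v}) \<le> d"
  shows "finite (ball F x k) \<and> card (ball F x k) \<le> (d + 1) ^ k"
proof (induction k)
  case (Suc k)
  let ?B = "ball F x k"
  have eq: "ball F x (Suc k) = ?B \<union> (\<Union>v\<in>?B. F `` {v})" by (auto simp: ball_Suc)
  have "card (ball F x (Suc k)) \<le> card ?B + card (\<Union>v\<in>?B. F `` {v})"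
    unfolding eq by (rule card_Un_le)
  also have "card (\<Union>v\<in>?B. F `` {v}) \<le> (\<Sum>v\<in>?B. card (F `` {v}))"
    using Suc.IH by (intro card_UN_le) auto
  also have "\<dots> \<le> (\<Sum>v\<in>?B. d)" by (intro sum_mono assms)
  also have "card ?B + (\<Sum>v\<in>?B. d) = card ?B * (d + 1)" by simp
  also have "\<dots> \<le> (d + 1) ^ k * (d + 1)" using Suc.IH by (intro mult_right_mono) auto
  finally show ?case using Suc.IH assms(1) by (simp add: eq mult.commute)
qed simp

text \<open>The vertices of such a sequence fail independently of each other, and there are few enough
  sequences for a union bound.\<close>
fun sprouts :: "(nat \<times> nat) set \<Rightarrow> nat set \<Rightarrow> nat \<Rightarrow> nat list set" where
  "sprouts F A 0 = (\<lambda>v. [v]) ` A"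
| "sprouts F A (Suc i) =
     {w # ws | w ws. ws \<in> sprouts F A i \<and>
        w \<in> (\<Union>x\<in>set ws. ball F x 3) \<and> w \<notin> (\<Union>x\<in>set ws. ball F x 2)}"

lemma sprouts_props:
  assumes "sym F" "F \<subseteq> A \<times> A"
  shows "ws \<in> sprouts F A i \<Longrightarrow> length ws = Suc i \<and> distinct ws \<and> set ws \<subseteq> A \<and>
    (\<forall>x\<in>set ws. \<forall>y\<in>set ws. x \<noteq> y \<longrightarrow> y \<notin> ball F x 2)"
proof (induction i arbitrary: ws)
  case (Suc i)
  then obtain w vs where ws: "ws = w # vs" and vs: "vs \<in> sprouts F A i"
    and w: "w \<in> (\<Union>x\<in>set vs. ball F x 3)" "w \<notin> (\<Union>x\<in>set vs. ball F x 2)" by auto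
  note IH = Suc.IH[OF vs]
  have ballA: "ball F x k \<subseteq> A" if "x \<in> A" for x k
    by (induction k) (use that assms(2) in \<open>auto simp: ball_Suc\<close>)
  have "w \<in> A" using w(1) IH ballA by blast
  moreover have "w \<notin> set vs" using w(2) by auto
  moreover have "x \<notin> ball F w 2" if "x \<in> set vs" for x
    using that w(2) ball_sym[OF assms(1), of x w 2] by blast
  ultimately show ?case using IH w(2) by (auto simp: ws)
qed auto

text \<open>If two closed neighbourhoods meet, their centres are at distance at most 2, which a
  sprout excludes.\<close>

lemma sprouts_separated:
  assumes "sym F" "F \<subseteq> A \<times> A" "ws \<in> sprouts F A i"
  shows "separated F (set ws)"
  unfolding separated_def
proof (intro ballI impI equals0I)
  fix u v z assume uv: "u \<in> set ws" "v \<in> set ws" "u \<noteq> v"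
    and "z \<in> insert u (F `` {u}) \<inter> insert v (F `` {v})"
  then have "z \<in> ball F u 1" "z \<in> ball F v 1" by (auto intro: ball_edge)
  then have "v \<in> ball F z 1" using ball_sym[OF assms(1)] by blast
  with \<open>z \<in> ball F u 1\<close> have "v \<in> ball F u 2" using ball_trans[of z F u 1 v 1] by (simp add: numeral_2_eq_2)
  then show False using sprouts_props[OF assms] uv by blast
qed

text \<open>Only the first entry is free. Every later one lies within distance 3 of one of at most
  \<open>t\<close> earlier entries, which leaves \<open>t * (d + 1) ^ 3\<close> choices.\<close>

lemma card_sprouts_le:
  assumes F: "\<And>v. finite (F `` {v})" "\<And>v. card (F `` {v}) \<le> d" "sym F" "F \<subseteq> A \<times> A" and "finite A"
  shows "i < t \<Longrightarrow> finite (sprouts F A i) \<and> card (sprouts F A i) \<le> card A * (t * (d + 1) ^ 3) ^ i"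
proof (induction i)
  case 0
  then show ?case using \<open>finite A\<close> by (auto simp: card_image inj_on_def)
next
  case (Suc i)
  let ?S = "sprouts F A i" and ?B = "\<lambda>ws. \<Union>x\<in>set ws. ball F x 3"
  note ball = card_ball_le[of F d, OF F(1,2)]
  have finB: "finite (?B ws)" for ws :: "nat list" using ball by auto
  have finS: "finite ?S" using Suc by auto
  have sub: "sprouts F A (Suc i) \<subseteq> (\<lambda>(ws, w). w # ws) ` (SIGMA ws:?S. ?B ws)" by force
  have B: "card (?B ws) \<le> t * (d + 1) ^ 3" if "ws \<in> ?S" for ws
  proof -
    have "card (?B ws) \<le> (\<Sum>x\<in>set ws. card (ball F x 3))" by (intro card_UN_le) auto
    also have "\<dots> \<le> (\<Sum>x\<in>set ws. (d + 1) ^ 3)" by (intro sum_mono) (use ball in auto)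
    also have "\<dots> \<le> length ws * (d + 1) ^ 3" using card_length[of ws] by simp
    also have "\<dots> \<le> t * (d + 1) ^ 3"
      using sprouts_props[OF F(3,4) that] Suc.prems by (intro mult_right_mono) auto
    finally show ?thesis .
  qed
  have "card (sprouts F A (Suc i)) \<le> card (SIGMA ws:?S. ?B ws)"
    using finS finB by (intro surj_card_le[OF _ sub]) auto
  also have "\<dots> = (\<Sum>ws\<in>?S. card (?B ws))" using finS finB by (intro card_SigmaI) auto
  also have "\<dots> \<le> (\<Sum>ws\<in>?S. t * (d + 1) ^ 3)" by (intro sum_mono B)
  also have "\<dots> = card ?S * (t * (d + 1) ^ 3)" by simp
  also have "\<dots> \<le> card A * (t * (d + 1) ^ 3) ^ i * (t * (d + 1) ^ 3)"
    using Suc by (intro mult_right_mono) auto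
  finally have "card (sprouts F A (Suc i)) \<le> card A * (t * (d + 1) ^ 3) ^ Suc i" by (simp add: mult_ac)
  moreover have "finite (sprouts F A (Suc i))"
    using finS finB by (intro finite_subset[OF sub]) auto
  ultimately show ?case by blast
qed

section \<open>Large components contain long sprouts\<close>

definition component :: "('a \<times> 'a) set \<Rightarrow> 'a \<Rightarrow> 'a set" where
  "component F v = F\<^sup>* `` {v}"

lemma component_exit:
  assumes "sym F" "x \<in> component F v" "x \<in> X" "\<not> component F v \<subseteq> X"
  shows "\<exists>a b. (a, b) \<in> F \<and> a \<in> X \<and> b \<notin> X \<and> b \<in> component F v"
proof (rule ccontr)
  assume n: "\<not> ?thesis"
  have symr: "sym (F\<^sup>*)" using assms(1) by (rule sym_rtrancl)
  have xv: "(v, x) \<in> F\<^sup>*" using assms(2) by (simp add: component_def)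
  have "y \<in> X" if "(x, y) \<in> F\<^sup>*" for y
    using that
  proof (induction rule: rtrancl_induct)
    case base
    then show ?case by fact
  next
    case (step y z)
    then have "(v, z) \<in> F\<^sup>*" using xv by auto
    then show ?case using n step by (auto simp: component_def)
  qed
  moreover have "(x, y) \<in> F\<^sup>*" if "y \<in> component F v" for y
    using that xv symr by (auto simp: component_def dest: symD intro: rtrancl_trans)
  ultimately show False using assms(4) by blast
qed

text \<open>Radius-2 balls around at most \<open>t\<close> vertices cover at most
  \<open>t * (d + 1) ^ 2\<close> vertices, so an edge of the component leaves them, and its far end
  prolongs the sprout. Distances are taken in the larger graph \<open>F\<close>, the one in which
  rivals live during all rounds.\<close>

lemma ex_sprouts:
  assumes F: "\<And>v. finite (F `` {v})" "\<And>v. card (F `` {v}) \<le> d" and F': "sym F'" "F' \<subseteq> F"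
    and v: "v \<in> A" and big: "t * (d + 1) ^ 2 < card (component F' v)"
  shows "i < t \<Longrightarrow> \<exists>ws\<in>sprouts F A i. length ws = Suc i \<and> set ws \<subseteq> component F' v"
proof (induction i)
  case 0
  then show ?case using v by (auto simp: component_def)
next
  case (Suc i)
  let ?W = "component F' v"
  from Suc obtain ws where ws: "ws \<in> sprouts F A i" "length ws = Suc i" "set ws \<subseteq> ?W" by auto
  let ?X = "\<Union>x\<in>set ws. ball F x 2"
  note ball = card_ball_le[of F d, OF F]
  have "card ?X \<le> (\<Sum>x\<in>set ws. card (ball F x 2))" by (intro card_UN_le) auto
  also have "\<dots> \<le> (\<Sum>x\<in>set ws. (d + 1) ^ 2)" by (intro sum_mono) (use ball in auto)
  also have "\<dots> \<le> length ws * (d + 1) ^ 2" using card_length[of ws] by simp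
  also have "\<dots> \<le> t * (d + 1) ^ 2" using ws Suc.prems by (intro mult_right_mono) auto
  finally have "card ?X < card ?W" using big by simp
  moreover have "finite ?X" using ball by auto
  ultimately have nsub: "\<not> ?W \<subseteq> ?X" by (meson card_mono not_le)
  from ws(2) have hd: "hd ws \<in> set ws" by (cases ws) auto
  have "hd ws \<in> ?W" using hd ws(3) by blast
  moreover have "hd ws \<in> ?X" using hd by (rule UN_I) simp
  ultimately have "hd ws \<in> ?W" "hd ws \<in> ?X" .
  from component_exit[OF F'(1) this nsub] obtain a b
    where ab: "(a, b) \<in> F'" "a \<in> ?X" "b \<notin> ?X" "b \<in> ?W" by blast
  then have "b \<in> (\<Union>x\<in>set ws. ball F x 3)"
    using F'(2) ball_step[of a F _ 2 b] by (auto simp: numeral_3_eq_3 numeral_2_eq_2)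
  then have "b # ws \<in> sprouts F A (Suc i)" using ws(1) ab(3) by auto
  then show ?case using ws ab(4) by (intro bexI[of _ "b # ws"]) auto
qed

context bounded_graph
begin

lemma trial_zero: "trial D E P \<sigma> a y v = 0 \<Longrightarrow> \<sigma> v = 0"
  by (rule ccontr) (simp add: trial_colored)

lemma rivals_trial_subset: "rivals E P' (trial D E P \<sigma> a y) v \<subseteq> rivals E P' \<sigma> v"
  by (auto simp: rivals_def dest: trial_zero)

lemma rivals_trials_subset: "rivals E P' (trials D E P \<sigma> zs) v \<subseteq> rivals E P' \<sigma> v"
proof
  fix u assume u: "u \<in> rivals E P' (trials D E P \<sigma> zs) v"
  then have "\<sigma> u = 0" using trials_colored[of \<sigma> u D E P zs] by (cases "\<sigma> u = 0") (auto simp: rivals_def)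
  with u show "u \<in> rivals E P' \<sigma> v" by (simp add: rivals_def)
qed

text \<open>The threshold is the one at which \<open>card_mostly_even_le\<close> applies; the vertex
  itself may already be coloured.\<close>

definition busy :: "nat \<Rightarrow> (nat \<Rightarrow> nat) \<Rightarrow> nat set" where
  "busy m \<sigma> = {u. 16 * m \<le> card (rivals E UNIV \<sigma> u)}"

text \<open>A crowded vertex has an \<open>m\<close>-set \<open>S\<close> of uncoloured busy
  neighbours. Rivals only disappear, so \<open>S\<close> was uncoloured and busy in every round, and
  each round costs \<open>(15 / 16) ^ m\<close>. There are at most \<open>(D + 1) ^ m\<close> sets
  per vertex, which \<open>\<tau>\<close> of order log D outweighs.\<close>

lemma card_trials_crowded_le:
  assumes q: "even q" "(fact (D + 1) :: nat) dvd q" "0 < q" and m: "11 \<le> m"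
  shows "card {zs. set zs \<subseteq> V \<rightarrow>\<^sub>E {..<q} \<and> length zs = 2 * \<tau> \<and>
      (\<exists>v\<in>V. m \<le> card (rivals E (busy m (trials D E UNIV \<sigma> zs)) (trials D E UNIV \<sigma> zs) v))}
    \<le> card V * ((real D + 1) * (15 / 16) ^ \<tau>) ^ m * card (V \<rightarrow>\<^sub>E {..<q}) ^ (2 * \<tau>)"
proof -
  let ?Q = "V \<rightarrow>\<^sub>E {..<q}"
  let ?L = "{zs. set zs \<subseteq> ?Q \<and> length zs = 2 * \<tau>}"
  let ?I = "SIGMA v:V. {S. S \<subseteq> E `` {v} \<and> card S = m}"
  let ?R = "\<lambda>S \<sigma>. \<forall>u\<in>S. \<sigma> u = 0 \<and> 16 * m \<le> card (rivals E UNIV \<sigma> u)"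
  let ?\<epsilon> = "((15 / 16) ^ m) ^ \<tau> * card ?Q ^ (2 * \<tau>)"
  have finQ: "finite ?Q" using fin by (auto intro: finite_PiE)
  have finL: "finite ?L" using finQ by (rule finite_lists_length_eq)
  have finI: "finite ?I" using fin by (auto intro: finite_subset[OF _ finite_Pow_iff[THEN iffD2, OF finite_nbs]])
  have one: "card {zs \<in> ?L. ?R S (trials D E UNIV \<sigma> zs)} \<le> ?\<epsilon>" if S: "S \<subseteq> V" "card S = m" for S
  proof -
    have "card {zs. set zs \<subseteq> ?Q \<and> length zs = 2 * \<tau> \<and> ?R S (trials D E UNIV \<sigma> zs)} \<le> ?\<epsilon>"
    proof (rule card_trials_le[where I = "\<lambda>_. True" and R = "?R S"])
      show "?R S \<sigma>" if "?R S (trial D E UNIV \<sigma> a y)" for \<sigma> a y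
      proof
        fix u assume "u \<in> S"
        with that have "trial D E UNIV \<sigma> a y u = 0" "16 * m \<le> card (rivals E UNIV (trial D E UNIV \<sigma> a y) u)"
          by auto
        moreover have "card (rivals E UNIV (trial D E UNIV \<sigma> a y) u) \<le> card (rivals E UNIV \<sigma> u)"
          by (intro card_mono rivals_trial_subset) auto
        ultimately show "\<sigma> u = 0 \<and> 16 * m \<le> card (rivals E UNIV \<sigma> u)"
          using trial_zero by fastforce
      qed
    next
      fix \<sigma> :: "nat \<Rightarrow> nat" assume R: "?R S \<sigma>"
      have "card {(a, y) \<in> ?Q \<times> ?Q. ?R S (trial D E UNIV \<sigma> a y)}
          \<le> card {(a, y) \<in> ?Q \<times> ?Q. \<forall>v\<in>S. trial D E UNIV \<sigma> a y v = 0}"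
      proof (rule card_mono)
        show "finite {(a, y) \<in> ?Q \<times> ?Q. \<forall>v\<in>S. trial D E UNIV \<sigma> a y v = 0}"
          by (rule finite_subset[OF _ finite_cartesian_product[OF finQ finQ]]) blast
      qed (clarify, blast)
      also have "real \<dots> \<le> (15 / 16) ^ m * card ?Q ^ 2"
        by (intro card_trial_pairs_le sum_prod_block_prob_high_le) (use R S q m in auto)
      finally show "card {(a, y) \<in> ?Q \<times> ?Q. ?R S (trial D E UNIV \<sigma> a y)} \<le> (15 / 16) ^ m * card ?Q ^ 2"
        by simp
    qed (use finQ in auto)
    then show ?thesis by simp
  qed
  have "card ?I = (\<Sum>v\<in>V. card (E `` {v}) choose m)"
    using fin by (subst card_SigmaI) (auto simp: n_subsets intro: finite_subset[OF _ finite_Pow_iff[THEN iffD2, OF finite_nbs]])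
  also have "\<dots> \<le> (\<Sum>v\<in>V. (D + 1) ^ m)"
  proof (rule sum_mono)
    fix v
    have "card (E `` {v}) choose m \<le> card (E `` {v}) ^ m"
      by (cases "m \<le> card (E `` {v})") (auto simp: binomial_le_pow binomial_eq_0)
    also have "\<dots> \<le> (D + 1) ^ m" using deg[of v] by (intro power_mono) auto
    finally show "card (E `` {v}) choose m \<le> (D + 1) ^ m" .
  qed
  finally have cardI: "card ?I \<le> card V * (D + 1) ^ m" by simp
  have "{zs \<in> ?L. \<exists>v\<in>V. m \<le> card (rivals E (busy m (trials D E UNIV \<sigma> zs)) (trials D E UNIV \<sigma> zs) v)}
      \<subseteq> {zs \<in> ?L. \<exists>i\<in>?I. ?R (snd i) (trials D E UNIV \<sigma> zs)}"
  proof (intro subsetI)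
    fix zs :: "(nat \<Rightarrow> nat) list"
    let ?s = "trials D E UNIV \<sigma> zs"
    assume zs: "zs \<in> {zs \<in> ?L. \<exists>v\<in>V. m \<le> card (rivals E (busy m (trials D E UNIV \<sigma> zs)) (trials D E UNIV \<sigma> zs) v)}"
    then obtain v where v: "v \<in> V" "m \<le> card (rivals E (busy m ?s) ?s v)" by blast
    from v(2) obtain S where S: "S \<subseteq> rivals E (busy m ?s) ?s v" "card S = m"
      by (rule obtain_subset_with_card_n)
    then have "(v, S) \<in> ?I" using v(1) by (auto simp: rivals_def)
    moreover have "?R S ?s" using S(1) by (auto simp: rivals_def busy_def)
    ultimately have "\<exists>i\<in>?I. ?R (snd i) ?s" by (intro bexI[of _ "(v, S)"]) simp_all
    then show "zs \<in> {zs \<in> ?L. \<exists>i\<in>?I. ?R (snd i) (trials D E UNIV \<sigma> zs)}" using zs by blast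
  qed
  then have "card {zs \<in> ?L. \<exists>v\<in>V. m \<le> card (rivals E (busy m (trials D E UNIV \<sigma> zs)) (trials D E UNIV \<sigma> zs) v)}
      \<le> card {zs \<in> ?L. \<exists>i\<in>?I. ?R (snd i) (trials D E UNIV \<sigma> zs)}"
    by (rule card_mono[rotated]) (rule finite_subset[OF _ finL], blast)
  also have "real \<dots> \<le> real (card V * (D + 1) ^ m) * ?\<epsilon>"
  proof (rule card_exists_le[OF finI finL])
    fix i assume "i \<in> ?I"
    then have "snd i \<subseteq> V" "card (snd i) = m" using edges by auto
    then show "card {zs \<in> ?L. ?R (snd i) (trials D E UNIV \<sigma> zs)} \<le> ?\<epsilon>"
      by (rule one)
  next
    show "0 \<le> ?\<epsilon>" by simp
  qed (rule cardI)
  also have "\<dots> = card V * ((real D + 1) * (15 / 16) ^ \<tau>) ^ m * card ?Q ^ (2 * \<tau>)"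
    by (simp add: power_mult_distrib power_mult[symmetric] mult_ac add_ac)
  finally show ?thesis by simp
qed

text \<open>A large surviving component contains a sprout of \<open>t\<close> uncoloured vertices.
  Being separated, they survive a round with frequency at most \<open>(3 / 4) ^ t\<close>, against
  at most \<open>(t * (d + 1) ^ 3) ^ t\<close> sprouts per start.\<close>

lemma card_trials_big_component_le:
  assumes q: "even q" "(fact (D + 1) :: nat) dvd q" "0 < q" and t: "0 < t"
    and d: "\<And>v. v \<in> P \<Longrightarrow> card (rivals E P \<sigma> v) \<le> d"
  shows "card {zs. set zs \<subseteq> V \<rightarrow>\<^sub>E {..<q} \<and> length zs = 2 * \<tau> \<and>
      (\<exists>v\<in>V. t * (d + 1) ^ 2 < card (component (E \<inter> {u \<in> P. trials D E P \<sigma> zs u = 0} \<times> {u \<in> P. trials D E P \<sigma> zs u = 0}) v))}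
    \<le> card V * (t * (real d + 1) ^ 3 * (3 / 4) ^ \<tau>) ^ t * card (V \<rightarrow>\<^sub>E {..<q}) ^ (2 * \<tau>)"
proof -
  let ?Q = "V \<rightarrow>\<^sub>E {..<q}"
  let ?L = "{zs. set zs \<subseteq> ?Q \<and> length zs = 2 * \<tau>}"
  let ?U = "\<lambda>zs. {u \<in> P. trials D E P \<sigma> zs u = 0}"
  define U where "U = {u \<in> V \<inter> P. \<sigma> u = 0}"
  define F where "F = E \<inter> U \<times> U"
  \<comment> \<open>The lists in \<open>sprouts F A i\<close> have length
    \<open>i + 1\<close>.\<close>
  let ?I = "sprouts F U (t - 1)"
  let ?\<epsilon> = "((3 / 4) ^ t) ^ \<tau> * card ?Q ^ (2 * \<tau>)"
  have finQ: "finite ?Q" using fin by (auto intro: finite_PiE)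
  have finL: "finite ?L" using finQ by (rule finite_lists_length_eq)
  have finU: "finite U" using fin by (simp add: U_def)
  have Fsub: "F `` {v} \<subseteq> (if v \<in> P then rivals E P \<sigma> v else {})" for v
    by (auto simp: F_def U_def rivals_def)
  have finF: "finite (F `` {v})" for v
    using finite_subset[OF Fsub[of v]] by (auto split: if_splits)
  have degF: "card (F `` {v}) \<le> d" for v
  proof (cases "v \<in> P")
    case True
    then have "card (F `` {v}) \<le> card (rivals E P \<sigma> v)" using Fsub[of v] by (intro card_mono) auto
    then show ?thesis using d[OF True] by simp
  next
    case False
    then have "F `` {v} = {}" using Fsub[of v] by simp
    then show ?thesis by (metis card.empty zero_le)
  qed
  have symF: "sym F" using edge_sym by (auto simp: F_def sym_def)
  have FU: "F \<subseteq> U \<times> U" by (auto simp: F_def)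
  have one: "card {zs \<in> ?L. \<forall>v\<in>set ws. trials D E P \<sigma> zs v = 0} \<le> ?\<epsilon>" if ws: "ws \<in> ?I" for ws
  proof -
    have p: "card (set ws) = t" "set ws \<subseteq> U"
      using sprouts_props[OF symF FU ws] t by (auto simp: distinct_card)
    have "card {zs. set zs \<subseteq> ?Q \<and> length zs = 2 * \<tau> \<and> (\<forall>v\<in>set ws. trials D E P \<sigma> zs v = 0)} \<le> ?\<epsilon>"
    \<comment> \<open>The invariant says that no vertex loses its colour, so the rivals of every
      later round are still \<open>F\<close>-neighbours.\<close>
    proof (rule card_trials_le[where I = "\<lambda>\<sigma>'. \<forall>v. \<sigma>' v = 0 \<longrightarrow> \<sigma> v = 0" and R = "\<lambda>\<sigma>. \<forall>v\<in>set ws. \<sigma> v = 0"])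
      fix \<sigma>' :: "nat \<Rightarrow> nat"
      assume I: "\<forall>v. \<sigma>' v = 0 \<longrightarrow> \<sigma> v = 0" and R: "\<forall>v\<in>set ws. \<sigma>' v = 0"
      show "card {(a, y) \<in> ?Q \<times> ?Q. \<forall>v\<in>set ws. trial D E P \<sigma>' a y v = 0} \<le> (3 / 4) ^ t * card ?Q ^ 2"
      proof (intro card_trial_pairs_le)
        have "rivals E P \<sigma>' v \<subseteq> F `` {v}" if "v \<in> set ws" for v
          using that p(2) I edges by (auto simp: F_def U_def rivals_def)
        then show "(\<Sum>a\<in>?Q. \<Prod>v\<in>set ws. block_prob P \<sigma>' a v) \<le> (3 / 4) ^ t * real q ^ card V"
          using sum_prod_block_prob_separated_le[OF q(1,3) _ sprouts_separated[OF symF FU ws], of P \<sigma>'] p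
          by (auto simp: U_def)
      qed (use p R q in \<open>auto simp: U_def\<close>)
    next
      fix \<sigma>' a y :: "nat \<Rightarrow> nat" assume "\<forall>v. \<sigma>' v = 0 \<longrightarrow> \<sigma> v = 0"
      then show "\<forall>v. trial D E P \<sigma>' a y v = 0 \<longrightarrow> \<sigma> v = 0" using trial_zero by blast
    next
      fix \<sigma>' a y :: "nat \<Rightarrow> nat" assume "\<forall>v\<in>set ws. trial D E P \<sigma>' a y v = 0"
      then show "\<forall>v\<in>set ws. \<sigma>' v = 0" using trial_zero by blast
    qed (use finQ in auto)
    then show ?thesis by simp
  qed
  have I: "finite ?I" "card ?I \<le> card U * (t * (d + 1) ^ 3) ^ (t - 1)"
    using card_sprouts_le[OF finF degF symF FU finU, of "t - 1" t] t by auto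
  have "card U \<le> card V" using fin by (intro card_mono) (auto simp: U_def)
  moreover have "(t * (d + 1) ^ 3) ^ (t - 1) \<le> (t * (d + 1) ^ 3) ^ t"
    using t by (intro power_increasing) auto
  ultimately have cardI: "card ?I \<le> card V * (t * (d + 1) ^ 3) ^ t"
    using I(2) by (meson mult_le_mono order_trans)
  have "{zs \<in> ?L. \<exists>v\<in>V. t * (d + 1) ^ 2 < card (component (E \<inter> ?U zs \<times> ?U zs) v)}
      \<subseteq> {zs \<in> ?L. \<exists>ws\<in>?I. \<forall>v\<in>set ws. trials D E P \<sigma> zs v = 0}"
  proof (intro subsetI)
    fix zs :: "(nat \<Rightarrow> nat) list"
    let ?F = "E \<inter> ?U zs \<times> ?U zs"
    assume zs: "zs \<in> {zs \<in> ?L. \<exists>v\<in>V. t * (d + 1) ^ 2 < card (component (E \<inter> ?U zs \<times> ?U zs) v)}"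
    then obtain v where v: "v \<in> V" and big: "t * (d + 1) ^ 2 < card (component ?F v)" by blast
    have "?F \<subseteq> F"
      using trials_colored[of \<sigma> _ D E P zs] edges by (fastforce simp: F_def U_def)
    have vU: "v \<in> ?U zs"
    proof (rule ccontr)
      assume "v \<notin> ?U zs"
      then have "component ?F v = {v}"
        by (auto simp: component_def elim: converse_rtranclE)
      then have "t * (d + 1) ^ 2 < 1" using big by simp
      then show False using t by simp
    qed
    then have "v \<in> U" using v trials_colored[of \<sigma> v D E P zs] by (auto simp: U_def)
    moreover have "sym ?F" using edge_sym by (auto simp: sym_def)
    ultimately obtain ws where ws: "ws \<in> ?I" "set ws \<subseteq> component ?F v"
      using ex_sprouts[OF finF degF _ \<open>?F \<subseteq> F\<close> _ big, of U "t - 1"] t by auto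
    have "component ?F v \<subseteq> ?U zs"
      using vU by (auto simp: component_def elim: rtranclE)
    then have "\<exists>ws\<in>?I. \<forall>v\<in>set ws. trials D E P \<sigma> zs v = 0" using ws by blast
    then show "zs \<in> {zs \<in> ?L. \<exists>ws\<in>?I. \<forall>v\<in>set ws. trials D E P \<sigma> zs v = 0}" using zs by blast
  qed
  then have "card {zs \<in> ?L. \<exists>v\<in>V. t * (d + 1) ^ 2 < card (component (E \<inter> ?U zs \<times> ?U zs) v)}
      \<le> card {zs \<in> ?L. \<exists>ws\<in>?I. \<forall>v\<in>set ws. trials D E P \<sigma> zs v = 0}"
    by (rule card_mono[rotated]) (rule finite_subset[OF _ finL], blast)
  also have "real \<dots> \<le> real (card V * (t * (d + 1) ^ 3) ^ t) * ?\<epsilon>"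
    using one cardI by (intro card_exists_le[OF I(1) finL]) auto
  also have "\<dots> = card V * (t * (real d + 1) ^ 3 * (3 / 4) ^ \<tau>) ^ t * card ?Q ^ (2 * \<tau>)"
    by (simp add: power_mult_distrib power_mult[symmetric] mult_ac add_ac)
  finally show ?thesis by simp
qed

end

section \<open>Separating moduli\<close>

text \<open>The reciprocals of these numbers form the Leibniz harmonic triangle, where an entry is
  the difference of the entry above it and its left neighbour. If the common multiple times both of
  these is an integer, so is the multiple times their difference.\<close>

lemma Leibniz_triangle_dvd_Lcm: "k \<le> n \<Longrightarrow> (n + 1) * (n choose k) dvd Lcm {1..n + 1}"
proof (induction k arbitrary: n)
  case 0
  then show ?case by (simp add: dvd_Lcm)
next
  case (Suc k)
  let ?L = "Lcm {1..n + 1}" and ?c = "n choose Suc k"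
  have k: "k \<le> n" "k \<le> n - 1" "0 < n" using Suc.prems by auto
  obtain i where i: "?L = (n + 1) * (n choose k) * i" using Suc.IH[OF k(1)] by (auto elim: dvdE)
  have "Lcm {1..n - 1 + 1} dvd ?L" by (intro Lcm_least dvd_Lcm) auto
  then have "n * ((n - 1) choose k) dvd ?L"
    using dvd_trans[OF Suc.IH[OF k(2)]] k(3) by simp
  then obtain j where j: "?L = n * ((n - 1) choose k) * j" by (auto elim: dvdE)
  have a: "n * ((n - 1) choose k) = Suc k * ?c"
    using Suc_times_binomial_eq[of "n - 1" k] k(3) by (simp add: mult.commute)
  have b: "(n - k) * (n choose k) = Suc k * ?c"
    using binomial_absorb_comp[of n k] a by (metis binomial_absorption mult.commute)
  have c: "0 < Suc k * ?c" using Suc.prems by simp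
  have "Suc k * ?c * (j * (n - k)) = ?L * (n - k)"
    unfolding j a by (simp only: mult_ac)
  also have "\<dots> = (n + 1) * i * ((n - k) * (n choose k))"
    unfolding i by (simp only: mult_ac)
  also have "\<dots> = Suc k * ?c * ((n + 1) * i)"
    unfolding b by (simp only: mult_ac)
  finally have ji: "j * (n - k) = (n + 1) * i"
    by (rule mult_left_cancel[THEN iffD1, rotated]) (use c in blast)
  have "j * Suc k + j * (n - k) = j * (n + 1)"
    using k(1) by (simp add: add_mult_distrib2[symmetric])
  then have "n + 1 dvd j * Suc k + j * (n - k)" by (simp only: dvd_triv_right)
  moreover have "n + 1 dvd j * (n - k)" unfolding ji by (rule dvd_triv_left)
  ultimately have "n + 1 dvd j * Suc k" using dvd_add_left_iff by blast
  then have "(n + 1) * ?c dvd j * Suc k * ?c" by (rule mult_dvd_mono) simp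
  also have "j * Suc k * ?c = ?L" unfolding j a by (simp only: mult_ac)
  finally show ?case .
qed

text \<open>The central entry of row \<open>2 * n\<close> divides the least common multiple, and the
  central binomial coefficient is at least 4^n / (2n).\<close>

lemma four_power_le_Lcm: "4 ^ n \<le> Lcm {1..2 * n + 1 :: nat}"
proof (cases "n = 0")
  case False
  have "(4::real) ^ n / (2 * real n) \<le> real ((2 * n) choose n)"
    using central_binomial_lower_bound[of n] False by simp
  then have "(4::real) ^ n \<le> real ((2 * n + 1) * ((2 * n) choose n))"
    using False by (simp add: field_simps)
  then have "4 ^ n \<le> (2 * n + 1) * ((2 * n) choose n)"
    by (metis of_nat_le_iff of_nat_numeral of_nat_power)
  also have "\<dots> \<le> Lcm {1..2 * n + 1}"
  proof (rule dvd_imp_le)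
    show "(2 * n + 1) * ((2 * n) choose n) dvd Lcm {1..2 * n + 1}"
      by (rule Leibniz_triangle_dvd_Lcm) simp
    show "0 < Lcm {1..2 * n + 1}" by (rule Nat.gr0I) (simp add: Lcm_0_iff)
  qed
  finally show ?thesis .
qed simp

text \<open>Otherwise every modulus, and hence their least common multiple, divides the product
  of the differences.\<close>
lemma ex_separating_modulus:
  fixes x \<mu> s :: nat
  assumes "finite Y" "card Y \<le> s" "x \<notin> Y" "x < 2 ^ \<mu>" "\<And>y. y \<in> Y \<Longrightarrow> y < 2 ^ \<mu>" "0 < \<mu>" "0 < s"
  shows "\<exists>p\<in>{1..2 * (\<mu> * s) + 1}. \<forall>y\<in>Y. y mod p \<noteq> x mod p"
proof (rule ccontr)
  assume n: "\<not> ?thesis"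
  let ?d = "\<lambda>y. nat \<bar>int x - int y\<bar>"
  let ?Z = "\<Prod>y\<in>Y. ?d y"
  have "Lcm {1..2 * (\<mu> * s) + 1} dvd ?Z"
  proof (rule Lcm_least)
    fix p assume "p \<in> {1..2 * (\<mu> * s) + 1}"
    with n obtain y where y: "y \<in> Y" "y mod p = x mod p" by blast
    then have "int p dvd int x - int y"
      by (metis mod_eq_dvd_iff zmod_int)
    then have "p dvd ?d y" by (metis abs_ge_zero dvd_abs_iff int_dvd_int_iff int_nat_eq)
    also have "?d y dvd ?Z" using assms(1) y(1) by (rule dvd_prodI)
    finally show "p dvd ?Z" .
  qed
  moreover have "0 < ?Z"
    using assms(3) by (intro prod_pos) auto
  ultimately have "Lcm {1..2 * (\<mu> * s) + 1} \<le> ?Z" by (rule dvd_imp_le)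
  \<comment> \<open>At most \<open>s\<close> differences, none above \<open>2 ^ \<mu>\<close>,
    cannot reach \<open>4 ^ (\<mu> * s)\<close>, whereas the least common multiple does.\<close>
  also have "?Z \<le> (\<Prod>y\<in>Y. 2 ^ \<mu>)"
  proof (rule prod_mono)
    fix y assume "y \<in> Y"
    then have "y < 2 ^ \<mu>" "x < 2 ^ \<mu>" using assms(4,5) by simp_all
    then show "0 \<le> ?d y \<and> ?d y \<le> 2 ^ \<mu>" unfolding nat_abs_int_diff by auto
  qed
  also have "\<dots> = 2 ^ (\<mu> * card Y)" by (simp add: power_mult)
  also have "\<dots> \<le> 2 ^ (\<mu> * s)" using assms(2) by (intro power_increasing) auto
  also have "\<dots> < 4 ^ (\<mu> * s)" using assms(6,7) by (intro power_strict_mono) auto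
  finally show False using four_power_le_Lcm[of "\<mu> * s"] by simp
qed

section \<open>Deterministic clustering\<close>

text \<open>The value \<open>None\<close> marks a vertex that never took part or has been dropped by
  the clustering.\<close>

definition members :: "('v \<Rightarrow> 'x option) \<Rightarrow> 'x \<Rightarrow> 'v set" where
  "members cl x = {v. cl v = Some x}"

definition offers :: "('v \<times> 'v) set \<Rightarrow> ('x \<Rightarrow> bool) \<Rightarrow> ('v \<Rightarrow> 'x option) \<Rightarrow> 'v \<Rightarrow> 'x set" where
  "offers E red cl v = {x. red x \<and> (\<exists>u. (v, u) \<in> E \<and> cl u = Some x)}"

definition proposal :: "('v \<times> 'v) set \<Rightarrow> ('x \<Rightarrow> bool) \<Rightarrow> ('v \<Rightarrow> 'x option) \<Rightarrow> 'v \<Rightarrow> 'x option" where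
  "proposal E red cl v =
     (if (\<exists>x. cl v = Some x \<and> \<not> red x) \<and> offers E red cl v \<noteq> {}
      then Some (SOME x. x \<in> offers E red cl v) else None)"

text \<open>The proposers must be at least a \<open>1 / (2 * b)\<close> fraction of the cluster.
  With \<open>b\<close> phases, losing at most this fraction per phase leaves half of the
  vertices.\<close>

definition accepts :: "nat \<Rightarrow> ('v \<times> 'v) set \<Rightarrow> ('x \<Rightarrow> bool) \<Rightarrow> ('v \<Rightarrow> 'x option) \<Rightarrow> 'x \<Rightarrow> bool" where
  "accepts b E red cl x \<longleftrightarrow> card (members cl x) \<le> 2 * b * card (members (proposal E red cl) x)"

text \<open>Rejection is the only way of dropping a vertex: it creates the gap between the rejecting
  cluster and its blue neighbours.\<close>

definition carve_step :: "nat \<Rightarrow> ('v \<times> 'v) set \<Rightarrow> ('x \<Rightarrow> bool) \<Rightarrow> ('v \<Rightarrow> 'x option) \<Rightarrow> 'v \<Rightarrow> 'x option" where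
  "carve_step b E red cl v =
     (case proposal E red cl v of None \<Rightarrow> cl v
      | Some x \<Rightarrow> if accepts b E red cl x then Some x else None)"

text \<open>The terminal state of a red cluster within a phase: it gets no further proposals and
  never changes again. Dropped neighbours do not count.\<close>

definition calm :: "('v \<times> 'v) set \<Rightarrow> ('x \<Rightarrow> bool) \<Rightarrow> ('v \<Rightarrow> 'x option) \<Rightarrow> 'x \<Rightarrow> bool" where
  "calm E red cl x \<longleftrightarrow> (\<forall>v u y. cl v = Some y \<and> \<not> red y \<and> (v, u) \<in> E \<longrightarrow> cl u \<noteq> Some x)"

lemma proposalD:
  assumes "proposal E red cl v = Some x"
  shows "red x \<and> (\<exists>u. (v, u) \<in> E \<and> cl u = Some x) \<and> (\<exists>y. cl v = Some y \<and> \<not> red y)"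
proof -
  from assms have b: "\<exists>x. cl v = Some x \<and> \<not> red x" and o: "offers E red cl v \<noteq> {}"
    and x: "x = (SOME x. x \<in> offers E red cl v)"
    by (auto simp: proposal_def split: if_splits)
  from o have "x \<in> offers E red cl v" unfolding x by (simp add: some_in_eq)
  with b show ?thesis by (auto simp: offers_def)
qed

lemma proposal_NoneD:
  "proposal E red cl v = None \<Longrightarrow> cl v = Some y \<Longrightarrow> \<not> red y \<Longrightarrow> (v, u) \<in> E \<Longrightarrow> cl u = Some x \<Longrightarrow> \<not> red x"
  by (auto simp: proposal_def offers_def split: if_splits)

lemma proposal_red: "cl v = Some x \<Longrightarrow> red x \<Longrightarrow> proposal E red cl v = None"
  by (auto simp: proposal_def)

lemma carve_step_blue:
  assumes "carve_step b E red cl v = Some y" "\<not> red y"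
  shows "proposal E red cl v = None \<and> cl v = Some y"
  using assms proposalD[of E red cl v] by (auto simp: carve_step_def split: option.splits if_splits)

lemma members_carve_step:
  assumes "red x"
  shows "members (carve_step b E red cl) x =
    members cl x \<union> (if accepts b E red cl x then members (proposal E red cl) x else {})"
  using assms proposal_red[of cl _ x red E] unfolding members_def carve_step_def
  by (auto split: option.splits if_splits)

lemma calm_proposals:
  assumes "calm E red cl x" shows "members (proposal E red cl) x = {}"
  using assms unfolding calm_def members_def by (blast dest: proposalD)

text \<open>A vertex that is still blue made no proposal, so no red cluster touched it before the
  step, and \<open>x\<close> has gained no members since.\<close>

lemma calm_carve_step:
  assumes "red x" "members (carve_step b E red cl) x = members cl x"
    and "calm E red cl x \<or> \<not> accepts b E red cl x"
  shows "calm E red (carve_step b E red cl) x"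
  unfolding calm_def
proof (intro allI impI)
  fix v u y assume a: "carve_step b E red cl v = Some y \<and> \<not> red y \<and> (v, u) \<in> E"
  then have "proposal E red cl v = None" "cl v = Some y" using carve_step_blue[of b E red cl v y] by auto
  then have "cl u \<noteq> Some x" using a assms(1) proposal_NoneD[of E red cl v y u x] by blast
  then show "carve_step b E red cl u \<noteq> Some x" using assms(2) by (auto simp: members_def)
qed

lemma calm_persists:
  assumes "red x" "calm E red cl x"
  shows "members (carve_step b E red cl) x = members cl x \<and> calm E red (carve_step b E red cl) x"
proof -
  have "members (carve_step b E red cl) x = members cl x"
    using members_carve_step[of red x b E cl, OF assms(1)] calm_proposals[OF assms(2)] by auto
  then show ?thesis using calm_carve_step[of red x, OF assms(1)] assms(2) by blast
qed

text \<open>Every blue neighbour of \<open>x\<close> proposed somewhere and hence turns red or is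
  dropped, while \<open>x\<close> does not grow. A cluster thus turns proposers away at most once
  per phase.\<close>

lemma reject_calm:
  assumes "red x" "\<not> accepts b E red cl x"
  shows "members (carve_step b E red cl) x = members cl x \<and> calm E red (carve_step b E red cl) x"
proof -
  have "members (carve_step b E red cl) x = members cl x"
    using members_carve_step[of red x b E cl, OF assms(1)] assms(2) by auto
  then show ?thesis using calm_carve_step[of red x, OF assms(1)] assms(2) by blast
qed

text \<open>By Bernoulli, \<open>2 * b\<close> accepted rounds at least double a cluster, so
  \<open>2 * b * k\<close> of them would make it larger than \<open>s\<close>. This fixes the length
  of a phase.\<close>

lemma growth_bound:
  assumes "(0::nat) < b" "s < 2 ^ k"
  shows "s * (2 * b) ^ (2 * b * k) < (2 * b + 1) ^ (2 * b * k)"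
proof -
  have "2 \<le> 1 + real (2 * b) * (1 / (2 * b))" using assms(1) by simp
  also have "\<dots> \<le> (1 + 1 / (2 * b)) ^ (2 * b)" by (rule Bernoulli_inequality) (rule order_trans[of _ 0], auto)
  finally have "(2::real) ^ k \<le> ((1 + 1 / (2 * b)) ^ (2 * b)) ^ k" by (intro power_mono) auto
  then have "real s < (1 + 1 / (2 * b)) ^ (2 * b * k)"
    using assms(2) by (simp add: power_mult) (metis of_nat_less_iff of_nat_numeral of_nat_power order_less_le_trans)
  then have "real s * (2 * b) ^ (2 * b * k) < (1 + 1 / (2 * b)) ^ (2 * b * k) * (2 * b) ^ (2 * b * k)"
    using assms(1) by (intro mult_strict_right_mono) auto
  also have "\<dots> = real (2 * b + 1) ^ (2 * b * k)"
  proof -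
    have "(1 + 1 / real (2 * b)) * real (2 * b) = real (2 * b + 1)"
      using assms(1) by (simp add: field_simps)
    then have "(1 + 1 / real (2 * b)) ^ n * real (2 * b) ^ n = real (2 * b + 1) ^ n" for n
      by (simp only: power_mult_distrib[symmetric])
    then show ?thesis by (simp only: of_nat_power)
  qed
  finally have "real (s * (2 * b) ^ (2 * b * k)) < real ((2 * b + 1) ^ (2 * b * k))" by simp
  then show ?thesis by (simp only: of_nat_less_iff)
qed

text \<open>One bit phase of the clustering of Rozhon and Ghaffari, seen from a finite region \<open>W\<close> that no
  edge between clustered vertices leaves; \<open>X\<close> is the set of clusters inside \<open>W\<close>.\<close>
locale carve_phase =
  fixes E :: "('v \<times> 'v) set" and red :: "'x \<Rightarrow> bool" and b s k :: nat
    and cls :: "nat \<Rightarrow> 'v \<Rightarrow> 'x option" and W :: "'v set" and X :: "'x set"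
  assumes step: "\<And>i. i < 2 * b * k \<Longrightarrow> cls (Suc i) = carve_step b E red (cls i)"
    and region: "\<And>i v x. i \<le> 2 * b * k \<Longrightarrow> cls i v = Some x \<Longrightarrow> v \<in> W \<longleftrightarrow> x \<in> X"
    and closed: "\<And>i u v x y. i \<le> 2 * b * k \<Longrightarrow> (v, u) \<in> E \<Longrightarrow> cls i v = Some x \<Longrightarrow> cls i u = Some y \<Longrightarrow> v \<in> W \<longleftrightarrow> u \<in> W"
    and fin: "finite W" and size: "card W \<le> s" and sk: "s < 2 ^ k" and b: "0 < b"
begin

lemma members_W: "i \<le> 2 * b * k \<Longrightarrow> x \<in> X \<Longrightarrow> members (cls i) x \<subseteq> W"
  using region by (auto simp: members_def)

lemma finite_members: "i \<le> 2 * b * k \<Longrightarrow> x \<in> X \<Longrightarrow> finite (members (cls i) x)"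
  using members_W fin finite_subset by blast

lemma proposal_region:
  assumes "i \<le> 2 * b * k" "proposal E red (cls i) v = Some x" shows "v \<in> W \<longleftrightarrow> x \<in> X"
proof -
  from proposalD[OF assms(2)] obtain u y
    where "(v, u) \<in> E" "cls i u = Some x" "cls i v = Some y" by blast
  then show ?thesis using closed[OF assms(1)] region[OF assms(1)] by blast
qed

lemma finite_proposals:
  assumes "i \<le> 2 * b * k" "x \<in> X" shows "finite (members (proposal E red (cls i)) x)"
proof -
  have "members (proposal E red (cls i)) x \<subseteq> W"
    using proposal_region[OF assms(1)] assms(2) by (auto simp: members_def)
  then show ?thesis using fin finite_subset by blast
qed

text \<open>A cluster not calm after a step was neither calm nor rejecting before it, so it accepted
  and grew by the factor \<open>(2 * b + 1) / (2 * b)\<close>. The powers of \<open>2 * b\<close>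
  stand on the right to remain in the naturals.\<close>

lemma unsettled_grows:
  assumes "red x" "x \<in> X"
  shows "i \<le> 2 * b * k \<Longrightarrow> \<not> calm E red (cls i) x \<Longrightarrow>
    (2 * b + 1) ^ i \<le> (2 * b) ^ i * card (members (cls i) x)"
proof (induction i)
  case 0
  then have "members (cls 0) x \<noteq> {}" by (auto simp: calm_def members_def)
  then show ?case using finite_members[of 0 x] assms(2) by (simp add: Suc_le_eq card_gt_0_iff)
next
  case (Suc i)
  let ?M = "members (cls i) x" and ?P = "members (proposal E red (cls i)) x"
  have i: "i < 2 * b * k" "i \<le> 2 * b * k" using Suc.prems by auto
  have nc: "\<not> calm E red (cls i) x" and acc: "accepts b E red (cls i) x"
    using Suc.prems(2) calm_persists[of red x E "cls i" b, OF assms(1)] reject_calm[of red x b E "cls i", OF assms(1)]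
    unfolding step[OF i(1)] by auto
  have eq: "members (cls (Suc i)) x = ?M \<union> ?P"
    unfolding step[OF i(1)] members_carve_step[of red x, OF assms(1)] using acc by simp
  have "?M \<inter> ?P = {}" using proposal_red[of "cls i" _ x red E] assms(1) by (auto simp: members_def)
  then have card: "card (members (cls (Suc i)) x) = card ?M + card ?P"
    unfolding eq using finite_members[OF i(2) assms(2)] finite_proposals[OF i(2) assms(2)] by (simp add: card_Un_disjoint)
  have "(2 * b + 1) ^ Suc i = (2 * b + 1) * (2 * b + 1) ^ i" by simp
  also have "\<dots> \<le> (2 * b + 1) * ((2 * b) ^ i * card ?M)"
    by (intro mult_left_mono Suc.IH i nc) auto
  also have "\<dots> = (2 * b) ^ i * (2 * b * card ?M + card ?M)" by (simp add: algebra_simps)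
  also have "\<dots> \<le> (2 * b) ^ i * (2 * b * card ?M + 2 * b * card ?P)"
    using acc unfolding accepts_def by (intro mult_left_mono add_left_mono) auto
  also have "\<dots> = (2 * b) ^ Suc i * card (members (cls (Suc i)) x)"
    unfolding card by (simp add: algebra_simps)
  finally show ?case .
qed

lemma final_calm:
  assumes "red x" "x \<in> X" shows "calm E red (cls (2 * b * k)) x"
proof (rule ccontr)
  assume "\<not> ?thesis"
  from unsettled_grows[OF assms order_refl this]
  have "(2 * b + 1) ^ (2 * b * k) \<le> (2 * b) ^ (2 * b * k) * card (members (cls (2 * b * k)) x)" .
  also have "\<dots> \<le> (2 * b) ^ (2 * b * k) * s"
    using card_mono[OF fin members_W[OF order_refl assms(2)]] size by (intro mult_left_mono) auto
  finally show False using growth_bound[OF b sk] by (simp add: mult.commute)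
qed

lemma final_monochromatic:
  assumes "v \<in> W" "cls (2 * b * k) v = Some x" "(v, u) \<in> E" "(u, v) \<in> E" "cls (2 * b * k) u = Some y"
  shows "red x \<longleftrightarrow> red y"
proof -
  have "x \<in> X" "y \<in> X" using region closed assms by blast+
  then show ?thesis
    using final_calm[of x] final_calm[of y] assms unfolding calm_def by blast
qed

definition settled :: "nat \<Rightarrow> 'v set" where
  "settled i = {v \<in> W. \<exists>x. cls i v = Some x \<and> red x \<and> calm E red (cls i) x}"

text \<open>Charging argument: a rejecting cluster drops fewer than a \<open>1 / (2 * b)\<close>
  fraction of its own size, and its members become settled at that moment for good. So every settled
  vertex pays only once.\<close>

lemma lost_le_settled:
  "i \<le> 2 * b * k \<Longrightarrow> 2 * b * card {v \<in> W. cls 0 v \<noteq> None \<and> cls i v = None} \<le> card (settled i)"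
proof (induction i)
  case (Suc i)
  let ?lost = "\<lambda>i. {v \<in> W. cls 0 v \<noteq> None \<and> cls i v = None}"
  let ?P = "members (proposal E red (cls i))" and ?M = "members (cls i)"
  \<comment> \<open>Requiring a proposal ensures that the listed clusters are not yet calm, hence
    that their members are not among the settled ones.\<close>
  let ?Y = "{x \<in> X. red x \<and> \<not> accepts b E red (cls i) x \<and> ?P x \<noteq> {}}"
  have i: "i < 2 * b * k" "i \<le> 2 * b * k" using Suc.prems by auto
  have "?Y \<subseteq> (\<lambda>v. the (proposal E red (cls i) v)) ` W"
    using proposal_region[OF i(2)] by (force simp: members_def)
  then have finY: "finite ?Y" using fin finite_surj by blast
  have "?lost (Suc i) \<subseteq> ?lost i \<union> (\<Union>x\<in>?Y. ?P x)"
  proof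
    fix v assume v: "v \<in> ?lost (Suc i)"
    show "v \<in> ?lost i \<union> (\<Union>x\<in>?Y. ?P x)"
    proof (cases "cls i v")
      case None
      then show ?thesis using v by auto
    next
      case (Some y)
      have "carve_step b E red (cls i) v = None" using v step[OF i(1)] by simp
      then obtain x where x: "proposal E red (cls i) v = Some x" "\<not> accepts b E red (cls i) x"
        using Some by (auto simp: carve_step_def split: option.splits if_splits)
      then have "x \<in> ?Y" using v proposalD[OF x(1)] proposal_region[OF i(2) x(1)] by (auto simp: members_def)
      then show ?thesis using x(1) by (auto simp: members_def)
    qed
  qed
  then have "card (?lost (Suc i)) \<le> card (?lost i \<union> (\<Union>x\<in>?Y. ?P x))"
    using fin finY finite_proposals[OF i(2)] by (intro card_mono) auto
  also have "\<dots> \<le> card (?lost i) + card (\<Union>x\<in>?Y. ?P x)" by (rule card_Un_le)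
  also have "card (\<Union>x\<in>?Y. ?P x) \<le> (\<Sum>x\<in>?Y. card (?P x))" using finY by (rule card_UN_le)
  finally have "2 * b * card (?lost (Suc i)) \<le> 2 * b * (card (?lost i) + (\<Sum>x\<in>?Y. card (?P x)))"
    by simp
  also have "\<dots> = 2 * b * card (?lost i) + (\<Sum>x\<in>?Y. 2 * b * card (?P x))"
    by (simp add: sum_distrib_left algebra_simps)
  also have "\<dots> \<le> card (settled i) + (\<Sum>x\<in>?Y. card (?M x))"
    using Suc.IH i(2) by (intro add_mono sum_mono) (auto simp: accepts_def)
  also have "(\<Sum>x\<in>?Y. card (?M x)) = card (\<Union>x\<in>?Y. ?M x)"
    using finY finite_members[OF i(2)] by (subst card_UN_disjoint) (auto simp: members_def)
  also have "card (settled i) + card (\<Union>x\<in>?Y. ?M x) = card (settled i \<union> (\<Union>x\<in>?Y. ?M x))"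
  proof (rule card_Un_disjoint[symmetric])
    show "finite (settled i)" using fin by (simp add: settled_def)
    show "finite (\<Union>x\<in>?Y. ?M x)" using finY finite_members[OF i(2)] by auto
    have "v \<notin> ?M x" if "v \<in> settled i" "x \<in> ?Y" for v x
      using that calm_proposals[of E red "cls i" x] by (auto simp: settled_def members_def)
    then show "settled i \<inter> (\<Union>x\<in>?Y. ?M x) = {}" by blast
  qed
  also have "\<dots> \<le> card (settled (Suc i))"
  proof (rule card_mono)
    show "finite (settled (Suc i))" using fin by (simp add: settled_def)
    have keep: "v \<in> settled (Suc i)"
      if "v \<in> W" "cls i v = Some x" "red x"
        "members (carve_step b E red (cls i)) x = ?M x \<and> calm E red (carve_step b E red (cls i)) x" for v x
    proof -
      have "v \<in> members (carve_step b E red (cls i)) x" using that(2,4) by (simp add: members_def)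
      then show ?thesis using that step[OF i(1)] by (auto simp: settled_def members_def)
    qed
    have "v \<in> settled (Suc i)" if "v \<in> settled i" for v
      using that keep calm_persists[of red _ E "cls i" b] unfolding settled_def by blast
    moreover have "v \<in> settled (Suc i)" if "x \<in> ?Y" "v \<in> ?M x" for v x
      using that keep[of v x] reject_calm[of red x b E "cls i"] members_W[OF i(2), of x] by (auto simp: members_def)
    ultimately show "settled i \<union> (\<Union>x\<in>?Y. ?M x) \<subseteq> settled (Suc i)" by blast
  qed
  finally show ?case .
next
  case 0
  have "{v \<in> W. cls 0 v \<noteq> None \<and> cls 0 v = None} = {}" by blast
  then show ?case by (metis card.empty mult_0_right zero_le)
qed

lemma lost_le: "2 * b * card {v \<in> W. cls 0 v \<noteq> None \<and> cls (2 * b * k) v = None} \<le> card W"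
proof -
  have "card (settled (2 * b * k)) \<le> card W" using fin by (intro card_mono) (auto simp: settled_def)
  then show ?thesis using lost_le_settled[OF order_refl] by simp
qed

end

section \<open>Labels and the local form of the clustering\<close>

definition red_bit :: "nat \<Rightarrow> nat \<times> nat \<Rightarrow> bool" where
  "red_bit j x \<longleftrightarrow> bit (snd x) j"

text \<open>Cluster sizes and proposals are counted only inside a ball; the result is unchanged as
  long as \<open>R\<close> covers the cluster and its proposers.\<close>

definition local_carve_step :: "nat \<Rightarrow> nat \<Rightarrow> (nat \<times> nat) set \<Rightarrow> ('x \<Rightarrow> bool) \<Rightarrow> (nat \<Rightarrow> 'x option) \<Rightarrow> nat \<Rightarrow> 'x option" where
  "local_carve_step b R E red cl v =
     (case proposal E red cl v of None \<Rightarrow> cl v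
      | Some x \<Rightarrow> if card {u \<in> ball E v R. cl u = Some x} \<le> 2 * b * card {u \<in> ball E v R. proposal E red cl u = Some x}
                then Some x else None)"

primrec clusters :: "nat \<Rightarrow> nat \<Rightarrow> nat \<Rightarrow> (nat \<times> nat) set \<Rightarrow> (nat \<Rightarrow> (nat \<times> nat) option) \<Rightarrow> nat \<Rightarrow> nat \<Rightarrow> (nat \<times> nat) option" where
  "clusters b n R E cl 0 = cl"
| "clusters b n R E cl (Suc j) = (local_carve_step b R E (red_bit j) ^^ n) (clusters b n R E cl j)"

definition modulus :: "(nat \<times> nat) set \<Rightarrow> nat set \<Rightarrow> (nat \<Rightarrow> nat) \<Rightarrow> nat \<Rightarrow> nat \<Rightarrow> nat" where
  "modulus E U idf R v =
     (LEAST p. 0 < p \<and> (\<forall>u\<in>ball (E \<inter> U \<times> U) v R - {v}. idf u mod p \<noteq> idf v mod p))"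

text \<open>The pair of modulus and residue in base \<open>B\<close>. The modulus belongs to the
  label because vertices choose different ones: equal labels mean equal residues for a common
  modulus, which that modulus excludes nearby.\<close>

definition label :: "(nat \<times> nat) set \<Rightarrow> nat set \<Rightarrow> (nat \<Rightarrow> nat) \<Rightarrow> nat \<Rightarrow> nat \<Rightarrow> nat \<Rightarrow> nat" where
  "label E U idf R B v = modulus E U idf R v * B + idf v mod modulus E U idf R v"

text \<open>A cluster is named by its initial vertex together with that vertex's label: labels are
  short but only locally unique, and the vertex keeps distant clusters apart.\<close>

definition singletons :: "(nat \<times> nat) set \<Rightarrow> nat set \<Rightarrow> (nat \<Rightarrow> nat) \<Rightarrow> nat \<Rightarrow> nat \<Rightarrow> nat \<Rightarrow> (nat \<times> nat) option" where
  "singletons E U idf R B v = (if v \<in> U then Some (v, label E U idf R B v) else None)"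

definition extends :: "nat \<Rightarrow> (nat \<times> nat) set \<Rightarrow> (nat \<Rightarrow> nat) \<Rightarrow> nat set \<Rightarrow> (nat \<Rightarrow> nat) \<Rightarrow> bool" where
  "extends D E \<sigma> M g \<longleftrightarrow> (\<forall>u\<in>M. g u \<in> {1..D + 1} \<and>
     (\<forall>w. (u, w) \<in> E \<longrightarrow> (\<sigma> w \<noteq> 0 \<longrightarrow> g u \<noteq> \<sigma> w) \<and> (w \<in> M \<longrightarrow> g u \<noteq> g w)))"

text \<open>All members see the same whole cluster and therefore make the same Hilbert choice; no
  leader has to distribute the brute-force colouring.\<close>

definition paint :: "nat \<Rightarrow> nat \<Rightarrow> (nat \<times> nat) set \<Rightarrow> (nat \<Rightarrow> nat) \<Rightarrow> (nat \<Rightarrow> 'x option) \<Rightarrow> nat \<Rightarrow> nat" where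
  "paint D R E \<sigma> cl v =
     (if cl v = None then \<sigma> v else (SOME g. extends D E \<sigma> {u \<in> ball E v R. cl u = cl v} g) v)"

text \<open>\<open>\<rho>\<close> is the total number of carving steps and bounds the distance to a
  cluster centre. Radius \<open>2 * \<rho> + 2\<close> covers a cluster and its proposers,
  \<open>2 * \<rho> + 1\<close> the distance between centres of touching clusters.\<close>

definition finish_step :: "nat \<Rightarrow> nat \<Rightarrow> nat \<Rightarrow> nat \<Rightarrow> (nat \<times> nat) set \<Rightarrow> nat set \<Rightarrow> (nat \<Rightarrow> nat) \<Rightarrow> (nat \<Rightarrow> nat) \<Rightarrow> nat \<Rightarrow> nat" where
  "finish_step D B b k E P idf \<sigma> =
     (let \<rho> = b * (2 * b * k) in
      paint D (2 * \<rho> + 2) E \<sigma>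
        (clusters b (2 * b * k) (2 * \<rho> + 2) E (singletons E {v \<in> P. \<sigma> v = 0} idf (2 * \<rho> + 1) B) b))"

lemma bit_less_two_power: "bit (l::nat) i \<Longrightarrow> l < 2 ^ b \<Longrightarrow> i < b"
  by (metis bit_take_bit_iff take_bit_nat_eq_self)

text \<open>A vertex that changes its cluster joins that of a neighbour, where \<open>f\<close>
  already had the same value. Hence later phases preserve agreement on earlier bits.\<close>

lemma carve_step_agree:
  assumes "\<And>v u x y. (v, u) \<in> E \<Longrightarrow> cl v = Some x \<Longrightarrow> cl u = Some y \<Longrightarrow> f x = f y"
    and "(v, u) \<in> E" "carve_step b E red cl v = Some x" "carve_step b E red cl u = Some y"
  shows "f x = f y"
proof -
  have keep: "\<exists>z. cl v = Some z \<and> f z = f x" if "carve_step b E red cl v = Some x" for v x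
  proof (cases "proposal E red cl v")
    case None
    then show ?thesis using that by (auto simp: carve_step_def)
  next
    case (Some x')
    then have "x' = x" using that by (auto simp: carve_step_def split: if_splits)
    then show ?thesis using proposalD[OF Some] assms(1) by blast
  qed
  from keep[OF assms(3)] keep[OF assms(4)] obtain z z'
    where "cl v = Some z" "f z = f x" "cl u = Some z'" "f z' = f y" by blast
  then show ?thesis using assms(1)[OF assms(2)] by metis
qed

lemma ball_closed: "F `` W \<subseteq> W \<Longrightarrow> v \<in> W \<Longrightarrow> ball F v i \<subseteq> W"
  by (induction i) (auto simp: ball_Suc)

text \<open>\<open>\<mu>\<close> is the bit length of the IDs, \<open>s\<close> bounds component
  sizes, \<open>k\<close> counts halvings and \<open>b\<close> label bits. The last assumption lets
  modulus and residue, both below \<open>2 * (\<mu> * s) + 2\<close>, fit into \<open>b\<close>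
  bits.\<close>

locale finishing = bounded_graph +
  fixes idf :: "nat \<Rightarrow> nat" and s k \<mu> b :: nat
  assumes inj_id: "inj_on idf V" and id_less: "\<And>v. v \<in> V \<Longrightarrow> idf v < 2 ^ \<mu>"
    and s: "0 < s" "s < 2 ^ k" and mu: "0 < \<mu>" and b: "0 < b"
    and labels: "(2 * (\<mu> * s) + 2) ^ 2 \<le> 2 ^ b"

text \<open>Any closed set rather than one component: removing newly coloured vertices leaves a
  region again, while a component may fall apart.\<close>

definition small_region :: "nat \<Rightarrow> (nat \<times> nat) set \<Rightarrow> nat set \<Rightarrow> nat set \<Rightarrow> bool" where
  "small_region s E U W \<longleftrightarrow> W \<subseteq> U \<and> (E \<inter> U \<times> U) `` W \<subseteq> W \<and> finite W \<and> card W \<le> s"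

section \<open>All bit phases together\<close>

locale clustering = finishing +
  fixes U :: "nat set"
  assumes small: "\<And>v. v \<in> U \<Longrightarrow> \<exists>W. v \<in> W \<and> small_region s E U W"
begin

abbreviation "F \<equiv> E \<inter> U \<times> U"
abbreviation "n \<equiv> 2 * b * k"
definition "\<rho> = b * n"
definition "B = 2 * (\<mu> * s) + 2"
abbreviation "lab \<equiv> label E U idf (2 * \<rho> + 1) B"
abbreviation "modu \<equiv> modulus E U idf (2 * \<rho> + 1)"
abbreviation "cl0 \<equiv> singletons E U idf (2 * \<rho> + 1) B"
abbreviation "cls \<equiv> clusters b n (2 * \<rho> + 2) E cl0"

lemma symF: "sym F"
  using edge_sym by (auto simp: sym_def)

lemma F_E: "F \<subseteq> E"
  by blast

lemma modulus_props:
  assumes v: "v \<in> U"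
  shows "0 < modu v \<and> modu v \<le> 2 * (\<mu> * s) + 1 \<and>
    (\<forall>u\<in>ball F v (2 * \<rho> + 1) - {v}. idf u mod modu v \<noteq> idf v mod modu v)"
proof -
  let ?I = "ball F v (2 * \<rho> + 1) - {v}"
  let ?Q = "\<lambda>p. 0 < p \<and> (\<forall>u\<in>?I. idf u mod p \<noteq> idf v mod p)"
  have "\<exists>p\<le>2 * (\<mu> * s) + 1. ?Q p"
  proof (cases "?I = {}")
    case True
    then show ?thesis by (intro exI[of _ 1]) (simp only: True ball_simps, simp)
  next
    case False
    have "ball F v (2 * \<rho> + 1) \<subseteq> V" if "v \<in> V"
      using ball_closed[of F V v] edges that by blast
    moreover have "v \<in> V"
    proof (rule ccontr)
      assume "v \<notin> V"
      then have "ball F v i \<subseteq> {v}" for i using edges by (intro ball_closed) auto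
      then show False using False by blast
    qed
    ultimately have IV: "?I \<subseteq> V" "v \<in> V" by auto
    obtain W where W: "v \<in> W" "small_region s E U W" using small[OF v] by blast
    then have IW: "?I \<subseteq> W" using ball_closed[of F W v] unfolding small_region_def by blast
    have finI: "finite ?I" using IV(1) fin finite_subset by blast
    have "card (idf ` ?I) \<le> card ?I" using finI by (rule card_image_le)
    also have "\<dots> \<le> s" using W IW card_mono[of W ?I] unfolding small_region_def by linarith
    finally have "card (idf ` ?I) \<le> s" .
    moreover have "idf v \<notin> idf ` ?I"
    proof
      assume "idf v \<in> idf ` ?I"
      then obtain u where "u \<in> ?I" "idf v = idf u" by blast
      then show False using IV inj_onD[OF inj_id, of v u] by blast
    qed
    ultimately have "\<exists>p\<in>{1..2 * (\<mu> * s) + 1}. \<forall>y\<in>idf ` ?I. y mod p \<noteq> idf v mod p"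
      using IV finI s mu id_less by (intro ex_separating_modulus) auto
    then show ?thesis by (fastforce simp: Suc_le_eq)
  qed
  then obtain p where p: "p \<le> 2 * (\<mu> * s) + 1" "?Q p" by blast
  have "?Q (modu v)" unfolding modulus_def by (rule LeastI[of ?Q, OF p(2)])
  moreover have "modu v \<le> p" unfolding modulus_def by (rule Least_le[of ?Q, OF p(2)])
  ultimately show ?thesis using p(1) by (auto intro: order_trans)
qed

lemma label_less:
  assumes "v \<in> U" shows "lab v < 2 ^ b"
proof -
  have m: "0 < modu v" "modu v \<le> 2 * (\<mu> * s) + 1" using modulus_props[OF assms] by auto
  then have "idf v mod modu v < B" using mod_less_divisor[of "modu v" "idf v"] unfolding B_def by linarith
  then have "lab v < modu v * B + B" by (simp add: label_def)
  also have "\<dots> = (modu v + 1) * B" by (simp add: algebra_simps)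
  also have "\<dots> \<le> B * B" using m(2) by (intro mult_right_mono) (auto simp: B_def)
  also have "\<dots> \<le> 2 ^ b" using labels by (simp only: power2_eq_square B_def)
  finally show ?thesis .
qed

lemma label_inj:
  assumes "u \<in> U" "v \<in> U" "u \<in> ball F v (2 * \<rho> + 1)" "lab u = lab v"
  shows "u = v"
proof (rule ccontr)
  assume "u \<noteq> v"
  have div: "lab w div B = modu w \<and> lab w mod B = idf w mod modu w" if "w \<in> U" for w
  proof -
    have "0 < modu w" "modu w \<le> 2 * (\<mu> * s) + 1" using modulus_props[OF that] by auto
    then have "idf w mod modu w < B" using mod_less_divisor[of "modu w" "idf w"] unfolding B_def by linarith
    then show ?thesis by (simp add: label_def)
  qed
  have "modu u = modu v" "idf u mod modu u = idf v mod modu v"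
    using div[OF assms(1)] div[OF assms(2)] assms(4) by auto
  then show False using modulus_props[OF assms(2)] assms(3) \<open>u \<noteq> v\<close> by auto
qed

text \<open>Only a weak radius is controlled: distances are taken in the graph of all uncoloured
  vertices, and the centre \<open>c\<close> may have left its own cluster.\<close>

definition inv :: "nat \<Rightarrow> (nat \<Rightarrow> (nat \<times> nat) option) \<Rightarrow> bool" where
  "inv i cl \<longleftrightarrow> (\<forall>v c l. cl v = Some (c, l) \<longrightarrow> v \<in> U \<and> c \<in> U \<and> l = lab c \<and> c \<in> ball F v i)"

lemma inv_start: "inv 0 cl0"
  by (auto simp: inv_def singletons_def)

lemma inv_mono: "inv i cl \<Longrightarrow> i \<le> j \<Longrightarrow> inv j cl"
  using ball_mono[of i j F] unfolding inv_def by blast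

lemma inv_edge: "inv i cl \<Longrightarrow> (v, u) \<in> E \<Longrightarrow> cl v = Some x \<Longrightarrow> cl u = Some y \<Longrightarrow> (v, u) \<in> F"
  unfolding inv_def by (cases x, cases y) blast

lemma inv_members:
  assumes "inv i cl" "cl v = Some x" "cl u = Some x"
  shows "u \<in> ball E v (2 * i)"
proof -
  obtain c l where x: "x = (c, l)" by (cases x)
  then have "c \<in> ball F v i" "c \<in> ball F u i" using assms unfolding inv_def by blast+
  then have "u \<in> ball F v (i + i)" using ball_trans ball_sym[OF symF] by blast
  then show ?thesis using ball_mono_rel[OF F_E] by (auto simp: mult_2)
qed

text \<open>Members of a cluster are within \<open>2 * i\<close> of each other via the centre. A
  proposer touches one of them, so it sees all members within \<open>2 * i + 1\<close> and all other
  proposers within \<open>2 * i + 2\<close>.\<close>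

lemma local_carve_step_eq:
  assumes inv: "inv i cl" and i: "i \<le> \<rho>"
  shows "local_carve_step b (2 * \<rho> + 2) E red cl = carve_step b E red cl"
proof
  fix v
  show "local_carve_step b (2 * \<rho> + 2) E red cl v = carve_step b E red cl v"
  proof (cases "proposal E red cl v")
    case None
    then show ?thesis by (simp add: local_carve_step_def carve_step_def)
  next
    case (Some x)
    from proposalD[OF Some] obtain u0 where u0: "(v, u0) \<in> E" "cl u0 = Some x" by blast
    have near: "u \<in> ball E v (2 * i + 1)" if "cl u = Some x" for u
      using ball_trans[OF ball_edge[OF u0(1), of 1] inv_members[OF inv u0(2) that]] by simp
    then have near': "u \<in> ball E v (2 * \<rho> + 2)" if "cl u = Some x" for u
      using that i ball_mono[of "2 * i + 1" "2 * \<rho> + 2" E v] by auto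
    have proposer: "w \<in> ball E v (2 * \<rho> + 2)" if "proposal E red cl w = Some x" for w
    proof -
      from proposalD[OF that] obtain u where u: "(w, u) \<in> E" "cl u = Some x" by blast
      then have "w \<in> ball E v (Suc (2 * i + 1))"
        using near ball_step[of u E v _ w] edge_sym by blast
      then show ?thesis using i ball_mono[of "Suc (2 * i + 1)" "2 * \<rho> + 2" E v] by auto
    qed
    have "{u \<in> ball E v (2 * \<rho> + 2). cl u = Some x} = members cl x"
      using near' by (auto simp: members_def)
    moreover have "{u \<in> ball E v (2 * \<rho> + 2). proposal E red cl u = Some x} = members (proposal E red cl) x"
      using proposer by (auto simp: members_def)
    ultimately show ?thesis using Some by (simp add: local_carve_step_def carve_step_def accepts_def)
  qed
qed

lemma inv_carve_step:
  assumes "inv i cl" shows "inv (Suc i) (carve_step b E red cl)"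
  unfolding inv_def
proof (intro allI impI)
  fix v c l assume a: "carve_step b E red cl v = Some (c, l)"
  show "v \<in> U \<and> c \<in> U \<and> l = lab c \<and> c \<in> ball F v (Suc i)"
  proof (cases "proposal E red cl v")
    case None
    then have "cl v = Some (c, l)" using a by (simp add: carve_step_def)
    then show ?thesis using inv_mono[OF assms, of "Suc i"] unfolding inv_def by auto
  next
    case (Some x)
    then have x: "x = (c, l)" using a by (auto simp: carve_step_def split: if_splits)
    from proposalD[OF Some] obtain u y where u: "(v, u) \<in> E" "cl u = Some (c, l)" "cl v = Some y"
      unfolding x by blast
    then have "(v, u) \<in> F" using inv_edge[OF assms] by blast
    moreover have "c \<in> U" "l = lab c" "c \<in> ball F u i" using assms u(2) unfolding inv_def by blast+
    ultimately show ?thesis using ball_trans[OF ball_edge[of v u F 1], of c i] by auto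
  qed
qed

lemma phase_steps:
  assumes "inv i cl" "i + m \<le> \<rho>"
  shows "(local_carve_step b (2 * \<rho> + 2) E red ^^ m) cl = (carve_step b E red ^^ m) cl \<and>
    inv (i + m) ((carve_step b E red ^^ m) cl)"
  using assms(2)
proof (induction m)
  case 0
  then show ?case using assms(1) by simp
next
  case (Suc m)
  then show ?case using local_carve_step_eq[of "i + m"] inv_carve_step[of "i + m"] by simp
qed

lemma small_regionD:
  assumes "small_region s E U W" "inv i cl" "cl v = Some x"
  shows "v \<in> W \<longleftrightarrow> fst x \<in> W"
proof -
  obtain c l where x: "x = (c, l)" by (cases x)
  then have "c \<in> ball F v i" using assms(2,3) unfolding inv_def by blast
  then show ?thesis
    using ball_closed[of F W v i] ball_closed[of F W c i] ball_sym[OF symF, of c v i] assms(1) x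
    unfolding small_region_def by auto
qed

lemma phase:
  assumes inv: "inv i cl" "i + n \<le> \<rho>" and W: "small_region s E U W"
  shows "carve_phase E red b s k (\<lambda>m. (carve_step b E red ^^ m) cl) W {x. fst x \<in> W}"
proof
  fix m v x assume m: "m \<le> 2 * b * k" and x: "(carve_step b E red ^^ m) cl v = Some x"
  then have inv': "inv (i + m) ((carve_step b E red ^^ m) cl)"
    using inv phase_steps[of i cl m red] by simp
  show "v \<in> W \<longleftrightarrow> x \<in> {x. fst x \<in> W}" using small_regionD[OF W inv' x] by simp
  fix u y assume u: "(v, u) \<in> E" "(carve_step b E red ^^ m) cl u = Some y"
  have "(v, u) \<in> F" by (rule inv_edge[OF inv' u(1) x u(2)])
  moreover from this have "(u, v) \<in> F" using symF by (rule symD[rotated])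
  ultimately show "v \<in> W \<longleftrightarrow> u \<in> W" using W unfolding small_region_def by blast
qed (use W s b in \<open>auto simp: small_region_def\<close>)

text \<open>Each phase adds \<open>n\<close> to the radius, keeps the earlier bits by
  \<open>carve_step_agree\<close>, settles its own bit by \<open>final_monochromatic\<close> and
  drops at most another \<open>1 / (2 * b)\<close> of every region.\<close>

lemma clusters_props:
  "j \<le> b \<Longrightarrow> inv (j * n) (cls j) \<and>
    (\<forall>v u x y i. (v, u) \<in> E \<longrightarrow> cls j v = Some x \<longrightarrow> cls j u = Some y \<longrightarrow> i < j \<longrightarrow> bit (snd x) i = bit (snd y) i) \<and>
    (\<forall>W. small_region s E U W \<longrightarrow> 2 * b * card {v \<in> W. cls j v = None} \<le> j * card W)"
proof (induction j)
  case 0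
  have "{v \<in> W. cls 0 v = None} = {}" if "small_region s E U W" for W
    using that by (auto simp: small_region_def singletons_def)
  then show ?case using inv_start by (simp add: card_eq_0_iff)
next
  case (Suc j)
  let ?c = "cls j" and ?f = "carve_step b E (red_bit j)"
  from Suc have IH: "inv (j * n) ?c"
    "\<And>v u x y i. (v, u) \<in> E \<Longrightarrow> ?c v = Some x \<Longrightarrow> ?c u = Some y \<Longrightarrow> i < j \<Longrightarrow> bit (snd x) i = bit (snd y) i"
    "\<And>W. small_region s E U W \<Longrightarrow> 2 * b * card {v \<in> W. ?c v = None} \<le> j * card W" by auto
  have le: "j * n + n \<le> \<rho>" using mult_right_mono[OF Suc.prems, of n] by (simp add: \<rho>_def)
  have eq: "cls (Suc j) = (?f ^^ n) ?c" and inv': "inv (j * n + n) ((?f ^^ n) ?c)"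
    using phase_steps[OF IH(1) le, of "red_bit j"] by auto
  have low: "bit (snd x) i = bit (snd y) i"
    if "(v, u) \<in> E" "(?f ^^ m) ?c v = Some x" "(?f ^^ m) ?c u = Some y" "i < j" for m v u x y i
    using that
  proof (induction m arbitrary: v u x y)
    case 0
    then show ?case using IH(2) by simp
  next
    case (Suc m)
    show ?case
    proof (rule carve_step_agree[where f = "\<lambda>x. bit (snd x) i"])
      show "bit (snd x) i = bit (snd y) i" if "(v, u) \<in> E" "(?f ^^ m) ?c v = Some x" "(?f ^^ m) ?c u = Some y" for v u x y
        using Suc.IH that Suc.prems(4) by blast
      show "(v, u) \<in> E" by fact
      show "?f ((?f ^^ m) ?c) v = Some x" "?f ((?f ^^ m) ?c) u = Some y" using Suc.prems by simp_all
    qed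
  qed
  have new: "bit (snd x) j = bit (snd y) j"
    if "(v, u) \<in> E" "(?f ^^ n) ?c v = Some x" "(?f ^^ n) ?c u = Some y" for v u x y
  proof -
    have "v \<in> U" using inv' that(2) unfolding inv_def by (cases x) blast
    then obtain W where W: "v \<in> W" "small_region s E U W" using small by blast
    interpret carve_phase E "red_bit j" b s k "\<lambda>m. (?f ^^ m) ?c" W "{x. fst x \<in> W}"
      by (rule phase[OF IH(1) le W(2)])
    show ?thesis using final_monochromatic[OF W(1) that(2,1) edge_sym[OF that(1)] that(3)]
      by (simp add: red_bit_def)
  qed
  have "2 * b * card {v \<in> W. (?f ^^ n) ?c v = None} \<le> Suc j * card W" if W: "small_region s E U W" for W
  proof -
    interpret carve_phase E "red_bit j" b s k "\<lambda>m. (?f ^^ m) ?c" W "{x. fst x \<in> W}"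
      by (rule phase[OF IH(1) le W])
    let ?N = "{v \<in> W. (?f ^^ n) ?c v = None}" and ?O = "{v \<in> W. ?c v = None}"
    let ?L = "{v \<in> W. ?c v \<noteq> None \<and> (?f ^^ n) ?c v = None}"
    have finW: "finite W" using W by (simp add: small_region_def)
    have "card ?N \<le> card (?O \<union> ?L)" using finW by (intro card_mono) auto
    also have "\<dots> \<le> card ?O + card ?L" by (rule card_Un_le)
    finally have "2 * b * card ?N \<le> 2 * b * card ?O + 2 * b * card ?L"
      by (simp add: add_mult_distrib2[symmetric] del: add_mult_distrib2)
    also have "\<dots> \<le> j * card W + card W" using IH(3)[OF W] lost_le by (intro add_mono) auto
    finally show ?thesis by simp
  qed
  moreover have "bit (snd x) i = bit (snd y) i"
    if "(v, u) \<in> E" "(?f ^^ n) ?c v = Some x" "(?f ^^ n) ?c u = Some y" "i < Suc j" for v u x y i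
    using low[OF that(1-3)] new[OF that(1-3)] that(4) by (cases "i = j") auto
  moreover have "inv (Suc j * n) ((?f ^^ n) ?c)" using inv' by (simp add: add.commute)
  ultimately show ?case unfolding eq by blast
qed

text \<open>All \<open>b\<close> bits of the two labels agree, so the labels are equal. The centres
  are at most \<open>\<rho> + 1 + \<rho>\<close> apart, a range in which labels are
  injective.\<close>

lemma clusters_adjacent:
  assumes "(v, u) \<in> E" "cls b v = Some x" "cls b u = Some y" shows "x = y"
proof -
  obtain c l where x: "x = (c, l)" by (cases x)
  obtain c' l' where y: "y = (c', l')" by (cases y)
  note props = clusters_props[OF order_refl]
  have inv: "inv \<rho> (cls b)" using props unfolding \<rho>_def by blast
  have c: "c \<in> U" "l = lab c" "c \<in> ball F v \<rho>" using inv assms(2) unfolding inv_def x by blast+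
  have c': "c' \<in> U" "l' = lab c'" "c' \<in> ball F u \<rho>" using inv assms(3) unfolding inv_def y by blast+
  have "bit l i = bit l' i" for i
  proof (cases "i < b")
    case True
    have "bit (snd x) i = bit (snd y) i" using props assms True by blast
    then show ?thesis by (simp add: x y)
  next
    case False
    then show ?thesis
      using bit_less_two_power[of l i b] bit_less_two_power[of l' i b] label_less[OF c(1)] label_less[OF c'(1)] c(2) c'(2)
      by auto
  qed
  then have "l = l'" by (simp add: bit_eq_iff)
  have "(v, u) \<in> F" by (rule inv_edge[OF inv assms])
  then have "c' \<in> ball F v (\<rho> + 1)" using ball_trans[OF ball_edge[of v u F 1] c'(3)] by simp
  moreover have "v \<in> ball F c \<rho>" using ball_sym[OF symF c(3)] .
  ultimately have "c' \<in> ball F c (\<rho> + 1 + \<rho>)" using ball_trans by blast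
  then have "c' = c" using label_inj[OF c'(1) c(1)] c c' \<open>l = l'\<close> by (simp add: mult_2)
  then show ?thesis using x y \<open>l = l'\<close> by simp
qed

lemma unclustered_half:
  assumes "small_region s E U W" shows "2 * card {v \<in> W. cls b v = None} \<le> card W"
proof -
  have "b * (2 * card {v \<in> W. cls b v = None}) \<le> b * card W"
    using clusters_props[OF order_refl] assms by (auto simp: mult_ac)
  then show ?thesis using b by simp
qed

lemma clustered_in_U: "cls b v \<noteq> None \<Longrightarrow> v \<in> U"
  using clusters_props[OF order_refl] unfolding inv_def by fast

lemma cluster_eq:
  assumes "cls b v \<noteq> None"
  shows "{u \<in> ball E v (2 * \<rho> + 2). cls b u = cls b v} = {u. cls b u = cls b v}"
proof -
  obtain x where x: "cls b v = Some x" using assms by auto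
  have inv: "inv \<rho> (cls b)" using clusters_props[OF order_refl] unfolding \<rho>_def by blast
  have "u \<in> ball E v (2 * \<rho> + 2)" if "cls b u = Some x" for u
    using inv_members[OF inv x that] ball_mono[of "2 * \<rho>" "2 * \<rho> + 2" E v] by auto
  then show ?thesis using x by auto
qed

end

section \<open>Finishing small components\<close>

definition finish :: "nat \<Rightarrow> nat \<Rightarrow> nat \<Rightarrow> nat \<Rightarrow> (nat \<times> nat) set \<Rightarrow> nat set \<Rightarrow> (nat \<Rightarrow> nat) \<Rightarrow> (nat \<Rightarrow> nat) \<Rightarrow> nat \<Rightarrow> nat" where
  "finish D B b k E P idf = finish_step D B b k E P idf ^^ k"

text \<open>Greedy colouring: at most \<open>D\<close> neighbours cannot exclude all
  \<open>D + 1\<close> colours.\<close>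

lemma (in bounded_graph) ex_extends:
  assumes "finite M" "\<And>u. u \<in> M \<Longrightarrow> \<sigma> u = 0"
  shows "\<exists>g. extends D E \<sigma> M g"
  using assms
proof (induction M rule: finite_induct)
  case empty
  then show ?case by (simp add: extends_def)
next
  case (insert x M)
  then obtain g where g: "extends D E \<sigma> M g" by auto
  let ?h = "\<lambda>w. if w \<in> M then g w else \<sigma> w"
  have "card (?h ` (E `` {x})) \<le> card (E `` {x})" by (intro card_image_le) simp
  also have "\<dots> < card {1..D + 1}" using deg[of x] by simp
  finally have "\<not> {1..D + 1} \<subseteq> ?h ` (E `` {x})"
    using card_mono[of "?h ` (E `` {x})" "{1..D + 1}"] by (meson finite_imageI finite_nbs not_le)
  then obtain c where c: "c \<in> {1..D + 1}" "c \<notin> ?h ` (E `` {x})" by blast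
  have cM: "g w \<noteq> c" if "(x, w) \<in> E" "w \<in> M" for w using c(2) that by force
  have cS: "\<sigma> w \<noteq> c" if "(x, w) \<in> E" "\<sigma> w \<noteq> 0" for w
  proof -
    have "w \<notin> M" using insert.prems that(2) by auto
    then show ?thesis using c(2) that(1) by force
  qed
  have "extends D E \<sigma> (insert x M) (g(x := c))"
    unfolding extends_def
  proof (intro ballI conjI allI impI)
    fix u assume u: "u \<in> insert x M"
    show "(g(x := c)) u \<in> {1..D + 1}"
      using u c(1) g by (auto simp: extends_def)
    fix w assume w: "(u, w) \<in> E"
    have uw: "u \<noteq> w" using w irrefl by blast
    show "(g(x := c)) u \<noteq> \<sigma> w" if "\<sigma> w \<noteq> 0"
    proof (cases "u = x")
      case True
      then show ?thesis using cS[of w] w that by auto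
    next
      case False
      then show ?thesis using u w that g unfolding extends_def by auto
    qed
    show "(g(x := c)) u \<noteq> (g(x := c)) w" if wM: "w \<in> insert x M"
    proof (cases "u = x")
      case True
      then show ?thesis using cM[of w] w wM uw by auto
    next
      case False
      then have "u \<in> M" using u by simp
      then show ?thesis using cM[of u] edge_sym[OF w] wM w g uw False unfolding extends_def by auto
    qed
  qed
  then show ?case by blast
qed

context clustering
begin

lemma paint_cluster:
  assumes "\<And>v. v \<in> U \<Longrightarrow> \<sigma> v = 0" "cls b v = Some x"
  shows "\<exists>g. extends D E \<sigma> (members (cls b) x) g \<and>
    (\<forall>u\<in>members (cls b) x. paint D (2 * \<rho> + 2) E \<sigma> (cls b) u = g u)"
proof -
  let ?M = "members (cls b) x"
  have inv: "inv \<rho> (cls b)" using clusters_props[OF order_refl] unfolding \<rho>_def by blast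
  have vU: "v \<in> U" using assms(2) by (intro clustered_in_U) simp
  then obtain W where W: "v \<in> W" "small_region s E U W" using small by blast
  have "?M \<subseteq> W"
  proof
    fix u assume "u \<in> ?M"
    then have "cls b u = Some x" by (simp add: members_def)
    then show "u \<in> W" using small_regionD[OF W(2) inv, of u x] small_regionD[OF W(2) inv assms(2)] W(1) by blast
  qed
  then have "finite ?M" using W(2) finite_subset unfolding small_region_def by blast
  moreover have "\<sigma> u = 0" if "u \<in> ?M" for u
    using that by (intro assms(1) clustered_in_U) (simp add: members_def)
  ultimately have ex: "\<exists>g. extends D E \<sigma> ?M g" by (rule ex_extends)
  let ?g = "SOME g. extends D E \<sigma> ?M g"
  have "extends D E \<sigma> ?M ?g" using ex by (rule someI_ex)
  moreover have "paint D (2 * \<rho> + 2) E \<sigma> (cls b) u = ?g u" if "u \<in> ?M" for u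
  proof -
    have u: "cls b u = Some x" using that by (simp add: members_def)
    then have "{w \<in> ball E u (2 * \<rho> + 2). cls b w = cls b u} = ?M"
      using cluster_eq[of u] by (simp add: members_def)
    then show ?thesis using u by (simp add: paint_def)
  qed
  ultimately show ?thesis by blast
qed

text \<open>Clusters can be painted simultaneously because clustered neighbours always share a
  cluster, and \<open>extends\<close> respects both edges inside the cluster and colours already
  present.\<close>

lemma paint_props:
  assumes z: "\<And>v. v \<in> U \<Longrightarrow> \<sigma> v = 0" and pc: "partial_coloring D E \<sigma>"
  defines "\<tau> \<equiv> paint D (2 * \<rho> + 2) E \<sigma> (cls b)"
  shows "partial_coloring D E \<tau>" "v \<notin> U \<Longrightarrow> \<tau> v = \<sigma> v" "v \<in> U \<Longrightarrow> \<tau> v = 0 \<longleftrightarrow> cls b v = None"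
proof -
  have none: "\<tau> v = \<sigma> v" if "cls b v = None" for v using that by (simp add: \<tau>_def paint_def)
  have some: "\<tau> v \<in> {1..D + 1} \<and> (\<forall>w. (v, w) \<in> E \<longrightarrow> (\<sigma> w \<noteq> 0 \<longrightarrow> \<tau> v \<noteq> \<sigma> w) \<and> (cls b w = Some x \<longrightarrow> \<tau> v \<noteq> \<tau> w))"
    if x: "cls b v = Some x" for v x
  proof -
    obtain g where g: "extends D E \<sigma> (members (cls b) x) g" "\<And>u. u \<in> members (cls b) x \<Longrightarrow> \<tau> u = g u"
      using paint_cluster[of \<sigma>, OF z x] unfolding \<tau>_def by blast
    have "v \<in> members (cls b) x" using x by (simp add: members_def)
    then show ?thesis using g unfolding extends_def by (auto simp: members_def)
  qed
  show out: "\<tau> v = \<sigma> v" if "v \<notin> U" for v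
    using that clustered_in_U none by blast
  show "\<tau> v = 0 \<longleftrightarrow> cls b v = None" if "v \<in> U" for v
    using some[of v] none[of v] z[OF that] by (cases "cls b v") auto
  have "\<tau> v \<le> D + 1" for v
    using some[of v] none[of v] pc by (cases "cls b v") (auto simp: partial_coloring_def)
  moreover have "\<tau> u \<noteq> \<tau> w" if "(u, w) \<in> E" "\<tau> u \<noteq> 0" for u w
  proof (cases "cls b u")
    case None
    then have u: "\<tau> u = \<sigma> u" "\<sigma> u \<noteq> 0" using none that(2) by auto
    then show ?thesis
    proof (cases "cls b w")
      case None
      then show ?thesis using none u that(1) pc by (auto simp: partial_coloring_def)
    next
      case (Some y)
      then show ?thesis using some[OF Some] edge_sym[OF that(1)] u by auto
    qed
  next
    case (Some x)
    then show ?thesis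
    proof (cases "cls b w")
      case None
      then show ?thesis using none[OF None] some[OF Some] that by (cases "\<sigma> w = 0") auto
    next
      case (Some y)
      then have "y = x" using clusters_adjacent[OF that(1) \<open>cls b u = Some x\<close>] by simp
      then show ?thesis using some[OF \<open>cls b u = Some x\<close>] that(1) Some by blast
    qed
  qed
  ultimately show "partial_coloring D E \<tau>" by (auto simp: partial_coloring_def)
qed

end

context finishing
begin

lemma finish_step_props:
  fixes P :: "nat set" and \<sigma> :: "nat \<Rightarrow> nat"
  defines "U \<equiv> {v \<in> P. \<sigma> v = 0}" and "\<tau> \<equiv> finish_step D (2 * (\<mu> * s) + 2) b k E P idf \<sigma>"
  assumes pc: "partial_coloring D E \<sigma>" and small: "\<And>v. v \<in> U \<Longrightarrow> \<exists>W. v \<in> W \<and> small_region s E U W"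
  shows "partial_coloring D E \<tau>" "v \<notin> U \<Longrightarrow> \<tau> v = \<sigma> v"
    "small_region s E U W \<Longrightarrow> 2 * card {v \<in> W. \<tau> v = 0} \<le> card W"
proof -
  interpret clustering V E D idf s k \<mu> b U
    by unfold_locales (rule small)
  have \<tau>: "\<tau> = paint D (2 * \<rho> + 2) E \<sigma> (cls b)"
    unfolding \<tau>_def finish_step_def Let_def U_def[symmetric] \<rho>_def B_def ..
  have z: "\<sigma> v = 0" if "v \<in> U" for v using that by (simp add: U_def)
  note p = paint_props[OF z pc, folded \<tau>]
  show "partial_coloring D E \<tau>" by (rule p(1))
  show "\<tau> v = \<sigma> v" if "v \<notin> U" using p(2) that by blast
  assume W: "small_region s E U W"
  then have "{v \<in> W. \<tau> v = 0} = {v \<in> W. cls b v = None}"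
    using p(3) unfolding small_region_def by blast
  then show "2 * card {v \<in> W. \<tau> v = 0} \<le> card W" using unclustered_half[OF W] by simp
qed

text \<open>Each repetition leaves at most half of every region uncoloured, and the uncoloured part
  is a region for the next repetition; as \<open>s < 2 ^ k\<close>, nothing is left after
  \<open>k\<close> of them.\<close>

lemma finish_props:
  fixes P :: "nat set" and \<sigma> :: "nat \<Rightarrow> nat"
  defines "U \<equiv> {v \<in> P. \<sigma> v = 0}" and "\<tau> \<equiv> finish D (2 * (\<mu> * s) + 2) b k E P idf \<sigma>"
  assumes pc: "partial_coloring D E \<sigma>" and small: "\<And>v. v \<in> U \<Longrightarrow> \<exists>W. v \<in> W \<and> small_region s E U W"
  shows "partial_coloring D E \<tau>" "v \<notin> U \<Longrightarrow> \<tau> v = \<sigma> v" "v \<in> P \<Longrightarrow> \<tau> v \<noteq> 0"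
proof -
  let ?s = "\<lambda>i. (finish_step D (2 * (\<mu> * s) + 2) b k E P idf ^^ i) \<sigma>"
  have main: "partial_coloring D E (?s i) \<and> (\<forall>v. v \<notin> U \<longrightarrow> ?s i v = \<sigma> v) \<and>
      (\<forall>W. small_region s E U W \<longrightarrow> 2 ^ i * card {v \<in> W. ?s i v = 0} \<le> card W)" for i
  proof (induction i)
    case 0
    have "card {v \<in> W. \<sigma> v = 0} \<le> card W" if "small_region s E U W" for W
      using that by (intro card_mono) (auto simp: small_region_def)
    then show ?case using pc by simp
  next
    case (Suc i)
    let ?U = "{v \<in> P. ?s i v = 0}"
    have sub: "?U \<subseteq> U" using Suc.IH by (auto simp: U_def)
    have region: "small_region s E ?U {v \<in> W. ?s i v = 0}" if W: "small_region s E U W" for W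
    proof -
      have "card {v \<in> W. ?s i v = 0} \<le> card W" using W by (intro card_mono) (auto simp: small_region_def)
      moreover have "W \<subseteq> P" using W by (auto simp: small_region_def U_def)
      moreover have "(E \<inter> ?U \<times> ?U) `` {v \<in> W. ?s i v = 0} \<subseteq> {v \<in> W. ?s i v = 0}"
        using W sub unfolding small_region_def by blast
      ultimately show ?thesis using W unfolding small_region_def by auto
    qed
    have sm: "\<exists>W. v \<in> W \<and> small_region s E ?U W" if "v \<in> ?U" for v
    proof -
      have "v \<in> U" using sub that by (rule subsetD)
      then obtain W where W: "v \<in> W" "small_region s E U W" using small[of v] by blast
      from W(1) that have "v \<in> {v \<in> W. ?s i v = 0}" by simp
      then show ?thesis using region[OF W(2)] by (intro exI conjI)
    qed
    have pci: "partial_coloring D E (?s i)" using Suc.IH by blast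
    note step = finish_step_props[OF pci sm]
    have "2 ^ Suc i * card {v \<in> W. ?s (Suc i) v = 0} \<le> card W" if W: "small_region s E U W" for W
    proof -
      have "?s (Suc i) v \<noteq> 0" if "v \<in> W" "?s i v \<noteq> 0" for v
        using step(2)[of v] that by simp
      then have "{v \<in> W. ?s (Suc i) v = 0} = {v \<in> {v \<in> W. ?s i v = 0}. ?s (Suc i) v = 0}" by blast
      then have "2 * card {v \<in> W. ?s (Suc i) v = 0} \<le> card {v \<in> W. ?s i v = 0}"
        using step(3)[OF _ region[OF W]] by simp
      then have "2 ^ i * (2 * card {v \<in> W. ?s (Suc i) v = 0}) \<le> 2 ^ i * card {v \<in> W. ?s i v = 0}"
        by (rule mult_left_mono) simp
      also have "\<dots> \<le> card W" using Suc.IH W by blast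
      finally show ?thesis by (simp add: mult_ac)
    qed
    moreover have "?s (Suc i) v = \<sigma> v" if "v \<notin> U" for v
    proof -
      have "v \<notin> ?U" using that sub by blast
      then have "?s (Suc i) v = ?s i v" using step(2)[of v] by simp
      then show ?thesis using Suc.IH that by simp
    qed
    moreover have "partial_coloring D E (?s (Suc i))" using step(1) by simp
    ultimately show ?case by blast
  qed
  have \<tau>: "\<tau> = ?s k" by (simp add: \<tau>_def finish_def)
  show "partial_coloring D E \<tau>" using main[of k] \<tau> by blast
  show out: "\<tau> v = \<sigma> v" if "v \<notin> U" for v using main[of k] \<tau> that by blast
  show "\<tau> v \<noteq> 0" if "v \<in> P" for v
  proof (cases "v \<in> U")
    case False
    then show ?thesis using out[OF False] that by (simp add: U_def)
  next
    case True
    then obtain W where W: "v \<in> W" "small_region s E U W" using small by blast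
    have "2 ^ k * card {v \<in> W. \<tau> v = 0} \<le> card W" using main[of k] W \<tau> by blast
    also have "\<dots> < 2 ^ k" using W s(2) unfolding small_region_def by linarith
    finally have "card {v \<in> W. \<tau> v = 0} = 0" by simp
    then show ?thesis using W unfolding small_region_def by auto
  qed
qed

end

section \<open>Locality of the algorithm\<close>

lemma agree_val: "agree T E X E' X' v \<Longrightarrow> u \<in> ball E v T \<Longrightarrow> X u = X' u"
  by (simp add: agree_def)

lemma agree_ball: "agree T E X E' X' v \<Longrightarrow> d \<le> T \<Longrightarrow> ball E v d = ball E' v d"
  using agree_mono[of T E X E' X' v d] by (simp add: agree_def)

lemma agree_nb:
  assumes "agree (Suc T) E X E' X' v" "u \<in> ball E v T" "(u, w) \<in> E"
  shows "X w = X' w"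
  using agree_val[OF assms(1) ball_step[OF assms(2,3)]] .

text \<open>Radius 2 is needed since the picks of neighbours depend on their palettes, hence on
  colours two steps away. The state is bundled into one input function to suit
  \<open>loc_comp\<close>.\<close>

lemma loc_trial_state:
  "loc 2 (\<lambda>E (X :: nat \<Rightarrow> (bool \<times> nat) \<times> nat \<times> nat).
     trial D E {v. fst (fst (X v))} (\<lambda>v. snd (fst (X v))) (\<lambda>v. fst (snd (X v))) (\<lambda>v. snd (snd (X v))))"
  unfolding loc_def
proof (intro allI impI)
  fix E E' and X X' :: "nat \<Rightarrow> (bool \<times> nat) \<times> nat \<times> nat" and v
  assume ag: "agree 2 E X E' X' v"
  then have ag': "agree (Suc 1) E X E' X' v" by (simp add: numeral_2_eq_2)
  let ?P = "{v. fst (fst (X v))}" and ?P' = "{v. fst (fst (X' v))}"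
  let ?s = "\<lambda>v. snd (fst (X v))" and ?s' = "\<lambda>v. snd (fst (X' v))"
  let ?y = "\<lambda>v. snd (snd (X v))" and ?y' = "\<lambda>v. snd (snd (X' v))"
  have E: "E `` {u} = E' `` {u}" if "u \<in> ball E v 1" for u
    using agree_Image[OF ag] that ball_mono[of 1 2 E v] by auto
  have X: "X u = X' u" if "u \<in> ball E v 1" for u
    using agree_val[OF ag] that ball_mono[of 1 2 E v] by auto
  have pal: "palette D E ?s u = palette D E' ?s' u" if u: "u \<in> ball E v 1" for u
  proof -
    have "?s ` (E `` {u}) = ?s' ` (E `` {u})"
      using agree_nb[OF ag' u] by (intro image_cong) auto
    then show ?thesis unfolding palette_def using E[OF u] by simp
  qed
  have pick: "pick D E ?s ?y u = pick D E' ?s' ?y' u" if u: "u \<in> ball E v 1" for u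
    using pal[OF u] X[OF u] by (simp add: pick_def)
  have nb: "u \<in> ball E v 1" if "u \<in> E `` {v}" for u
    using that ball_edge[of v u E 1] by simp
  have riv: "rivals E ?P ?s v = rivals E' ?P' ?s' v"
    unfolding rivals_def using E[of v] X nb by auto
  have "u \<in> ball E v 1" if "u \<in> rivals E' ?P' ?s' v" for u
    using that riv nb[of u] by (auto simp: rivals_def)
  then show "trial D E ?P ?s (\<lambda>v. fst (snd (X v))) ?y v = trial D E' ?P' ?s' (\<lambda>v. fst (snd (X' v))) ?y' v"
    unfolding trial_def riv using X pick[of v] pick X[of v] by auto
qed

lemma loc_trial:
  assumes "loc T (\<lambda>E X v. v \<in> P E X)" "loc T S" "loc T A" "loc T Y"
  shows "loc (T + 2) (\<lambda>E X. trial D E (P E X) (S E X) (A E X) (Y E X))"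
  using loc_comp[OF loc_Pair[OF loc_Pair[OF assms(1,2)] loc_Pair[OF assms(3,4)]] loc_trial_state[of D]]
  by simp

lemma loc_trials:
  assumes "loc T (\<lambda>E X v. v \<in> P E X)" "loc T S"
  shows "loc (T + 2 * \<tau>) (\<lambda>E (X :: nat \<Rightarrow> nat \<Rightarrow> nat).
    trials D E (P E X) (S E X) (map (\<lambda>i v. X v i) [j..<j + 2 * \<tau>]))"
  using assms
proof (induction \<tau> arbitrary: T S j)
  case 0
  then show ?case by simp
next
  case (Suc \<tau>)
  have eq: "[j..<j + 2 * Suc \<tau>] = j # Suc j # [j + 2..<j + 2 + 2 * \<tau>]"
    by (simp add: upt_conv_Cons)
  have "loc (T + 2) (\<lambda>E X. trial D E (P E X) (S E X) (\<lambda>v. X v j) (\<lambda>v. X v (Suc j)))"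
    by (intro loc_trial Suc.prems loc_input)
  from Suc.IH[OF loc_mono[OF Suc.prems(1)] this, of "j + 2"]
  have "loc (T + 2 + 2 * \<tau>) (\<lambda>E X. trials D E (P E X) (trial D E (P E X) (S E X) (\<lambda>v. X v j) (\<lambda>v. X v (Suc j)))
      (map (\<lambda>i v. X v i) [j + 2..<j + 2 + 2 * \<tau>]))" by simp
  then show ?case unfolding eq by (simp add: algebra_simps)
qed

lemma agree_proposal:
  assumes "agree 1 E cl E' cl' v" shows "proposal E red cl v = proposal E' red cl' v"
proof -
  have E: "(v, u) \<in> E \<longleftrightarrow> (v, u) \<in> E'" for u using agree_Image[OF assms, of v] by auto
  have "cl u = cl' u" if "(v, u) \<in> E" for u
    using agree_nb[of 0 E cl E' cl' v v] assms that by simp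
  then have "(\<exists>u. (v, u) \<in> E \<and> cl u = Some x) \<longleftrightarrow> (\<exists>u. (v, u) \<in> E' \<and> cl' u = Some x)" for x
    using E by metis
  then have "offers E red cl v = offers E' red cl' v" by (simp add: offers_def)
  moreover have "cl v = cl' v" using agree_val[OF assms] by simp
  ultimately show ?thesis by (simp add: proposal_def)
qed

text \<open>The extra step is for proposals made at the boundary of the ball, which depend on
  neighbours outside it.\<close>

lemma loc_local_carve_step: "loc (1 + R) (\<lambda>E. local_carve_step b R E red)"
  unfolding loc_def
proof (intro allI impI)
  fix E E' and cl cl' :: "nat \<Rightarrow> 'a option" and v assume ag: "agree (1 + R) E cl E' cl' v"
  have ball: "ball E v R = ball E' v R" using agree_ball[OF ag] by simp
  have pr: "proposal E red cl u = proposal E' red cl' u" if "u \<in> ball E v R" for u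
    using agree_at[OF ag that] by (rule agree_proposal)
  have cl: "cl u = cl' u" if "u \<in> ball E v R" for u
    using agree_val[OF ag] that ball_mono[of R "1 + R" E v] by auto
  have "{u \<in> ball E v R. cl u = Some x} = {u \<in> ball E' v R. cl' u = Some x}" for x
    using cl ball by auto
  moreover have "{u \<in> ball E v R. proposal E red cl u = Some x} = {u \<in> ball E' v R. proposal E' red cl' u = Some x}" for x
    using pr ball by auto
  ultimately show "local_carve_step b R E red cl v = local_carve_step b R E' red cl' v"
    unfolding local_carve_step_def using pr[OF ball_refl] cl[OF ball_refl] by (simp only:)
qed

lemma loc_clusters:
  assumes "loc T C" shows "loc (T + j * (n * (1 + R))) (\<lambda>E X. clusters b n R E (C E X) j)"
proof (induction j)
  case 0
  then show ?case using assms by simp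
next
  case (Suc j)
  have "loc (T + j * (n * (1 + R)) + m * (1 + R)) (\<lambda>E X. (local_carve_step b R E (red_bit j) ^^ m) (clusters b n R E (C E X) j))" for m
  proof (induction m)
    case 0
    then show ?case using Suc.IH by simp
  next
    case (Suc m)
    from loc_comp[OF this loc_local_carve_step[of R b "red_bit j"]] show ?case
      by (simp add: algebra_simps)
  qed
  from this[of n] show ?case by (simp add: algebra_simps)
qed

lemma loc_singletons_state:
  "loc R (\<lambda>E (X :: nat \<Rightarrow> bool \<times> nat). singletons E {v. fst (X v)} (\<lambda>v. snd (X v)) R B)"
  unfolding loc_def
proof (intro allI impI)
  fix E E' and X X' :: "nat \<Rightarrow> bool \<times> nat" and v assume ag: "agree R E X E' X' v"
  let ?U = "{v. fst (X v)}" and ?U' = "{v. fst (X' v)}"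
  have X: "X u = X' u" if "u \<in> ball E v R" for u using agree_val[OF ag that] .
  have sub: "ball (E \<inter> ?U \<times> ?U) v i \<subseteq> ball E v i" for i by (rule ball_mono_rel) blast
  have ball: "ball (E \<inter> ?U \<times> ?U) v i = ball (E' \<inter> ?U' \<times> ?U') v i" if "i \<le> R" for i
    using that
  proof (induction i)
    case (Suc i)
    have "(E \<inter> ?U \<times> ?U) `` {x} = (E' \<inter> ?U' \<times> ?U') `` {x}" if "x \<in> ball (E \<inter> ?U \<times> ?U) v i" for x
    proof -
      have x: "x \<in> ball E v i" using sub that by blast
      have le: "ball E v i \<subseteq> ball E v R" "ball E v (Suc i) \<subseteq> ball E v R"
        using ball_mono Suc.prems by auto
      have "E `` {x} = E' `` {x}" using agree_Image[OF ag] x le by blast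
      moreover have "X y = X' y" if "(x, y) \<in> E" for y
        using X ball_step[OF x that] le by blast
      moreover have "X x = X' x" using X x le by blast
      ultimately show ?thesis by (intro set_eqI) (auto simp: Image_singleton_iff set_eq_iff)
    qed
    then have "(E \<inter> ?U \<times> ?U) `` ball (E \<inter> ?U \<times> ?U) v i = (E' \<inter> ?U' \<times> ?U') `` ball (E \<inter> ?U \<times> ?U) v i"
      by blast
    then show ?case using Suc by (simp add: ball_Suc)
  qed simp
  have "snd (X u) = snd (X' u)" if "u \<in> ball (E' \<inter> ?U' \<times> ?U') v R" for u
    using X sub[of R] ball[OF order_refl] that by auto
  then have "modulus E ?U (\<lambda>v. snd (X v)) R v = modulus E' ?U' (\<lambda>v. snd (X' v)) R v"
    unfolding modulus_def ball[OF order_refl] using X[of v] by simp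
  then show "singletons E ?U (\<lambda>v. snd (X v)) R B v = singletons E' ?U' (\<lambda>v. snd (X' v)) R B v"
    unfolding singletons_def label_def using X[of v] by simp
qed

text \<open>The choice is a function of the predicate \<open>extends\<close>, and this predicate
  reads nothing beyond the neighbours of members; equal predicates give equal choices.\<close>

lemma loc_paint_state:
  "loc (Suc R) (\<lambda>E (X :: nat \<Rightarrow> nat \<times> 'x option). paint D R E (\<lambda>v. fst (X v)) (\<lambda>v. snd (X v)))"
  unfolding loc_def
proof (intro allI impI)
  fix E E' and X X' :: "nat \<Rightarrow> nat \<times> 'x option" and v assume ag: "agree (Suc R) E X E' X' v"
  have ball: "ball E v R = ball E' v R" using agree_ball[OF ag] by simp
  have X: "X u = X' u" if "u \<in> ball E v R" for u
    using agree_val[OF ag] that ball_mono[of R "Suc R" E v] by auto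
  let ?M = "{u \<in> ball E v R. snd (X u) = snd (X v)}" and ?M' = "{u \<in> ball E' v R. snd (X' u) = snd (X' v)}"
  have M: "?M = ?M'" using X ball by auto
  have "extends D E (\<lambda>v. fst (X v)) ?M = extends D E' (\<lambda>v. fst (X' v)) ?M"
    unfolding extends_def
  proof (intro ext ball_cong refl conj_cong)
    fix g :: "nat \<Rightarrow> nat" and u assume "u \<in> ?M"
    then have u: "u \<in> ball E v R" by simp
    then have "E `` {u} = E' `` {u}" using agree_Image[OF ag] ball_mono[of R "Suc R" E v] by auto
    moreover have "X w = X' w" if "(u, w) \<in> E" for w by (rule agree_nb[OF ag u that])
    ultimately show "(\<forall>w. (u, w) \<in> E \<longrightarrow> (fst (X w) \<noteq> 0 \<longrightarrow> g u \<noteq> fst (X w)) \<and> (w \<in> ?M \<longrightarrow> g u \<noteq> g w)) \<longleftrightarrow>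
        (\<forall>w. (u, w) \<in> E' \<longrightarrow> (fst (X' w) \<noteq> 0 \<longrightarrow> g u \<noteq> fst (X' w)) \<and> (w \<in> ?M \<longrightarrow> g u \<noteq> g w))"
      by (metis (no_types, lifting) Image_singleton_iff)
  qed
  then show "paint D R E (\<lambda>v. fst (X v)) (\<lambda>v. snd (X v)) v = paint D R E' (\<lambda>v. fst (X' v)) (\<lambda>v. snd (X' v)) v"
    unfolding paint_def M[symmetric] using X[of v] by (simp only: ball_refl)
qed

definition finish_step_radius :: "nat \<Rightarrow> nat \<Rightarrow> nat" where
  "finish_step_radius b k =
     (let n = 2 * b * k; \<rho> = b * n in (2 * \<rho> + 1) + b * (n * (1 + (2 * \<rho> + 2))) + Suc (2 * \<rho> + 2))"

lemma loc_finish_step: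
  assumes P: "loc T (\<lambda>E X v. v \<in> P E X)" and S: "loc T S" and I: "loc T I"
  shows "loc (T + finish_step_radius b k) (\<lambda>E X. finish_step D B b k E (P E X) (I E X) (S E X))"
proof -
  let ?n = "2 * b * k"
  let ?\<rho> = "b * ?n"
  let ?U = "\<lambda>E X. {v \<in> P E X. S E X v = 0}"
  have U: "loc T (\<lambda>E X v. v \<in> P E X \<and> S E X v = 0)"
    using loc_map[OF loc_Pair[OF P S], of "\<lambda>(p, x). p \<and> x = 0"] by simp
  have "loc (T + (2 * ?\<rho> + 1)) (\<lambda>E X. singletons E (?U E X) (I E X) (2 * ?\<rho> + 1) B)"
    using loc_comp[OF loc_Pair[OF U I] loc_singletons_state[of "2 * ?\<rho> + 1" B]] by simp
  from loc_clusters[OF this, of b ?n "2 * ?\<rho> + 2" b]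
  have C: "loc (T + (2 * ?\<rho> + 1) + b * (?n * (1 + (2 * ?\<rho> + 2))))
     (\<lambda>E X. clusters b ?n (2 * ?\<rho> + 2) E (singletons E (?U E X) (I E X) (2 * ?\<rho> + 1) B) b)" .
  have S': "loc (T + (2 * ?\<rho> + 1) + b * (?n * (1 + (2 * ?\<rho> + 2)))) S"
    using S by (rule loc_mono) simp
  from loc_comp[OF loc_Pair[OF S' C] loc_paint_state[of "2 * ?\<rho> + 2" D]]
  show ?thesis by (simp add: finish_step_def finish_step_radius_def Let_def add_ac)
qed

lemma loc_finish:
  assumes P: "loc T (\<lambda>E X v. v \<in> P E X)" and S: "loc T S" and I: "loc T I"
  shows "loc (T + k * finish_step_radius b k) (\<lambda>E X. finish D B b k E (P E X) (I E X) (S E X))"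
proof -
  have "loc (T + i * finish_step_radius b k) (\<lambda>E X. (finish_step D B b k E (P E X) (I E X) ^^ i) (S E X))" for i
  proof (induction i)
    case 0
    then show ?case using S by simp
  next
    case (Suc i)
    have "loc (T + i * finish_step_radius b k) (\<lambda>E X v. v \<in> P E X)" "loc (T + i * finish_step_radius b k) I"
      by (rule loc_mono[OF P], simp) (rule loc_mono[OF I], simp)
    from loc_finish_step[OF this(1) Suc this(2), of b k D B] show ?case
      by (simp add: algebra_simps)
  qed
  then show ?thesis by (simp add: finish_def)
qed

lemma loc_busy:
  assumes "loc T S" shows "loc (T + 1) (\<lambda>E X v. v \<in> {u. c \<le> card (rivals E UNIV (S E X) u)})"
proof -
  have "loc 1 (\<lambda>E \<sigma> v. c \<le> card (rivals E UNIV \<sigma> v))"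
    unfolding loc_def
  proof (intro allI impI)
    fix E E' and \<sigma> \<sigma>' :: "nat \<Rightarrow> nat" and v assume ag: "agree 1 E \<sigma> E' \<sigma>' v"
    have E: "(v, u) \<in> E \<longleftrightarrow> (v, u) \<in> E'" for u using agree_Image[OF ag, of v] by auto
    have "\<sigma> u = \<sigma>' u" if "(v, u) \<in> E" for u
      using agree_nb[of 0 E \<sigma> E' \<sigma>' v v] ag that by simp
    then have "rivals E UNIV \<sigma> v = rivals E' UNIV \<sigma>' v"
      unfolding rivals_def using E by (intro Collect_cong) auto
    then show "(c \<le> card (rivals E UNIV \<sigma> v)) = (c \<le> card (rivals E' UNIV \<sigma>' v))" by simp
  qed
  from loc_comp[OF assms this] show ?thesis by simp
qed

section \<open>The whole algorithm\<close>

text \<open>\<open>H\<close> is frozen after the first trials: with no crowding, degrees inside it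
  stay below \<open>m\<close>, and outside it below \<open>16 * m\<close>. Trials on one side never
  recolour the other, so both sides are shattered before either is finished.\<close>

definition full_coloring ::
  "nat \<Rightarrow> (nat \<times> nat) set \<Rightarrow> nat \<Rightarrow> nat \<Rightarrow> nat \<Rightarrow> nat \<Rightarrow> (nat \<Rightarrow> nat) list \<Rightarrow> (nat \<Rightarrow> nat) list \<Rightarrow>
   (nat \<Rightarrow> nat) list \<Rightarrow> (nat \<Rightarrow> nat) \<Rightarrow> nat \<Rightarrow> nat" where
  "full_coloring D E m B b k z1 z2 z3 idf =
     (let \<sigma>1 = trials D E UNIV (\<lambda>_. 0) z1;
          H = {u. 16 * m \<le> card (rivals E UNIV \<sigma>1 u)};
          \<sigma>3 = trials D E (- H) (trials D E H \<sigma>1 z2) z3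
      in finish D B b k E (- H) idf (finish D B b k E H idf \<sigma>3))"

section \<open>Failure events and the union bound\<close>

lemma card_lists_segment_le:
  fixes \<epsilon> :: real
  assumes "finite Q"
    and seg: "\<And>xs. set xs \<subseteq> Q \<Longrightarrow> length xs = i \<Longrightarrow>
      card {ys. set ys \<subseteq> Q \<and> length ys = j \<and> bad xs ys} \<le> \<epsilon> * card Q ^ j"
  shows "card {zs. set zs \<subseteq> Q \<and> length zs = i + (j + r) \<and> bad (take i zs) (take j (drop i zs))}
    \<le> \<epsilon> * card Q ^ (i + (j + r))"
proof (rule card_lists_append_le[OF assms(1), where bad = "\<lambda>xs ws. bad xs (take j ws)"])
  fix xs assume xs: "set xs \<subseteq> Q" "length xs = i"
  let ?A = "{ys. set ys \<subseteq> Q \<and> length ys = j \<and> bad xs ys}"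
  let ?R = "{ys. set ys \<subseteq> Q \<and> length ys = r}"
  have finR: "finite ?R" using assms(1) by (rule finite_lists_length_eq)
  have finA: "finite ?A"
    by (rule finite_subset[OF _ finite_lists_length_eq[OF assms(1), of j]]) auto
  have "{ws. set ws \<subseteq> Q \<and> length ws = j + r \<and> bad xs (take j ws)} \<subseteq> (\<lambda>(a, b). a @ b) ` (?A \<times> ?R)"
  proof
    fix ws assume "ws \<in> {ws. set ws \<subseteq> Q \<and> length ws = j + r \<and> bad xs (take j ws)}"
    then have "(take j ws, drop j ws) \<in> ?A \<times> ?R"
      by (auto dest: in_set_takeD in_set_dropD)
    then show "ws \<in> (\<lambda>(a, b). a @ b) ` (?A \<times> ?R)" by (rule rev_image_eqI) simp
  qed
  then have "card {ws. set ws \<subseteq> Q \<and> length ws = j + r \<and> bad xs (take j ws)} \<le> card (?A \<times> ?R)"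
    using finA finR by (intro surj_card_le) auto
  also have "\<dots> = card ?A * card Q ^ r"
    using card_lists_length_eq[OF assms(1), of r] by (simp add: card_cartesian_product)
  also have "real \<dots> \<le> \<epsilon> * card Q ^ j * card Q ^ r"
    unfolding of_nat_mult using seg[OF xs] by (intro mult_right_mono) auto
  finally show "card {ws. set ws \<subseteq> Q \<and> length ws = j + r \<and> bad xs (take j ws)} \<le> \<epsilon> * card Q ^ (j + r)"
    by (simp add: power_add mult_ac)
qed

text \<open>The condition is attached to the larger vertex \<open>v\<close>, so the word of
  \<open>u\<close> is already exposed and one residue class modulo \<open>M\<close> remains.\<close>

lemma card_collision_le:
  fixes V :: "nat set" and M q :: nat
  assumes "finite V" "u \<in> V" "v \<in> V" "u < v" "M dvd q" "0 < M"
  shows "card {a \<in> V \<rightarrow>\<^sub>E {..<q}. a v mod M = a u mod M} \<le> 1 / M * real q ^ card V"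
proof -
  have "{a \<in> V \<rightarrow>\<^sub>E {..<q}. a v mod M = a u mod M} = {a \<in> V \<rightarrow>\<^sub>E {..<q}. \<forall>w\<in>V. w = v \<longrightarrow> a v mod M = a u mod M}"
    using assms(3) by auto
  moreover have "card {a \<in> V \<rightarrow>\<^sub>E {..<q}. \<forall>w\<in>V. w = v \<longrightarrow> a v mod M = a u mod M}
      \<le> (\<Prod>w\<in>V. if w = v then 1 / real M else 1) * card {..<q} ^ card V"
  proof (rule card_PiE_sequential_le[OF assms(1)])
    fix w and a a' :: "nat \<Rightarrow> nat" assume eq: "\<And>x. x \<le> w \<Longrightarrow> a x = a' x"
    show "(w = v \<longrightarrow> a v mod M = a u mod M) = (w = v \<longrightarrow> a' v mod M = a' u mod M)"
      using eq[of v] eq[of u] assms(4) by auto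
  next
    fix w and a :: "nat \<Rightarrow> nat"
    let ?a = "\<lambda>x. a(w := x)"
    show "card {x \<in> {..<q}. w = v \<longrightarrow> ?a x v mod M = ?a x u mod M} \<le> (if w = v then 1 / real M else 1) * card {..<q}"
    proof (cases "w = v")
      case True
      have "{x \<in> {..<q}. w = v \<longrightarrow> ?a x v mod M = ?a x u mod M} = {x \<in> {..<q}. x mod M = a u mod M}"
        using True assms(4) by auto
      then have "card {x \<in> {..<q}. w = v \<longrightarrow> ?a x v mod M = ?a x u mod M} \<le> q div M"
        using card_mod_eq_le[OF assms(5,6)] by simp
      then have "card {x \<in> {..<q}. w = v \<longrightarrow> ?a x v mod M = ?a x u mod M} \<le> real (q div M)" by simp
      also have "real (q div M) = 1 / real M * real q"
        using assms(5,6) by (simp add: real_of_nat_div)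
      finally show ?thesis using True by simp
    next
      case False
      then show ?thesis by simp
    qed
  qed auto
  ultimately show ?thesis using assms(1,3) by simp
qed

context bounded_graph
begin

lemma card_not_inj_le:
  fixes M q :: nat
  assumes "M dvd q" "0 < M"
  shows "card {a \<in> V \<rightarrow>\<^sub>E {..<q}. \<not> inj_on (\<lambda>v. a v mod M) V} \<le> real (card V ^ 2) * (1 / M * real q ^ card V)"
proof -
  let ?Q = "V \<rightarrow>\<^sub>E {..<q}" and ?I = "{(u, v) \<in> V \<times> V. u < v}"
  have finQ: "finite ?Q" using fin by (auto intro: finite_PiE)
  have finI: "finite ?I" by (rule finite_subset[of _ "V \<times> V"]) (use fin in auto)
  have "{a \<in> ?Q. \<not> inj_on (\<lambda>v. a v mod M) V} \<subseteq> {a \<in> ?Q. \<exists>i\<in>?I. a (snd i) mod M = a (fst i) mod M}"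
  proof
    fix a assume a: "a \<in> {a \<in> ?Q. \<not> inj_on (\<lambda>v. a v mod M) V}"
    then obtain x y where xy: "x \<in> V" "y \<in> V" "x \<noteq> y" "a x mod M = a y mod M" by (auto simp: inj_on_def)
    have "(min x y, max x y) \<in> ?I" "a (max x y) mod M = a (min x y) mod M"
      using xy by (auto simp: min_def max_def)
    then show "a \<in> {a \<in> ?Q. \<exists>i\<in>?I. a (snd i) mod M = a (fst i) mod M}"
      using a by (auto intro!: bexI[of _ "(min x y, max x y)"])
  qed
  then have "card {a \<in> ?Q. \<not> inj_on (\<lambda>v. a v mod M) V} \<le> card {a \<in> ?Q. \<exists>i\<in>?I. a (snd i) mod M = a (fst i) mod M}"
    using finQ by (intro card_mono) auto
  also have "real \<dots> \<le> real (card V ^ 2) * (1 / M * real q ^ card V)"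
  proof (rule card_exists_le[OF finI finQ])
    show "card {a \<in> ?Q. a (snd i) mod M = a (fst i) mod M} \<le> 1 / M * real q ^ card V" if "i \<in> ?I" for i
      using that by (intro card_collision_le fin assms) auto
    have "card ?I \<le> card (V \<times> V)" using fin by (intro card_mono) auto
    then show "card ?I \<le> card V ^ 2" by (simp add: card_cartesian_product power2_eq_square)
  qed simp
  finally show ?thesis by simp
qed

lemma small_region_component:
  assumes comp: "\<And>v. v \<in> V \<Longrightarrow> card (component (E \<inter> U \<times> U) v) \<le> s" and "0 < s" and v: "v \<in> U"
  shows "\<exists>W. v \<in> W \<and> small_region s E U W"
proof (intro exI conjI)
  let ?F = "E \<inter> U \<times> U"
  let ?W = "component ?F v"
  show "v \<in> ?W" by (simp add: component_def)
  have U: "?W \<subseteq> U" using v by (auto simp: component_def elim: rtranclE)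
  have cl: "?F `` ?W \<subseteq> ?W" by (auto simp: component_def intro: rtrancl_into_rtrancl)
  have "finite ?W \<and> card ?W \<le> s"
  proof (cases "v \<in> V")
    case True
    have "?W \<subseteq> V" using True edges by (auto simp: component_def elim: rtranclE)
    then show ?thesis using comp[OF True] fin finite_subset by blast
  next
    case False
    \<comment> \<open>\<open>U\<close> may contain numbers that are not vertices, such as those in
      the infinite complement of \<open>H\<close>; they are isolated.\<close>
    then have "?W = {v}" using edges by (auto simp: component_def elim: converse_rtranclE)
    then show ?thesis using assms(2) by simp
  qed
  then show "small_region s E U ?W" using U cl by (simp add: small_region_def)
qed

text \<open>Stages working outside a set leave it untouched: the component bound for
  \<open>H\<close> survives the third trials, and the one for \<open>- H\<close> survives the
  finishing of \<open>H\<close>.\<close>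

lemma proper_full_coloring:
  assumes fp: "finishing V E D idf s k m b"
    and H: "H = busy m (trials D E UNIV (\<lambda>_. 0) z1)"
    and \<sigma>2: "\<sigma>2 = trials D E H (trials D E UNIV (\<lambda>_. 0) z1) z2"
    and \<sigma>3: "\<sigma>3 = trials D E (- H) \<sigma>2 z3"
    and c2: "\<And>v. v \<in> V \<Longrightarrow> card (component (E \<inter> {u \<in> H. \<sigma>2 u = 0} \<times> {u \<in> H. \<sigma>2 u = 0}) v) \<le> s"
    and c3: "\<And>v. v \<in> V \<Longrightarrow> card (component (E \<inter> {u \<in> - H. \<sigma>3 u = 0} \<times> {u \<in> - H. \<sigma>3 u = 0}) v) \<le> s"
  shows "proper_coloring V E (D + 1) (full_coloring D E m (2 * (m * s) + 2) b k z1 z2 z3 idf)"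
proof -
  interpret finishing V E D idf s k m b by (rule fp)
  let ?f = "\<lambda>P. finish D (2 * (m * s) + 2) b k E P idf"
  define \<sigma>4 where "\<sigma>4 = ?f H \<sigma>3"
  define \<sigma>5 where "\<sigma>5 = ?f (- H) \<sigma>4"
  have full: "full_coloring D E m (2 * (m * s) + 2) b k z1 z2 z3 idf = \<sigma>5"
    unfolding full_coloring_def Let_def \<sigma>5_def \<sigma>4_def \<sigma>3 \<sigma>2 H busy_def ..
  have "partial_coloring D E (\<lambda>_. 0)" by (auto simp: partial_coloring_def)
  then have pc3: "partial_coloring D E \<sigma>3" unfolding \<sigma>3 \<sigma>2 by (intro partial_coloring_trials)
  have "{v \<in> H. \<sigma>3 v = 0} = {v \<in> H. \<sigma>2 v = 0}" unfolding \<sigma>3 by (auto simp: trials_outside)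
  then have sm4: "\<exists>W. v \<in> W \<and> small_region s E {v \<in> H. \<sigma>3 v = 0} W" if "v \<in> {v \<in> H. \<sigma>3 v = 0}" for v
    using small_region_component[OF c2 s(1)] that by simp
  note f4 = finish_props[where P = H and \<sigma> = \<sigma>3, OF pc3 sm4, folded \<sigma>4_def]
  have pc4: "partial_coloring D E \<sigma>4" by (rule f4(1))
  have eq4: "{v \<in> - H. \<sigma>4 v = 0} = {v \<in> - H. \<sigma>3 v = 0}" using f4(2) by auto
  have sm5: "\<exists>W. v \<in> W \<and> small_region s E {v \<in> - H. \<sigma>4 v = 0} W" if "v \<in> {v \<in> - H. \<sigma>4 v = 0}" for v
    using small_region_component[OF c3 s(1)] that unfolding eq4 by simp
  note f5 = finish_props[where P = "- H" and \<sigma> = \<sigma>4, OF pc4 sm5, folded \<sigma>5_def]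
  have pc5: "partial_coloring D E \<sigma>5" by (rule f5(1))
  have nz: "\<sigma>5 v \<noteq> 0" for v
  proof (cases "v \<in> H")
    case True
    then have "\<sigma>4 v \<noteq> 0" using f4(3) by blast
    then show ?thesis using f5(2)[of v] True by simp
  next
    case False
    then show ?thesis using f5(3)[of v] by blast
  qed
  have "1 \<le> \<sigma>5 v" "\<sigma>5 v \<le> D + 1" for v
    using nz[of v] pc5 by (simp_all add: partial_coloring_def Suc_le_eq)
  moreover have "\<sigma>5 u \<noteq> \<sigma>5 w" if "(u, w) \<in> E" for u w
    using pc5 nz that by (auto simp: partial_coloring_def)
  ultimately show ?thesis unfolding full proper_coloring_def by auto
qed

text \<open>Four events cover all failures: colliding IDs, a vertex crowded after the first trials,
  and a large component inside or outside \<open>H\<close>. Each has frequency at most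
  \<open>card V ^ 2 / 2 ^ m\<close>; the square is dictated by the ID collisions.\<close>

lemma card_failing_lists_le:
  fixes q m \<tau>1 \<tau>2 s k b :: nat
  assumes q: "even q" "(fact (D + 1) :: nat) dvd q" "0 < q" "2 ^ m dvd q" and m: "11 \<le> m"
    and \<tau>1: "(real D + 1) * (15 / 16) ^ \<tau>1 \<le> 1 / 2"
    and \<tau>2: "m * (real (16 * m) + 1) ^ 3 * (3 / 4) ^ \<tau>2 \<le> 1 / 2"
    and s: "s = m * (16 * m + 1) ^ 2" "s < 2 ^ k" and b: "0 < b" "(2 * (m * s) + 2) ^ 2 \<le> 2 ^ b"
  defines "Q \<equiv> V \<rightarrow>\<^sub>E {..<q}"
  shows "card {zs. set zs \<subseteq> Q \<and> length zs = 1 + 2 * \<tau>1 + 2 * \<tau>2 + 2 * \<tau>2 \<and>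
      \<not> proper_coloring V E (D + 1) (full_coloring D E m (2 * (m * s) + 2) b k
        (take (2 * \<tau>1) (drop 1 zs)) (take (2 * \<tau>2) (drop (1 + 2 * \<tau>1) zs))
        (take (2 * \<tau>2) (drop (1 + 2 * \<tau>1 + 2 * \<tau>2) zs)) (\<lambda>v. (zs ! 0) v mod 2 ^ m))}
    \<le> 4 * (card V ^ 2 / 2 ^ m) * card Q ^ (1 + 2 * \<tau>1 + 2 * \<tau>2 + 2 * \<tau>2)"
proof -
  let ?L = "1 + 2 * \<tau>1 + 2 * \<tau>2 + 2 * \<tau>2"
  let ?\<epsilon> = "card V ^ 2 / 2 ^ m :: real"
  let ?U = "\<lambda>P \<sigma> :: nat \<Rightarrow> nat. {u \<in> P. \<sigma> u = 0}"
  define S1 where "S1 z = trials D E UNIV (\<lambda>_. 0) z" for z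
  define bad1 where "bad1 z \<longleftrightarrow> (\<exists>v\<in>V. m \<le> card (rivals E (busy m (S1 z)) (S1 z) v))" for z
  define bad2 where "bad2 P \<sigma> z \<longleftrightarrow> (\<exists>v\<in>V. s < card (component (E \<inter> ?U P (trials D E P \<sigma> z) \<times> ?U P (trials D E P \<sigma> z)) v))"
    for P \<sigma> z
  define H where "H xs = busy m (S1 (take (2 * \<tau>1) (drop 1 xs)))" for xs
  define S2 where "S2 xs = trials D E (H xs) (S1 (take (2 * \<tau>1) (drop 1 xs))) (take (2 * \<tau>2) (drop (1 + 2 * \<tau>1) xs))" for xs
  have finQ: "finite Q" unfolding Q_def using fin by (auto intro: finite_PiE)
  have cardQ: "real (card Q) = real q ^ card V" unfolding Q_def using fin by (simp add: card_PiE)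
  have V2: "card V * (1 / 2) ^ m \<le> ?\<epsilon>"
    by (cases "card V = 0") (auto simp: power_divide divide_right_mono power2_eq_square)
  have half: "card V * x ^ m \<le> ?\<epsilon>" if "0 \<le> x" "x \<le> 1 / 2" for x :: real
  proof -
    have "x ^ m \<le> (1 / 2) ^ m" using that by (intro power_mono) auto
    then have "card V * x ^ m \<le> card V * (1 / 2) ^ m" by (intro mult_left_mono) auto
    then show ?thesis using V2 by linarith
  qed
  let ?Bids = "{zs. set zs \<subseteq> Q \<and> length zs = 0 + (1 + (2 * \<tau>1 + 2 * \<tau>2 + 2 * \<tau>2)) \<and>
      \<not> inj_on (\<lambda>v. (take 1 (drop 0 zs) ! 0) v mod 2 ^ m) V}"
  let ?Bcrowd = "{zs. set zs \<subseteq> Q \<and> length zs = 1 + (2 * \<tau>1 + (2 * \<tau>2 + 2 * \<tau>2)) \<and> bad1 (take (2 * \<tau>1) (drop 1 zs))}"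
  \<comment> \<open>Absence of crowding is part of the event, because only then is the degree inside
    \<open>H\<close> bounded.\<close>
  let ?Bhigh = "{zs. set zs \<subseteq> Q \<and> length zs = (1 + 2 * \<tau>1) + (2 * \<tau>2 + 2 * \<tau>2) \<and>
      \<not> bad1 (take (2 * \<tau>1) (drop 1 (take (1 + 2 * \<tau>1) zs))) \<and>
      bad2 (H (take (1 + 2 * \<tau>1) zs)) (S1 (take (2 * \<tau>1) (drop 1 (take (1 + 2 * \<tau>1) zs)))) (take (2 * \<tau>2) (drop (1 + 2 * \<tau>1) zs))}"
  let ?Blow = "{zs. set zs \<subseteq> Q \<and> length zs = (1 + 2 * \<tau>1 + 2 * \<tau>2) + (2 * \<tau>2 + 0) \<and>
      bad2 (- H (take (1 + 2 * \<tau>1 + 2 * \<tau>2) zs)) (S2 (take (1 + 2 * \<tau>1 + 2 * \<tau>2) zs)) (take (2 * \<tau>2) (drop (1 + 2 * \<tau>1 + 2 * \<tau>2) zs))}"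
  have Bids: "card ?Bids \<le> ?\<epsilon> * card Q ^ (0 + (1 + (2 * \<tau>1 + 2 * \<tau>2 + 2 * \<tau>2)))"
  proof (rule card_lists_segment_le[OF finQ, where bad = "\<lambda>_ ys. \<not> inj_on (\<lambda>v. (ys ! 0) v mod 2 ^ m) V"])
    have "{ys. set ys \<subseteq> Q \<and> length ys = 1 \<and> \<not> inj_on (\<lambda>v. (ys ! 0) v mod 2 ^ m) V}
        \<subseteq> (\<lambda>a. [a]) ` {a \<in> Q. \<not> inj_on (\<lambda>v. a v mod 2 ^ m) V}"
      by (auto simp: length_Suc_conv)
    then have "card {ys. set ys \<subseteq> Q \<and> length ys = 1 \<and> \<not> inj_on (\<lambda>v. (ys ! 0) v mod 2 ^ m) V}
        \<le> card {a \<in> Q. \<not> inj_on (\<lambda>v. a v mod 2 ^ m) V}"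
      using finQ by (intro surj_card_le) auto
    also have "real \<dots> \<le> real (card V ^ 2) * (1 / real (2 ^ m) * real q ^ card V)"
      unfolding Q_def by (intro card_not_inj_le q) simp
    finally show "card {ys. set ys \<subseteq> Q \<and> length ys = 1 \<and> \<not> inj_on (\<lambda>v. (ys ! 0) v mod 2 ^ m) V} \<le> ?\<epsilon> * card Q ^ 1"
      by (simp add: cardQ)
  qed
  have Bcrowd: "card ?Bcrowd \<le> ?\<epsilon> * card Q ^ (1 + (2 * \<tau>1 + (2 * \<tau>2 + 2 * \<tau>2)))"
  proof (rule card_lists_segment_le[OF finQ, where bad = "\<lambda>_ ys. bad1 ys"])
    have "card {ys. set ys \<subseteq> Q \<and> length ys = 2 * \<tau>1 \<and> bad1 ys}
        \<le> card V * ((real D + 1) * (15 / 16) ^ \<tau>1) ^ m * card Q ^ (2 * \<tau>1)"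
      unfolding Q_def bad1_def S1_def by (rule card_trials_crowded_le[OF q(1-3) m])
    also have "\<dots> \<le> ?\<epsilon> * card Q ^ (2 * \<tau>1)"
      using \<tau>1 by (intro mult_right_mono half) auto
    finally show "card {ys. set ys \<subseteq> Q \<and> length ys = 2 * \<tau>1 \<and> bad1 ys} \<le> ?\<epsilon> * card Q ^ (2 * \<tau>1)" .
  qed
  have comp: "card {ys. set ys \<subseteq> Q \<and> length ys = 2 * \<tau>2 \<and> bad2 P \<sigma> ys} \<le> ?\<epsilon> * card Q ^ (2 * \<tau>2)"
    if "\<And>v. v \<in> P \<Longrightarrow> card (rivals E P \<sigma> v) \<le> 16 * m" for P \<sigma>
  proof -
    have "card {ys. set ys \<subseteq> Q \<and> length ys = 2 * \<tau>2 \<and> bad2 P \<sigma> ys}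
        \<le> card V * (m * (real (16 * m) + 1) ^ 3 * (3 / 4) ^ \<tau>2) ^ m * card Q ^ (2 * \<tau>2)"
      unfolding Q_def bad2_def s(1) by (rule card_trials_big_component_le[OF q(1-3) _ that]) (use m in auto)
    also have "\<dots> \<le> ?\<epsilon> * card Q ^ (2 * \<tau>2)"
      using \<tau>2 by (intro mult_right_mono half) auto
    finally show ?thesis .
  qed
  have Bhigh: "card ?Bhigh \<le> ?\<epsilon> * card Q ^ ((1 + 2 * \<tau>1) + (2 * \<tau>2 + 2 * \<tau>2))"
  proof (rule card_lists_segment_le[OF finQ, where bad = "\<lambda>xs ys. \<not> bad1 (take (2 * \<tau>1) (drop 1 xs)) \<and>
      bad2 (H xs) (S1 (take (2 * \<tau>1) (drop 1 xs))) ys"])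
    fix xs :: "(nat \<Rightarrow> nat) list"
    let ?\<sigma> = "S1 (take (2 * \<tau>1) (drop 1 xs))"
    let ?A = "{ys. set ys \<subseteq> Q \<and> length ys = 2 * \<tau>2 \<and> \<not> bad1 (take (2 * \<tau>1) (drop 1 xs)) \<and> bad2 (H xs) ?\<sigma> ys}"
    show "card ?A \<le> ?\<epsilon> * card Q ^ (2 * \<tau>2)"
    proof (cases "bad1 (take (2 * \<tau>1) (drop 1 xs))")
      case True
      then have "?A = {}" by simp
      then have "card ?A = 0" by (metis card.empty)
      then show ?thesis by simp
    next
      case False
      have "card (rivals E (H xs) ?\<sigma> v) \<le> 16 * m" for v
      proof (cases "v \<in> V")
        case True
        then have "card (rivals E (H xs) ?\<sigma> v) < m" using False unfolding bad1_def H_def by auto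
        then show ?thesis by simp
      next
        case False
        then have "rivals E (H xs) ?\<sigma> v = {}" using edges by (auto simp: rivals_def)
        then show ?thesis by simp
      qed
      from comp[of "H xs" ?\<sigma>, OF this] False show ?thesis by simp
    qed
  qed
  have Blow: "card ?Blow \<le> ?\<epsilon> * card Q ^ ((1 + 2 * \<tau>1 + 2 * \<tau>2) + (2 * \<tau>2 + 0))"
  proof (rule card_lists_segment_le[OF finQ, where bad = "\<lambda>xs ys. bad2 (- H xs) (S2 xs) ys"])
    fix xs :: "(nat \<Rightarrow> nat) list"
    show "card {ys. set ys \<subseteq> Q \<and> length ys = 2 * \<tau>2 \<and> bad2 (- H xs) (S2 xs) ys} \<le> ?\<epsilon> * card Q ^ (2 * \<tau>2)"
    proof (rule comp)
      fix v assume v: "v \<in> - H xs"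
      let ?\<sigma> = "S1 (take (2 * \<tau>1) (drop 1 xs))"
      have "rivals E (- H xs) (S2 xs) v \<subseteq> rivals E (- H xs) ?\<sigma> v"
        unfolding S2_def by (rule rivals_trials_subset)
      also have "\<dots> \<subseteq> rivals E UNIV ?\<sigma> v" by (auto simp: rivals_def)
      finally have "card (rivals E (- H xs) (S2 xs) v) \<le> card (rivals E UNIV ?\<sigma> v)"
        by (intro card_mono) auto
      then show "card (rivals E (- H xs) (S2 xs) v) \<le> 16 * m"
        using v by (simp add: H_def busy_def)
    qed
  qed
  let ?Bad = "{zs. set zs \<subseteq> Q \<and> length zs = ?L \<and>
      \<not> proper_coloring V E (D + 1) (full_coloring D E m (2 * (m * s) + 2) b k
        (take (2 * \<tau>1) (drop 1 zs)) (take (2 * \<tau>2) (drop (1 + 2 * \<tau>1) zs))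
        (take (2 * \<tau>2) (drop (1 + 2 * \<tau>1 + 2 * \<tau>2) zs)) (\<lambda>v. (zs ! 0) v mod 2 ^ m))}"
  have "?Bad \<subseteq> ?Bids \<union> ?Bcrowd \<union> ?Bhigh \<union> ?Blow"
  proof (rule subsetI, rule ccontr)
    fix zs assume zs: "zs \<in> ?Bad" and nb: "zs \<notin> ?Bids \<union> ?Bcrowd \<union> ?Bhigh \<union> ?Blow"
    have t1: "take (2 * \<tau>1) (drop 1 (take (1 + 2 * \<tau>1) zs)) = take (2 * \<tau>1) (drop 1 zs)"
      "take (2 * \<tau>1) (drop 1 (take (1 + 2 * \<tau>1 + 2 * \<tau>2) zs)) = take (2 * \<tau>1) (drop 1 zs)"
      "take (2 * \<tau>2) (drop (1 + 2 * \<tau>1) (take (1 + 2 * \<tau>1 + 2 * \<tau>2) zs)) = take (2 * \<tau>2) (drop (1 + 2 * \<tau>1) zs)"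
      by (simp_all add: drop_take)
    have h: "H (take (1 + 2 * \<tau>1) zs) = H zs" "H (take (1 + 2 * \<tau>1 + 2 * \<tau>2) zs) = H zs"
      unfolding H_def t1 by simp_all
    have h2: "S2 (take (1 + 2 * \<tau>1 + 2 * \<tau>2) zs) = S2 zs" unfolding S2_def h(2) t1 ..
    have len: "set zs \<subseteq> Q" "length zs = ?L" using zs by auto
    have nbs: "zs \<notin> ?Bids" "zs \<notin> ?Bcrowd" "zs \<notin> ?Bhigh" "zs \<notin> ?Blow"
      using nb by (simp_all only: Un_iff de_Morgan_disj not_False_eq_True)
    have lens: "length zs = 0 + (1 + (2 * \<tau>1 + 2 * \<tau>2 + 2 * \<tau>2))" "length zs = 1 + (2 * \<tau>1 + (2 * \<tau>2 + 2 * \<tau>2))"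
      "length zs = (1 + 2 * \<tau>1) + (2 * \<tau>2 + 2 * \<tau>2)" "length zs = (1 + 2 * \<tau>1 + 2 * \<tau>2) + (2 * \<tau>2 + 0)"
      using len(2) by simp_all
    have "inj_on (\<lambda>v. (take 1 (drop 0 zs) ! 0) v mod 2 ^ m) V"
      using nbs(1) len(1) lens(1) unfolding mem_Collect_eq by blast
    then have inj: "inj_on (\<lambda>v. (zs ! 0) v mod 2 ^ m) V" by simp
    have n1: "\<not> bad1 (take (2 * \<tau>1) (drop 1 zs))"
      using nbs(2) len(1) lens(2) unfolding mem_Collect_eq by blast
    have n2: "\<not> bad2 (H zs) (S1 (take (2 * \<tau>1) (drop 1 zs))) (take (2 * \<tau>2) (drop (1 + 2 * \<tau>1) zs))"
      using nbs(3) len(1) lens(3) n1 unfolding mem_Collect_eq t1 h by blast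
    have n3: "\<not> bad2 (- H zs) (S2 zs) (take (2 * \<tau>2) (drop (1 + 2 * \<tau>1 + 2 * \<tau>2) zs))"
      using nbs(4) len(1) lens(4) unfolding mem_Collect_eq h h2 by blast
    have "finishing V E D (\<lambda>v. (zs ! 0) v mod 2 ^ m) s k m b"
    proof unfold_locales
      show "0 < s" using s(1) m by simp
    qed (use inj s b m in auto)
    then have "proper_coloring V E (D + 1) (full_coloring D E m (2 * (m * s) + 2) b k
        (take (2 * \<tau>1) (drop 1 zs)) (take (2 * \<tau>2) (drop (1 + 2 * \<tau>1) zs))
        (take (2 * \<tau>2) (drop (1 + 2 * \<tau>1 + 2 * \<tau>2) zs)) (\<lambda>v. (zs ! 0) v mod 2 ^ m))"
    proof (rule proper_full_coloring)
      show "H zs = busy m (trials D E UNIV (\<lambda>_. 0) (take (2 * \<tau>1) (drop 1 zs)))"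
        by (simp add: H_def S1_def)
      show "S2 zs = trials D E (H zs) (trials D E UNIV (\<lambda>_. 0) (take (2 * \<tau>1) (drop 1 zs))) (take (2 * \<tau>2) (drop (1 + 2 * \<tau>1) zs))"
        by (simp add: S2_def S1_def)
      show "card (component (E \<inter> ?U (H zs) (S2 zs) \<times> ?U (H zs) (S2 zs)) v) \<le> s" if "v \<in> V" for v
        using n2 that unfolding bad2_def S2_def by (simp add: not_less)
      show "card (component (E \<inter> ?U (- H zs) (trials D E (- H zs) (S2 zs) (take (2 * \<tau>2) (drop (1 + 2 * \<tau>1 + 2 * \<tau>2) zs)))
          \<times> ?U (- H zs) (trials D E (- H zs) (S2 zs) (take (2 * \<tau>2) (drop (1 + 2 * \<tau>1 + 2 * \<tau>2) zs)))) v) \<le> s" if "v \<in> V" for v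
        using n3 that unfolding bad2_def by (simp add: not_less)
    qed simp
    then show False using zs by simp
  qed
  moreover have finB: "finite {zs. set zs \<subseteq> Q \<and> length zs = l \<and> R zs}" for l R
    by (rule finite_subset[OF _ finite_lists_length_eq[OF finQ, of l]]) auto
  ultimately have "card ?Bad \<le> card (?Bids \<union> ?Bcrowd \<union> ?Bhigh \<union> ?Blow)"
    by (intro card_mono) (simp_all only: finite_Un finB simp_thms)
  also have "\<dots> \<le> card ?Bids + card ?Bcrowd + card ?Bhigh + card ?Blow"
    by (meson add_mono card_Un_le order_refl order_trans)
  finally have "real (card ?Bad) \<le> real (card ?Bids) + real (card ?Bcrowd) + real (card ?Bhigh) + real (card ?Blow)" by linarith
  also have "\<dots> \<le> ?\<epsilon> * real (card Q ^ ?L) + ?\<epsilon> * real (card Q ^ ?L) + ?\<epsilon> * real (card Q ^ ?L) + ?\<epsilon> * real (card Q ^ ?L)"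
  proof (intro add_mono)
    have "card Q ^ (0 + (1 + (2 * \<tau>1 + 2 * \<tau>2 + 2 * \<tau>2))) = card Q ^ ?L" by (rule arg_cong) simp
    with Bids show "real (card ?Bids) \<le> ?\<epsilon> * real (card Q ^ ?L)" by (simp only:)
    have "card Q ^ (1 + (2 * \<tau>1 + (2 * \<tau>2 + 2 * \<tau>2))) = card Q ^ ?L" by (rule arg_cong) simp
    with Bcrowd show "real (card ?Bcrowd) \<le> ?\<epsilon> * real (card Q ^ ?L)" by (simp only:)
    have "card Q ^ ((1 + 2 * \<tau>1) + (2 * \<tau>2 + 2 * \<tau>2)) = card Q ^ ?L" by (rule arg_cong) simp
    with Bhigh show "real (card ?Bhigh) \<le> ?\<epsilon> * real (card Q ^ ?L)" by (simp only:)
    have "card Q ^ ((1 + 2 * \<tau>1 + 2 * \<tau>2) + (2 * \<tau>2 + 0)) = card Q ^ ?L" by (rule arg_cong) simp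
    with Blow show "real (card ?Blow) \<le> ?\<epsilon> * real (card Q ^ ?L)" by (simp only:)
  qed
  also have "\<dots> = 4 * ?\<epsilon> * real (card Q ^ ?L)" by (simp only: algebra_simps)
  finally show ?thesis .
qed

end

section \<open>Parameters\<close>

definition clog :: "nat \<Rightarrow> nat" where
  "clog x = (LEAST l. x \<le> 2 ^ l)"

lemma le_two_power_clog: "x \<le> 2 ^ clog x"
  unfolding clog_def by (rule LeastI[of _ x]) (simp add: less_imp_le)

lemma clog_le:
  assumes "1 \<le> x" shows "real (clog x) \<le> 2 * ln (real x) + 1"
proof (cases "clog x")
  case 0
  then show ?thesis using assms by simp
next
  case (Suc l)
  then have "\<not> x \<le> 2 ^ l" unfolding clog_def using not_less_Least[of l "\<lambda>l. x \<le> 2 ^ l"] by simp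
  then have "real (2 ^ l) \<le> real x" by (simp only: of_nat_le_iff)
  then have "ln (2 ^ l) \<le> ln (real x)" by (subst ln_le_cancel_iff) (use assms in auto)
  then have "real l * ln 2 \<le> ln (real x)" by (simp add: ln_realpow)
  moreover have "real l * (1 / 2) \<le> real l * ln 2" using ln2_ge_two_thirds by (intro mult_left_mono) auto
  ultimately show ?thesis using Suc by simp
qed

text \<open>The working parameter is \<open>m = 2 ^ scale c N\<close>, at least of order
  \<open>c * log N\<close>. The 6 guarantees \<open>m \<ge> 64\<close>, and the 3 keeps the iterated
  logarithms away from degenerate values.\<close>

definition scale :: "nat \<Rightarrow> nat \<Rightarrow> nat" where
  "scale c N = clog (clog (N + 3)) + c + 6"

lemma four_power_le_scale: "4 * N ^ (c + 2) \<le> 2 ^ 2 ^ scale c N"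
proof -
  let ?l = "clog (N + 3)"
  have N: "N \<le> 2 ^ ?l" using le_two_power_clog[of "N + 3"] by simp
  have l: "1 \<le> ?l" using le_two_power_clog[of "N + 3"] by (cases ?l) auto
  have "4 * N ^ (c + 2) \<le> 4 * (2 ^ ?l) ^ (c + 2)" using N by (intro mult_left_mono power_mono) auto
  also have "\<dots> = 2 ^ (2 + ?l * (c + 2))" by (simp add: power_add power_mult)
  also have "2 + ?l * (c + 2) \<le> 2 ^ scale c N"
  proof -
    have "c + 6 \<le> 2 ^ (c + 6)" by (rule less_imp_le) (rule less_exp)
    then have "?l * (c + 6) \<le> 2 ^ clog ?l * 2 ^ (c + 6)" using le_two_power_clog[of ?l] by (rule mult_le_mono[rotated])
    also have "\<dots> = 2 ^ scale c N" by (simp add: scale_def power_add)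
    finally show ?thesis using l by (simp add: algebra_simps)
  qed
  finally show ?thesis by simp
qed

lemma scale_ge: "6 \<le> scale c N"
  by (simp add: scale_def)

text \<open>The quadratic Taylor term gives \<open>1 + x \<le> 2 * exp (sqrt x)\<close>; this turns
  polynomials in log log N into the form of the claimed bound.\<close>

lemma scale_le:
  fixes c N :: nat
  defines "x \<equiv> ln (ln (real N + 3))"
  shows "0 \<le> x" "real (scale c N) \<le> 2 * (real c + 10) * exp (sqrt x)"
proof -
  have "exp 1 \<le> (3::real)" using exp_le by simp
  then have "ln (exp 1) \<le> ln (real N + 3)" by (subst ln_le_cancel_iff) auto
  then have y: "1 \<le> ln (real N + 3)" by simp
  then show x: "0 \<le> x" by (simp add: x_def)
  have "real (clog (N + 3)) \<le> 2 * ln (real N + 3) + 1" using clog_le[of "N + 3"] by simp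
  also have "\<dots> \<le> 4 * ln (real N + 3)" using y by simp
  finally have l: "real (clog (N + 3)) \<le> 4 * ln (real N + 3)" .
  have l1: "1 \<le> clog (N + 3)" using le_two_power_clog[of "N + 3"] by (cases "clog (N + 3)") auto
  have "ln (real (clog (N + 3))) \<le> ln (4 * ln (real N + 3))"
    using l l1 y by (subst ln_le_cancel_iff) auto
  also have "\<dots> = ln 4 + x" using y by (simp add: x_def ln_mult)
  also have "ln (4::real) = 2 * ln 2" using ln_realpow[of 2 2] by simp
  also have "\<dots> \<le> 3 / 2" using ln2_le_25_over_36 by simp
  finally have "real (clog (clog (N + 3))) \<le> 4 + 2 * x" using clog_le[OF l1] by simp
  then have "real (scale c N) \<le> real c + 10 + 2 * x" by (simp add: scale_def)
  also have "\<dots> \<le> (real c + 10) * (1 + x)" using x by (simp add: algebra_simps)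
  also have "\<dots> \<le> (real c + 10) * (2 * exp (sqrt x))"
  proof (rule mult_left_mono)
    have "1 + sqrt x + (sqrt x)\<^sup>2 / 2 \<le> exp (sqrt x)"
      using exp_lower_Taylor_quadratic[of "sqrt x"] x by simp
    moreover have "0 \<le> sqrt x" using x by simp
    moreover have "(sqrt x)\<^sup>2 = x" using x by simp
    ultimately show "1 + x \<le> 2 * exp (sqrt x)" by linarith
  qed simp
  finally show "real (scale c N) \<le> 2 * (real c + 10) * exp (sqrt x)" by (simp only: mult_ac)
qed

text \<open>Eleven rounds suffice for a factor 1/2, as (15/16)^11 is below 1/2.\<close>

definition rounds1 :: "nat \<Rightarrow> nat" where "rounds1 D = 11 * (clog (D + 1) + 1)"
text \<open>Three rounds at rate 3/4 more than halve, and for \<open>m = 2 ^ \<kappa>\<close> the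
  sprout factor \<open>m * (16 * m + 1) ^ 3\<close> is at most
  \<open>2 ^ (4 * \<kappa> + 15)\<close>.\<close>

definition rounds2 :: "nat \<Rightarrow> nat" where "rounds2 \<kappa> = 3 * (4 * \<kappa> + 16)"
text \<open>For \<open>m = 2 ^ \<kappa>\<close>, \<open>size_bound m\<close> is at most
  \<open>2 ^ (3 * \<kappa> + 10)\<close>.\<close>

definition halvings :: "nat \<Rightarrow> nat" where "halvings \<kappa> = 3 * \<kappa> + 11"
definition label_bits :: "nat \<Rightarrow> nat" where "label_bits \<kappa> = 8 * \<kappa> + 24"
definition size_bound :: "nat \<Rightarrow> nat" where "size_bound m = m * (16 * m + 1) ^ 2"

lemma rounds1_decay: "(real D + 1) * (15 / 16) ^ rounds1 D \<le> 1 / 2"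
proof -
  let ?e = "clog (D + 1)"
  have "((15 / 16) ^ 11 :: real) \<le> 1 / 2" by (simp add: power_divide)
  then have "((15 / 16) ^ 11) ^ (?e + 1) \<le> (1 / 2 :: real) ^ (?e + 1)" by (intro power_mono) auto
  then have "(15 / 16 :: real) ^ rounds1 D \<le> (1 / 2) ^ (?e + 1)" by (simp only: rounds1_def power_mult)
  moreover have "real D + 1 \<le> 2 ^ ?e"
    using of_nat_mono[OF le_two_power_clog[of "D + 1"], where 'a = real] by simp
  ultimately have "(real D + 1) * (15 / 16) ^ rounds1 D \<le> 2 ^ ?e * (1 / 2) ^ (?e + 1)"
    by (intro mult_mono) auto
  then show ?thesis by (simp add: power_divide)
qed

lemma rounds2_decay: "2 ^ \<kappa> * (real (16 * 2 ^ \<kappa>) + 1) ^ 3 * (3 / 4) ^ rounds2 \<kappa> \<le> 1 / 2"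
proof -
  let ?x = "4 * \<kappa> + 16"
  have "((3 / 4) ^ 3 :: real) \<le> 1 / 2" by (simp add: power_divide)
  then have "((3 / 4) ^ 3) ^ ?x \<le> (1 / 2 :: real) ^ ?x" by (intro power_mono) auto
  then have a: "(3 / 4 :: real) ^ rounds2 \<kappa> \<le> (1 / 2) ^ ?x" by (simp only: rounds2_def power_mult)
  have "(1::real) \<le> 2 ^ \<kappa>" by simp
  then have "16 * 2 ^ \<kappa> + 1 \<le> (32::real) * 2 ^ \<kappa>" by linarith
  then have "real (16 * 2 ^ \<kappa>) + 1 \<le> 2 ^ (\<kappa> + 5)" by (simp add: power_add mult.commute)
  then have "(real (16 * 2 ^ \<kappa>) + 1) ^ 3 \<le> (2 ^ (\<kappa> + 5)) ^ 3" by (intro power_mono) auto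
  then have "2 ^ \<kappa> * (real (16 * 2 ^ \<kappa>) + 1) ^ 3 * (3 / 4) ^ rounds2 \<kappa> \<le> 2 ^ \<kappa> * (2 ^ (\<kappa> + 5)) ^ 3 * (1 / 2) ^ ?x"
    using a by (intro mult_mono) auto
  also have "(2::real) ^ \<kappa> * (2 ^ (\<kappa> + 5)) ^ 3 = 2 ^ (4 * \<kappa> + 15)"
    by (simp add: power_mult[symmetric] power_add[symmetric])
  also have "(2::real) ^ (4 * \<kappa> + 15) * (1 / 2) ^ ?x = 1 / 2"
    by (simp add: power_divide power_add)
  finally show ?thesis .
qed

lemma size_bound_le: "size_bound (2 ^ \<kappa>) < 2 ^ halvings \<kappa>"
proof -
  have "16 * 2 ^ \<kappa> + 1 \<le> (2::nat) ^ (\<kappa> + 5)" using one_le_power[of "2::nat" \<kappa>] by (simp add: power_add)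
  then have "(16 * 2 ^ \<kappa> + 1) ^ 2 \<le> ((2::nat) ^ (\<kappa> + 5)) ^ 2" by (rule power_mono) simp
  then have "size_bound (2 ^ \<kappa>) \<le> 2 ^ \<kappa> * (2 ^ (\<kappa> + 5)) ^ 2"
    unfolding size_bound_def by (rule mult_left_mono) simp
  also have "\<dots> = 2 ^ (3 * \<kappa> + 10)" by (simp add: power_mult[symmetric] power_add[symmetric])
  also have "\<dots> < 2 ^ halvings \<kappa>" by (simp add: halvings_def)
  finally show ?thesis .
qed

lemma label_bits_le: "(2 * (2 ^ \<kappa> * size_bound (2 ^ \<kappa>)) + 2) ^ 2 \<le> 2 ^ label_bits \<kappa>"
proof -
  have "2 * (2 ^ \<kappa> * size_bound (2 ^ \<kappa>)) + 2 \<le> 2 * (2 ^ \<kappa> * 2 ^ halvings \<kappa>)"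
  proof -
    have "2 ^ \<kappa> * size_bound (2 ^ \<kappa>) < 2 ^ \<kappa> * 2 ^ halvings \<kappa>" using size_bound_le[of \<kappa>] by simp
    then show ?thesis by linarith
  qed
  also have "\<dots> = 2 ^ (4 * \<kappa> + 12)" by (simp only: halvings_def power_Suc[symmetric] power_add[symmetric]) simp
  finally have "(2 * (2 ^ \<kappa> * size_bound (2 ^ \<kappa>)) + 2) ^ 2 \<le> (2 ^ (4 * \<kappa> + 12)) ^ 2"
    by (rule power_mono) simp
  also have "\<dots> = 2 ^ label_bits \<kappa>" by (simp add: label_bits_def power_mult[symmetric])
  finally show ?thesis .
qed

definition radius :: "nat \<Rightarrow> nat \<Rightarrow> nat" where
  "radius \<kappa> D = 2 * rounds1 D + 1 + 2 * rounds2 \<kappa> + 2 * rounds2 \<kappa> +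
     halvings \<kappa> * finish_step_radius (label_bits \<kappa>) (halvings \<kappa>) +
     halvings \<kappa> * finish_step_radius (label_bits \<kappa>) (halvings \<kappa>)"

text \<open>Label bits and halvings are linear in \<open>\<kappa>\<close>, so \<open>?\<rho>\<close>
  is cubic, one finishing step is quadratic in \<open>?\<rho>\<close>, and the linearly many
  repetitions give \<open>\<kappa> ^ 7\<close>.\<close>

lemma radius_le:
  assumes "6 \<le> \<kappa>"
  shows "radius \<kappa> D \<le> 22 * clog (D + 1) + 300000000 * \<kappa> ^ 7"
proof -
  let ?b = "label_bits \<kappa>" and ?k = "halvings \<kappa>"
  let ?\<rho> = "?b * (2 * ?b * ?k)"
  have b: "?b \<le> 12 * \<kappa>" and k: "?k \<le> 5 * \<kappa>" using assms by (simp_all add: label_bits_def halvings_def)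
  have "?\<rho> \<le> (12 * \<kappa>) * (2 * (12 * \<kappa>) * (5 * \<kappa>))" by (intro mult_le_mono b k order_refl)
  also have "\<dots> = 1440 * \<kappa> ^ 3" by (simp add: power3_eq_cube)
  finally have \<rho>: "?\<rho> \<le> 1440 * \<kappa> ^ 3" .
  have "1 \<le> ?\<rho>" by (simp add: label_bits_def halvings_def)
  then have \<rho>1: "1 \<le> ?\<rho> ^ 2" "?\<rho> \<le> ?\<rho> ^ 2" by (simp_all add: power2_eq_square)
  have "finish_step_radius ?b ?k = 2 * ?\<rho> ^ 2 + 7 * ?\<rho> + 4"
    by (simp add: finish_step_radius_def Let_def power2_eq_square algebra_simps)
  also have "\<dots> \<le> 13 * ?\<rho> ^ 2" using \<rho>1 by linarith
  also have "\<dots> \<le> 13 * (1440 * \<kappa> ^ 3) ^ 2" using \<rho> by (intro mult_left_mono power_mono) auto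
  also have "\<dots> = 26956800 * \<kappa> ^ 6" by (simp add: power_mult_distrib power_mult[symmetric])
  finally have "?k * finish_step_radius ?b ?k \<le> (5 * \<kappa>) * (26956800 * \<kappa> ^ 6)"
    by (intro mult_le_mono k)
  also have "\<dots> = 134784000 * (\<kappa> * \<kappa> ^ 6)" by simp
  also have "\<kappa> * \<kappa> ^ 6 = \<kappa> ^ 7" using power_add[of \<kappa> 1 6] by simp
  finally have f: "?k * finish_step_radius ?b ?k \<le> 134784000 * \<kappa> ^ 7" .
  have "\<kappa> ^ 1 \<le> \<kappa> ^ 7" using assms by (intro power_increasing) auto
  moreover have "2 * rounds1 D + 1 + 2 * rounds2 \<kappa> + 2 * rounds2 \<kappa> \<le> 22 * clog (D + 1) + 100 * \<kappa>"
    using assms by (simp add: rounds1_def rounds2_def)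
  ultimately show ?thesis using f unfolding radius_def by simp
qed

text \<open>The seventh power moves into the exponent as the factor 7, which \<open>C\<close>
  exceeds; 88 is 22 times the 4 from \<open>clog (D + 1) \<le> 4 * ln (D + 2)\<close>.\<close>

lemma radius_bound:
  fixes c :: nat
  defines "C \<equiv> 88 + 300000000 * (2 * (real c + 10)) ^ 7"
  shows "real (radius (scale c N) D) \<le> C * (ln (real D + 2) + exp (C * sqrt (ln (ln (real N + 3)))))"
proof -
  let ?x = "ln (ln (real N + 3))" and ?\<kappa> = "scale c N"
  let ?K = "300000000 * (2 * (real c + 10)) ^ 7"
  have C: "0 \<le> ?K" "88 \<le> C" "?K \<le> C" by (simp_all add: C_def)
  note x = scale_le(1)[of N] scale_le(2)[of c N]
  have "real (clog (D + 1)) \<le> 2 * ln (real D + 1) + 1" using clog_le[of "D + 1"] by (simp add: add.commute)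
  also have "ln (real D + 1) \<le> ln (real D + 2)" by (subst ln_le_cancel_iff) auto
  also have "1 \<le> 2 * ln (real D + 2)"
  proof -
    have "ln 2 \<le> ln (real D + 2)" by (subst ln_le_cancel_iff) auto
    then show ?thesis using ln2_ge_two_thirds by linarith
  qed
  finally have e: "real (clog (D + 1)) \<le> 4 * ln (real D + 2)" by simp
  have "real ?\<kappa> ^ 7 \<le> (2 * (real c + 10) * exp (sqrt ?x)) ^ 7" using x(2) by (intro power_mono) auto
  also have "\<dots> = (2 * (real c + 10)) ^ 7 * exp (7 * sqrt ?x)"
  proof -
    have "exp (sqrt ?x) ^ 7 = exp (7 * sqrt ?x)" using exp_of_nat_mult[of 7 "sqrt ?x"] by simp
    then show ?thesis by (simp only: power_mult_distrib)
  qed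
  also have "\<dots> \<le> (2 * (real c + 10)) ^ 7 * exp (C * sqrt ?x)"
    using C(2) x(1) by (intro mult_left_mono) (auto intro: mult_right_mono)
  finally have k: "300000000 * real ?\<kappa> ^ 7 \<le> ?K * exp (C * sqrt ?x)" by simp
  have "real (radius ?\<kappa> D) \<le> real (22 * clog (D + 1) + 300000000 * ?\<kappa> ^ 7)"
    using radius_le[of ?\<kappa> D, OF scale_ge] by (simp only: of_nat_le_iff)
  also have "\<dots> \<le> 88 * ln (real D + 2) + ?K * exp (C * sqrt ?x)" using e k by simp
  also have "\<dots> \<le> C * ln (real D + 2) + C * exp (C * sqrt ?x)"
    using C by (intro add_mono mult_right_mono) auto
  finally show ?thesis by (simp add: distrib_left)
qed

section \<open>Assembling locality, randomness and correctness\<close>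

lemma loc_full_coloring:
  fixes D m B b k \<tau>1 \<tau>2 :: nat
  shows "loc (2 * \<tau>1 + 1 + 2 * \<tau>2 + 2 * \<tau>2 + k * finish_step_radius b k + k * finish_step_radius b k)
    (\<lambda>E (X :: nat \<Rightarrow> nat \<Rightarrow> nat). full_coloring D E m B b k (map (\<lambda>i v. X v i) [1..<1 + 2 * \<tau>1])
       (map (\<lambda>i v. X v i) [1 + 2 * \<tau>1..<1 + 2 * \<tau>1 + 2 * \<tau>2])
       (map (\<lambda>i v. X v i) [1 + 2 * \<tau>1 + 2 * \<tau>2..<1 + 2 * \<tau>1 + 2 * \<tau>2 + 2 * \<tau>2]) (\<lambda>v. X v 0 mod 2 ^ m))"
proof -
  let ?z = "\<lambda>X i j. map (\<lambda>i v. X v i) [i..<j :: nat] :: (nat \<Rightarrow> nat) list"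
  define S1 where "S1 E X = trials D E UNIV (\<lambda>_. 0) (?z X 1 (1 + 2 * \<tau>1))" for E X
  define H where "H E X = {u. 16 * m \<le> card (rivals E UNIV (S1 E X) u)}" for E X
  define S2 where "S2 E X = trials D E (H E X) (S1 E X) (?z X (1 + 2 * \<tau>1) (1 + 2 * \<tau>1 + 2 * \<tau>2))" for E X
  define S3 where "S3 E X = trials D E (- H E X) (S2 E X) (?z X (1 + 2 * \<tau>1 + 2 * \<tau>2) (1 + 2 * \<tau>1 + 2 * \<tau>2 + 2 * \<tau>2))" for E X
  define I where "I E X = (\<lambda>v. X v 0 mod 2 ^ m)" for E :: "(nat \<times> nat) set" and X :: "nat \<Rightarrow> nat \<Rightarrow> nat"
  define S4 where "S4 E X = finish D B b k E (H E X) (I E X) (S3 E X)" for E X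
  let ?T3 = "2 * \<tau>1 + 1 + 2 * \<tau>2 + 2 * \<tau>2"
  have "loc (0 + 2 * \<tau>1) S1" unfolding S1_def by (rule loc_trials) (simp_all add: loc_const)
  then have L1: "loc (2 * \<tau>1) S1" by simp
  then have LH: "loc (2 * \<tau>1 + 1) (\<lambda>E X v. v \<in> H E X)" unfolding H_def by (rule loc_busy)
  then have LnH: "loc (2 * \<tau>1 + 1) (\<lambda>E X v. v \<in> - H E X)" using loc_map[OF LH, of Not] by simp
  have L2: "loc (2 * \<tau>1 + 1 + 2 * \<tau>2) S2" unfolding S2_def
    by (rule loc_trials[OF LH]) (rule loc_mono[OF L1], simp)
  have L3: "loc ?T3 S3" unfolding S3_def
    by (rule loc_trials[OF loc_mono[OF LnH] L2]) simp
  have LI: "loc T I" for T unfolding I_def by (rule loc_input)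
  have L4: "loc (?T3 + k * finish_step_radius b k) S4" unfolding S4_def
    by (rule loc_finish[OF loc_mono[OF LH] L3 LI]) simp
  have "loc (?T3 + k * finish_step_radius b k + k * finish_step_radius b k)
      (\<lambda>E X. finish D B b k E (- H E X) (I E X) (S4 E X))"
    by (rule loc_finish[OF loc_mono[OF LnH] L4 LI]) simp
  then show ?thesis
    unfolding full_coloring_def Let_def S4_def S3_def S2_def H_def S1_def I_def .
qed

lemma map_upt_eq_segment:
  assumes "j + l \<le> length zs"
  shows "map (\<lambda>i v. if i < length zs then (zs ! i) v else 0) [j..<j + l] = take l (drop j zs)"
  using assms by (intro nth_equalityI) (auto simp: fun_eq_iff)

lemma bounded_graph_max_degree:
  assumes "simple_graph V E" shows "bounded_graph V E (max_degree V E)"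
proof
  show "finite V" "E \<subseteq> V \<times> V" "sym E" "(v, v) \<notin> E" for v using assms by (auto simp: simple_graph_def)
  fix v
  have eq: "E `` {v} = {u. (v, u) \<in> E}" by auto
  show "card (E `` {v}) \<le> max_degree V E"
  proof (cases "v \<in> V")
    case True
    then have "degree E v \<le> max_degree V E"
      unfolding max_degree_def using \<open>finite V\<close> by (intro Max_ge) auto
    then show ?thesis by (simp add: degree_def eq)
  next
    case False
    then have "E `` {v} = {}" using \<open>E \<subseteq> V \<times> V\<close> by auto
    then show ?thesis by simp
  qed
qed

lemma proper_coloring_cong:
  assumes "E \<subseteq> V \<times> V" "\<And>v. v \<in> V \<Longrightarrow> f v = g v"
  shows "proper_coloring V E k f = proper_coloring V E k g"
proof -
  have "\<forall>(u, w)\<in>E. f u = g u \<and> f w = g w" using assms by blast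
  then show ?thesis unfolding proper_coloring_def using assms(2) by fastforce
qed

theorem theorem7:
  shows "\<forall>c::nat. \<exists>(T :: nat \<Rightarrow> nat \<Rightarrow> nat) (R :: nat \<Rightarrow> nat \<Rightarrow> nat)
            (f :: nat \<Rightarrow> nat \<Rightarrow> view \<Rightarrow> nat) (C :: real).
     C > 0 \<and>
     (\<forall>N D. R N D > 0 \<and>
        real (T N D) \<le> C * (ln (real D + 2) + exp (C * sqrt (ln (ln (real N + 3)))))) \<and>
     (\<forall>V E N. simple_graph V E \<and> card V \<le> N \<longrightarrow>
        success_prob T R f V E N \<ge> 1 - 1 / real (card V) ^ c)"
proof
  fix c :: nat
  define m where "m N = (2::nat) ^ scale c N" for N
  \<comment> \<open>Evenness makes the activity coins fair, the factorial makes picks uniform for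
    every palette size up to \<open>D + 1\<close>, and \<open>2 ^ m N\<close> makes the IDs
    uniform.\<close>
  define q where "q N D = (2 * fact (D + 1) * 2 ^ m N :: nat)" for N D
  define L where "L N D = 1 + 2 * rounds1 D + 2 * rounds2 (scale c N) + 2 * rounds2 (scale c N)" for N D
  define T where "T N D = radius (scale c N) D" for N D
  define R where "R N D = q N D ^ L N D" for N D
  have q0: "0 < q N D" for N D by (simp add: q_def)
  \<comment> \<open>Each vertex draws a single number; a bijection unpacks it into a list of
    \<open>L N D\<close> independent words.\<close>
  have "\<exists>\<beta>. bij_betw \<beta> {..<R N D} {xs. set xs \<subseteq> {..<q N D} \<and> length xs = L N D}" for N D
    by (rule finite_same_card_bij) (simp_all add: finite_lists_length_eq card_lists_length_eq R_def)
  then obtain \<beta> where \<beta>: "\<And>N D. bij_betw (\<beta> N D) {..<R N D} {xs. set xs \<subseteq> {..<q N D} \<and> length xs = L N D}"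
    by metis
  define dig where "dig N D x i = (if i < L N D then \<beta> N D x ! i else 0)" for N D x i
  define alg where "alg N D E (X :: nat \<Rightarrow> nat \<Rightarrow> nat) =
     (let \<tau>1 = rounds1 D; \<tau>2 = rounds2 (scale c N) in
     full_coloring D E (m N) (2 * (m N * size_bound (m N)) + 2) (label_bits (scale c N)) (halvings (scale c N))
       (map (\<lambda>i v. X v i) [1..<1 + 2 * \<tau>1])
       (map (\<lambda>i v. X v i) [1 + 2 * \<tau>1..<1 + 2 * \<tau>1 + 2 * \<tau>2])
       (map (\<lambda>i v. X v i) [1 + 2 * \<tau>1 + 2 * \<tau>2..<1 + 2 * \<tau>1 + 2 * \<tau>2 + 2 * \<tau>2]) (\<lambda>v. X v 0 mod 2 ^ m N))"
    for N D E X
  have loc_alg: "loc (T N D) (alg N D)" for N D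
    unfolding alg_def T_def radius_def Let_def by (rule loc_full_coloring)
  have "loc (0 + T N D) (\<lambda>E r. alg N D E (\<lambda>v. dig N D (r v)))" for N D
    by (rule loc_comp[OF loc_input loc_alg])
  then have "\<exists>f. \<forall>E r v. f (local_view E r (T N D) v) = alg N D E (\<lambda>v. dig N D (r v)) v" for N D
    by (intro ex_view_function) simp
  then obtain f where f: "\<And>N D E r v. f N D (local_view E r (T N D) v) = alg N D E (\<lambda>v. dig N D (r v)) v"
    by metis
  let ?C = "88 + 300000000 * (2 * (real c + 10)) ^ 7"
  have time: "real (T N D) \<le> ?C * (ln (real D + 2) + exp (?C * sqrt (ln (ln (real N + 3)))))" for N D
    unfolding T_def by (rule radius_bound)
  have prob: "success_prob T R f V E N \<ge> 1 - 1 / real (card V) ^ c" if G: "simple_graph V E" and N: "card V \<le> N" for V E N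
  proof -
    let ?D = "max_degree V E"
    let ?q = "q N ?D" and ?L = "L N ?D" and ?m = "m N" and ?\<tau>1 = "rounds1 (max_degree V E)" and ?\<tau>2 = "rounds2 (scale c N)"
    let ?A = "V \<rightarrow>\<^sub>E {..<R N ?D}" and ?Q = "V \<rightarrow>\<^sub>E {..<?q}"
    let ?col = "\<lambda>r v. f N ?D (local_view E r (T N ?D) v)"
    let ?good = "{r. proper_coloring V E (?D + 1) (?col r)}"
    interpret bounded_graph V E ?D using G by (rule bounded_graph_max_degree)
    let ?run = "\<lambda>zs. full_coloring ?D E ?m (2 * (?m * size_bound ?m) + 2) (label_bits (scale c N)) (halvings (scale c N))
        (take (2 * ?\<tau>1) (drop 1 zs)) (take (2 * ?\<tau>2) (drop (1 + 2 * ?\<tau>1) zs))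
        (take (2 * ?\<tau>2) (drop (1 + 2 * ?\<tau>1 + 2 * ?\<tau>2) zs)) (\<lambda>v. (zs ! 0) v mod 2 ^ ?m)"
    let ?bad = "{zs. set zs \<subseteq> ?Q \<and> length zs = 1 + 2 * ?\<tau>1 + 2 * ?\<tau>2 + 2 * ?\<tau>2 \<and>
        \<not> proper_coloring V E (?D + 1) (?run zs)}"
    have finQ: "finite ?Q" and finA: "finite ?A" using fin by (auto intro: finite_PiE)
    have A0: "?A \<noteq> {}" using q0 by (auto simp: PiE_eq_empty_iff R_def lessThan_empty_iff)
    have cardA: "card ?A = card ?Q ^ ?L" using fin by (simp add: card_PiE R_def power_mult[symmetric] mult.commute)
    have m11: "11 \<le> ?m"
    proof -
      have "(2::nat) ^ 6 \<le> ?m" unfolding m_def using scale_ge by (intro power_increasing) auto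
      then show ?thesis by simp
    qed
    have bad: "card ?bad \<le> 4 * (card V ^ 2 / 2 ^ ?m) * card ?Q ^ ?L"
      unfolding L_def
    proof (rule card_failing_lists_le)
      show "even ?q" "(fact (?D + 1) :: nat) dvd ?q" "0 < ?q" "2 ^ ?m dvd ?q" by (simp_all add: q_def del: fact_Suc)
      show "11 \<le> ?m" by (rule m11)
      show "(real ?D + 1) * (15 / 16) ^ ?\<tau>1 \<le> 1 / 2" by (rule rounds1_decay)
      show "?m * (real (16 * ?m) + 1) ^ 3 * (3 / 4) ^ ?\<tau>2 \<le> 1 / 2" unfolding m_def using rounds2_decay[of "scale c N"] by simp
      show "size_bound ?m = ?m * (16 * ?m + 1) ^ 2" by (simp add: size_bound_def)
      show "size_bound ?m < 2 ^ halvings (scale c N)" unfolding m_def by (rule size_bound_le)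
      show "0 < label_bits (scale c N)" by (simp add: label_bits_def)
      show "(2 * (?m * size_bound ?m) + 2) ^ 2 \<le> 2 ^ label_bits (scale c N)" unfolding m_def by (rule label_bits_le)
    qed
    \<comment> \<open>Transposition: one list of words per vertex becomes a list of assignments on
      \<open>V\<close>. It is injective, so failing draws are at most as many as failing lists, and
      both sample spaces have the same size.\<close>
    define \<Phi> where "\<Phi> r = map (\<lambda>i. \<lambda>v\<in>V. \<beta> N ?D (r v) ! i) [0..<?L]" for r
    have \<beta>': "set (\<beta> N ?D x) \<subseteq> {..<?q}" "length (\<beta> N ?D x) = ?L" if "x < R N ?D" for x
      using bij_betwE[OF \<beta>[of N ?D]] that by auto
    have \<Phi>Q: "set (\<Phi> r) \<subseteq> ?Q" "length (\<Phi> r) = ?L" if r: "r \<in> ?A" for r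
    proof -
      have "\<beta> N ?D (r v) ! i < ?q" if "v \<in> V" "i < ?L" for v i
      proof -
        have "r v < R N ?D" using PiE_mem[OF r that(1)] by simp
        note b = \<beta>'[OF this]
        have "\<beta> N ?D (r v) ! i \<in> set (\<beta> N ?D (r v))" using b(2) that(2) by (intro nth_mem) simp
        then show ?thesis using b(1) by blast
      qed
      then show "set (\<Phi> r) \<subseteq> ?Q" by (auto simp: \<Phi>_def)
      show "length (\<Phi> r) = ?L" by (simp add: \<Phi>_def)
    qed
    have inj: "inj_on \<Phi> ?A"
    proof (rule inj_onI)
      fix r r' assume r: "r \<in> ?A" "r' \<in> ?A" "\<Phi> r = \<Phi> r'"
      show "r = r'"
      proof (rule PiE_ext[OF r(1,2)])
        fix v assume v: "v \<in> V"
        have rv: "r v < R N ?D" "r' v < R N ?D" using PiE_mem[OF r(1) v] PiE_mem[OF r(2) v] by auto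
        have "\<beta> N ?D (r v) = \<beta> N ?D (r' v)"
        proof (rule nth_equalityI)
          show "length (\<beta> N ?D (r v)) = length (\<beta> N ?D (r' v))" using \<beta>' rv by simp
          fix i assume "i < length (\<beta> N ?D (r v))"
          then have i: "i < ?L" using \<beta>' rv by simp
          have "(\<Phi> r ! i) v = (\<Phi> r' ! i) v" using r(3) by simp
          then show "\<beta> N ?D (r v) ! i = \<beta> N ?D (r' v) ! i" using i v by (simp add: \<Phi>_def)
        qed
        then show "r v = r' v" using bij_betw_imp_inj_on[OF \<beta>] rv by (auto dest: inj_onD)
      qed
    qed
    have col: "?col r v = ?run (\<Phi> r) v" if r: "r \<in> ?A" and v: "v \<in> V" for r v
    proof -
      let ?X = "\<lambda>v i. if i < length (\<Phi> r) then (\<Phi> r ! i) v else 0"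
      \<comment> \<open>Balls around vertices stay in \<open>V\<close>, so it does not matter that
        the draws decode differently outside \<open>V\<close>.\<close>
      have "ball E v i \<subseteq> V" for i using v edges by (intro ball_closed) auto
      moreover have "dig N ?D (r u) = ?X u" if "u \<in> V" for u
        using that by (auto simp: dig_def \<Phi>_def fun_eq_iff)
      ultimately have "agree (T N ?D) E (\<lambda>v. dig N ?D (r v)) E ?X v" by (auto simp: agree_def)
      then have "?col r v = alg N ?D E ?X v" using f loc_alg unfolding loc_def by metis
      also have "alg N ?D E ?X = ?run (\<Phi> r)"
      proof -
        have len: "length (\<Phi> r) = 1 + 2 * ?\<tau>1 + 2 * ?\<tau>2 + 2 * ?\<tau>2" using \<Phi>Q(2)[OF r] by (simp add: L_def)
        have "map (\<lambda>i v. ?X v i) [1..<1 + 2 * ?\<tau>1] = take (2 * ?\<tau>1) (drop 1 (\<Phi> r))"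
          "map (\<lambda>i v. ?X v i) [1 + 2 * ?\<tau>1..<1 + 2 * ?\<tau>1 + 2 * ?\<tau>2] = take (2 * ?\<tau>2) (drop (1 + 2 * ?\<tau>1) (\<Phi> r))"
          "map (\<lambda>i v. ?X v i) [1 + 2 * ?\<tau>1 + 2 * ?\<tau>2..<1 + 2 * ?\<tau>1 + 2 * ?\<tau>2 + 2 * ?\<tau>2] = take (2 * ?\<tau>2) (drop (1 + 2 * ?\<tau>1 + 2 * ?\<tau>2) (\<Phi> r))"
          using len by (intro map_upt_eq_segment; simp)+
        moreover have "(\<lambda>v. ?X v 0 mod 2 ^ ?m) = (\<lambda>v. (\<Phi> r ! 0) v mod 2 ^ ?m)" using len by simp
        ultimately show ?thesis unfolding alg_def Let_def by (simp only:)
      qed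
      finally show ?thesis .
    qed
    have "\<Phi> ` (?A - ?good) \<subseteq> ?bad"
    proof
      fix zs assume "zs \<in> \<Phi> ` (?A - ?good)"
      then obtain r where r: "r \<in> ?A" "\<not> proper_coloring V E (?D + 1) (?col r)" "zs = \<Phi> r" by auto
      have "proper_coloring V E (?D + 1) (?col r) = proper_coloring V E (?D + 1) (?run (\<Phi> r))"
        by (rule proper_coloring_cong[OF edges col[OF r(1)]])
      with r(2) have "\<not> proper_coloring V E (?D + 1) (?run (\<Phi> r))" by blast
      then show "zs \<in> ?bad"
        unfolding r(3) using \<Phi>Q(1)[OF r(1)] \<Phi>Q(2)[OF r(1), unfolded L_def] by blast
    qed
    moreover have "inj_on \<Phi> (?A - ?good)" using inj by (rule inj_on_subset) blast
    moreover have "finite ?bad"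
      by (rule finite_subset[OF _ finite_lists_length_eq[OF finQ, of "1 + 2 * ?\<tau>1 + 2 * ?\<tau>2 + 2 * ?\<tau>2"]]) blast
    ultimately have "card (?A - ?good) \<le> card ?bad" by (intro card_inj_on_le[of \<Phi>])
    then have le: "real (card (?A - ?good)) \<le> 4 * (card V ^ 2 / 2 ^ ?m) * card ?A"
      using bad unfolding cardA by linarith
    \<comment> \<open>The four events cost \<open>4 * card V ^ 2\<close> in total, and the remaining
      \<open>c\<close> powers yield the required exponent.\<close>
    have "card V ^ c * (4 * card V ^ 2) = 4 * card V ^ (c + 2)" by (simp add: power_add power2_eq_square)
    also have "\<dots> \<le> 4 * N ^ (c + 2)" using N by (intro mult_left_mono power_mono) auto
    also have "\<dots> \<le> 2 ^ ?m" unfolding m_def by (rule four_power_le_scale)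
    finally have "real (card V ^ c * (4 * card V ^ 2)) \<le> real (2 ^ ?m)" by (simp only: of_nat_le_iff)
    then have small: "4 * (card V ^ 2 / 2 ^ ?m) \<le> 1 / real (card V) ^ c"
      by (cases "card V = 0") (auto simp: field_simps)
    have "success_prob T R f V E N = card (?A \<inter> ?good) / card ?A"
      unfolding success_prob_def Let_def using finA A0 by (simp add: measure_pmf_of_set)
    also have "real (card (?A \<inter> ?good)) = real (card ?A) - real (card (?A - ?good))"
    proof -
      have "card (?A - ?good) + card (?A \<inter> ?good) = card ?A"
        using finA by (subst card_Un_disjoint[symmetric]) (auto intro: arg_cong[of _ _ card])
      then show ?thesis by linarith
    qed
    also have "\<dots> / card ?A = 1 - card (?A - ?good) / card ?A"
      using finA A0 by (simp add: diff_divide_distrib)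
    also have "\<dots> \<ge> 1 - 4 * (card V ^ 2 / 2 ^ ?m)"
      using le finA A0 by (simp add: divide_le_eq card_gt_0_iff)
    finally show ?thesis using small by linarith
  qed
  have "?C > 0 \<and> (\<forall>N D. R N D > 0 \<and> real (T N D) \<le> ?C * (ln (real D + 2) + exp (?C * sqrt (ln (ln (real N + 3)))))) \<and>
     (\<forall>V E N. simple_graph V E \<and> card V \<le> N \<longrightarrow> success_prob T R f V E N \<ge> 1 - 1 / real (card V) ^ c)"
    using time prob q0 by (simp add: R_def add_pos_nonneg)
  then show "\<exists>(T :: nat \<Rightarrow> nat \<Rightarrow> nat) (R :: nat \<Rightarrow> nat \<Rightarrow> nat)
            (f :: nat \<Rightarrow> nat \<Rightarrow> view \<Rightarrow> nat) (C :: real).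
     C > 0 \<and>
     (\<forall>N D. R N D > 0 \<and>
        real (T N D) \<le> C * (ln (real D + 2) + exp (C * sqrt (ln (ln (real N + 3)))))) \<and>
     (\<forall>V E N. simple_graph V E \<and> card V \<le> N \<longrightarrow>
        success_prob T R f V E N \<ge> 1 - 1 / real (card V) ^ c)"
    by blast
qed

end
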